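(* Let $\mathcal{A}$ be a locally noetherian Grothendieck category, and let $\mathcal{A}$ have enough injective objects. Then there is a one-to-one correspondence between the class of left exact radical functors of $\mathcal{A}$ and $$\mathscr{B}=\{[F]\mid F:\mathcal{A}\to\mathcal{D}\text{ is an exact functor admitting a full and faithful right adjoint functor}\}.$$
   Context: A preradical functor on $\mathcal{A}$ is a subobject $\gamma$ of the identity functor: $\gamma(M)$ is a subobject of $M$ for each object $M$, and for $f:M\to N$ the morphism $\gamma(f)$ is the restriction of $f$ to $\gamma(M)$. It is radical if $\gamma(M/\gamma(M))=0$ for every $M$. For exact functors $F:\mathcal{A}\to\mathcal{D}$ and $F':\mathcal{A}\to\mathcal{D}'$ admitting full and faithful right adjoints, write $F\sim F'$ if there exists a unique (up to natural isomorphism) equivalence $H:\mathcal{D}\to\mathcal{D}'$ such that $H\circ F$ is naturally isomorphic to $F'$. This is an equivalence relation and $[F]$ denotes the class of $F$. *)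

theory Defs
  imports Main "HOL-Library.Equipollence" "HOL-Algebra.Group"
begin

section \<open>Categories\<close>

record ('o, 'm) category =
  Obj :: "'o set"
  Arr :: "'m set"
  Dom :: "'m \<Rightarrow> 'o"
  Cod :: "'m \<Rightarrow> 'o"
  Ident :: "'o \<Rightarrow> 'm"
  Comp :: "'m \<Rightarrow> 'm \<Rightarrow> 'm"

text \<open>\<open>g \<cdot>\<^bsub>C\<^esub> f\<close> is ``\<open>g\<close> after \<open>f\<close>''. The operations are total functions; their values
  outside the carriers (or on pairs that are not composable) are irrelevant.\<close>

abbreviation comp_in :: "'m \<Rightarrow> ('o, 'm) category \<Rightarrow> 'm \<Rightarrow> 'm"
    ("(_ \<cdot>\<^bsub>_\<^esub> _)" [71, 0, 70] 70)
  where "g \<cdot>\<^bsub>C\<^esub> f \<equiv> Comp C g f"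

definition Hom :: "('o, 'm) category \<Rightarrow> 'o \<Rightarrow> 'o \<Rightarrow> 'm set" where
  "Hom C X Y = {f \<in> Arr C. Dom C f = X \<and> Cod C f = Y}"

definition is_category :: "('o, 'm) category \<Rightarrow> bool" where
  "is_category C \<longleftrightarrow>
     (\<forall>f\<in>Arr C. Dom C f \<in> Obj C \<and> Cod C f \<in> Obj C) \<and>
     (\<forall>X\<in>Obj C. Ident C X \<in> Hom C X X) \<and>
     (\<forall>f\<in>Arr C. \<forall>g\<in>Arr C. Cod C f = Dom C g \<longrightarrow> g \<cdot>\<^bsub>C\<^esub> f \<in> Hom C (Dom C f) (Cod C g)) \<and>
     (\<forall>f\<in>Arr C. f \<cdot>\<^bsub>C\<^esub> Ident C (Dom C f) = f \<and> Ident C (Cod C f) \<cdot>\<^bsub>C\<^esub> f = f) \<and>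
     (\<forall>f\<in>Arr C. \<forall>g\<in>Arr C. \<forall>h\<in>Arr C. Cod C f = Dom C g \<longrightarrow> Cod C g = Dom C h \<longrightarrow>
        h \<cdot>\<^bsub>C\<^esub> (g \<cdot>\<^bsub>C\<^esub> f) = (h \<cdot>\<^bsub>C\<^esub> g) \<cdot>\<^bsub>C\<^esub> f)"

definition monic :: "('o, 'm) category \<Rightarrow> 'm \<Rightarrow> bool" where
  "monic C f \<longleftrightarrow> f \<in> Arr C \<and>
     (\<forall>g\<in>Arr C. \<forall>h\<in>Arr C. Dom C g = Dom C h \<longrightarrow> Cod C g = Dom C f \<longrightarrow> Cod C h = Dom C f \<longrightarrow>
        f \<cdot>\<^bsub>C\<^esub> g = f \<cdot>\<^bsub>C\<^esub> h \<longrightarrow> g = h)"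

definition epic :: "('o, 'm) category \<Rightarrow> 'm \<Rightarrow> bool" where
  "epic C f \<longleftrightarrow> f \<in> Arr C \<and>
     (\<forall>g\<in>Arr C. \<forall>h\<in>Arr C. Cod C g = Cod C h \<longrightarrow> Dom C g = Cod C f \<longrightarrow> Dom C h = Cod C f \<longrightarrow>
        g \<cdot>\<^bsub>C\<^esub> f = h \<cdot>\<^bsub>C\<^esub> f \<longrightarrow> g = h)"

definition iso_arr :: "('o, 'm) category \<Rightarrow> 'm \<Rightarrow> bool" where
  "iso_arr C f \<longleftrightarrow> f \<in> Arr C \<and>
     (\<exists>g\<in>Hom C (Cod C f) (Dom C f).
        g \<cdot>\<^bsub>C\<^esub> f = Ident C (Dom C f) \<and> f \<cdot>\<^bsub>C\<^esub> g = Ident C (Cod C f))"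

definition zero_obj :: "('o, 'm) category \<Rightarrow> 'o \<Rightarrow> bool" where
  "zero_obj C Z \<longleftrightarrow> Z \<in> Obj C \<and>
     (\<forall>X\<in>Obj C. (\<exists>!f. f \<in> Hom C X Z) \<and> (\<exists>!f. f \<in> Hom C Z X))"

definition zero_arr :: "('o, 'm) category \<Rightarrow> 'm \<Rightarrow> bool" where
  "zero_arr C f \<longleftrightarrow> f \<in> Arr C \<and>
     (\<exists>Z. zero_obj C Z \<and> (\<exists>g\<in>Hom C (Dom C f) Z. \<exists>h\<in>Hom C Z (Cod C f). f = h \<cdot>\<^bsub>C\<^esub> g))"

definition is_kernel :: "('o, 'm) category \<Rightarrow> 'm \<Rightarrow> 'm \<Rightarrow> bool" where
  "is_kernel C k f \<longleftrightarrow> k \<in> Arr C \<and> f \<in> Arr C \<and> Cod C k = Dom C f \<and> zero_arr C (f \<cdot>\<^bsub>C\<^esub> k) \<and>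
     (\<forall>h\<in>Arr C. Cod C h = Dom C f \<longrightarrow> zero_arr C (f \<cdot>\<^bsub>C\<^esub> h) \<longrightarrow>
        (\<exists>!u. u \<in> Hom C (Dom C h) (Dom C k) \<and> k \<cdot>\<^bsub>C\<^esub> u = h))"

definition is_cokernel :: "('o, 'm) category \<Rightarrow> 'm \<Rightarrow> 'm \<Rightarrow> bool" where
  "is_cokernel C p f \<longleftrightarrow> p \<in> Arr C \<and> f \<in> Arr C \<and> Dom C p = Cod C f \<and> zero_arr C (p \<cdot>\<^bsub>C\<^esub> f) \<and>
     (\<forall>h\<in>Arr C. Dom C h = Cod C f \<longrightarrow> zero_arr C (h \<cdot>\<^bsub>C\<^esub> f) \<longrightarrow>
        (\<exists>!u. u \<in> Hom C (Cod C p) (Cod C h) \<and> u \<cdot>\<^bsub>C\<^esub> p = h))"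

text \<open>Exactness of \<open>0 \<rightarrow> X \<rightarrow> Y \<rightarrow> Z \<rightarrow> 0\<close>; exactness of \<open>0 \<rightarrow> X \<rightarrow> Y \<rightarrow> Z\<close> is \<^const>\<open>is_kernel\<close>.\<close>

definition short_exact :: "('o, 'm) category \<Rightarrow> 'm \<Rightarrow> 'm \<Rightarrow> bool" where
  "short_exact C f g \<longleftrightarrow> is_kernel C f g \<and> is_cokernel C g f"

definition is_product :: "('o, 'm) category \<Rightarrow> 'o \<Rightarrow> 'o \<Rightarrow> 'o \<Rightarrow> 'm \<Rightarrow> 'm \<Rightarrow> bool" where
  "is_product C X Y P p q \<longleftrightarrow> p \<in> Hom C P X \<and> q \<in> Hom C P Y \<and>
     (\<forall>W\<in>Obj C. \<forall>f\<in>Hom C W X. \<forall>g\<in>Hom C W Y.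
        \<exists>!u. u \<in> Hom C W P \<and> p \<cdot>\<^bsub>C\<^esub> u = f \<and> q \<cdot>\<^bsub>C\<^esub> u = g)"

definition preadditive :: "('o, 'm) category \<Rightarrow> bool" where
  "preadditive C \<longleftrightarrow> (\<exists>add zer.
     (\<forall>X\<in>Obj C. \<forall>Y\<in>Obj C.
        comm_group \<lparr>carrier = Hom C X Y, mult = add, one = zer X Y\<rparr>) \<and>
     (\<forall>X\<in>Obj C. \<forall>Y\<in>Obj C. \<forall>Z\<in>Obj C. \<forall>f\<in>Hom C X Y. \<forall>f'\<in>Hom C X Y. \<forall>g\<in>Hom C Y Z. \<forall>g'\<in>Hom C Y Z.
        g \<cdot>\<^bsub>C\<^esub> add f f' = add (g \<cdot>\<^bsub>C\<^esub> f) (g \<cdot>\<^bsub>C\<^esub> f') \<and>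
        add g g' \<cdot>\<^bsub>C\<^esub> f = add (g \<cdot>\<^bsub>C\<^esub> f) (g' \<cdot>\<^bsub>C\<^esub> f)))"

text \<open>In the presence of a zero object and binary products the additive structure is unique, so it is
  not part of the data. In a preadditive category binary products are biproducts.\<close>

definition abelian :: "('o, 'm) category \<Rightarrow> bool" where
  "abelian C \<longleftrightarrow> is_category C \<and> preadditive C \<and>
     (\<exists>Z. zero_obj C Z) \<and>
     (\<forall>X\<in>Obj C. \<forall>Y\<in>Obj C. \<exists>P p q. is_product C X Y P p q) \<and>
     (\<forall>f\<in>Arr C. (\<exists>k. is_kernel C k f) \<and> (\<exists>p. is_cokernel C p f)) \<and>
     (\<forall>f. monic C f \<longrightarrow> (\<exists>g. is_kernel C f g)) \<and>
     (\<forall>f. epic C f \<longrightarrow> (\<exists>g. is_cokernel C f g))"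

definition injective_obj :: "('o, 'm) category \<Rightarrow> 'o \<Rightarrow> bool" where
  "injective_obj C E \<longleftrightarrow> E \<in> Obj C \<and>
     (\<forall>i f. monic C i \<longrightarrow> f \<in> Hom C (Dom C i) E \<longrightarrow> (\<exists>g\<in>Hom C (Cod C i) E. g \<cdot>\<^bsub>C\<^esub> i = f))"

definition enough_injectives :: "('o, 'm) category \<Rightarrow> bool" where
  "enough_injectives C \<longleftrightarrow>
     (\<forall>X\<in>Obj C. \<exists>E i. injective_obj C E \<and> i \<in> Hom C X E \<and> monic C i)"

section \<open>Functors and natural transformations\<close>

record ('o, 'm, 'p, 'n) fctr =
  Src :: "('o, 'm) category"
  Tgt :: "('p, 'n) category"
  on_obj :: "'o \<Rightarrow> 'p"
  on_arr :: "'m \<Rightarrow> 'n"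

definition is_functor :: "('o, 'm, 'p, 'n) fctr \<Rightarrow> bool" where
  "is_functor F \<longleftrightarrow> is_category (Src F) \<and> is_category (Tgt F) \<and>
     (\<forall>X\<in>Obj (Src F). on_obj F X \<in> Obj (Tgt F)) \<and>
     (\<forall>f\<in>Arr (Src F).
        on_arr F f \<in> Hom (Tgt F) (on_obj F (Dom (Src F) f)) (on_obj F (Cod (Src F) f))) \<and>
     (\<forall>X\<in>Obj (Src F). on_arr F (Ident (Src F) X) = Ident (Tgt F) (on_obj F X)) \<and>
     (\<forall>f\<in>Arr (Src F). \<forall>g\<in>Arr (Src F). Cod (Src F) f = Dom (Src F) g \<longrightarrow>
        on_arr F (g \<cdot>\<^bsub>Src F\<^esub> f) = on_arr F g \<cdot>\<^bsub>Tgt F\<^esub> on_arr F f)"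

definition id_functor :: "('o, 'm) category \<Rightarrow> ('o, 'm, 'o, 'm) fctr" where
  "id_functor C = \<lparr>Src = C, Tgt = C, on_obj = (\<lambda>X. X), on_arr = (\<lambda>f. f)\<rparr>"

definition comp_functor ::
    "('p, 'n, 'q, 'l) fctr \<Rightarrow> ('o, 'm, 'p, 'n) fctr \<Rightarrow> ('o, 'm, 'q, 'l) fctr" where
  "comp_functor G F = \<lparr>Src = Src F, Tgt = Tgt G,
     on_obj = (\<lambda>X. on_obj G (on_obj F X)), on_arr = (\<lambda>f. on_arr G (on_arr F f))\<rparr>"

definition nat_trans ::
    "('o, 'm, 'p, 'n) fctr \<Rightarrow> ('o, 'm, 'p, 'n) fctr \<Rightarrow> ('o \<Rightarrow> 'n) \<Rightarrow> bool" where
  "nat_trans F G \<eta> \<longleftrightarrow> is_functor F \<and> is_functor G \<and> Src F = Src G \<and> Tgt F = Tgt G \<and>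
     (\<forall>X\<in>Obj (Src F). \<eta> X \<in> Hom (Tgt F) (on_obj F X) (on_obj G X)) \<and>
     (\<forall>f\<in>Arr (Src F). on_arr G f \<cdot>\<^bsub>Tgt F\<^esub> \<eta> (Dom (Src F) f) = \<eta> (Cod (Src F) f) \<cdot>\<^bsub>Tgt F\<^esub> on_arr F f)"

definition nat_iso ::
    "('o, 'm, 'p, 'n) fctr \<Rightarrow> ('o, 'm, 'p, 'n) fctr \<Rightarrow> ('o \<Rightarrow> 'n) \<Rightarrow> bool" where
  "nat_iso F G \<eta> \<longleftrightarrow> nat_trans F G \<eta> \<and> (\<forall>X\<in>Obj (Src F). iso_arr (Tgt F) (\<eta> X))"

definition nat_isomorphic :: "('o, 'm, 'p, 'n) fctr \<Rightarrow> ('o, 'm, 'p, 'n) fctr \<Rightarrow> bool" where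
  "nat_isomorphic F G \<longleftrightarrow> (\<exists>\<eta>. nat_iso F G \<eta>)"

definition is_equivalence :: "('o, 'm, 'p, 'n) fctr \<Rightarrow> bool" where
  "is_equivalence H \<longleftrightarrow> is_functor H \<and>
     (\<exists>K. is_functor K \<and> Src K = Tgt H \<and> Tgt K = Src H \<and>
        nat_isomorphic (comp_functor K H) (id_functor (Src H)) \<and>
        nat_isomorphic (comp_functor H K) (id_functor (Tgt H)))"

definition full_faithful :: "('o, 'm, 'p, 'n) fctr \<Rightarrow> bool" where
  "full_faithful F \<longleftrightarrow> is_functor F \<and>
     (\<forall>X\<in>Obj (Src F). \<forall>Y\<in>Obj (Src F).
        bij_betw (on_arr F) (Hom (Src F) X Y) (Hom (Tgt F) (on_obj F X) (on_obj F Y)))"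

definition right_adjoint :: "('o, 'm, 'p, 'n) fctr \<Rightarrow> ('p, 'n, 'o, 'm) fctr \<Rightarrow> bool" where
  "right_adjoint F G \<longleftrightarrow> is_functor F \<and> is_functor G \<and> Src G = Tgt F \<and> Tgt G = Src F \<and>
     (\<exists>\<eta> \<epsilon>. nat_trans (id_functor (Src F)) (comp_functor G F) \<eta> \<and>
            nat_trans (comp_functor F G) (id_functor (Tgt F)) \<epsilon> \<and>
            (\<forall>X\<in>Obj (Src F).
               \<epsilon> (on_obj F X) \<cdot>\<^bsub>Tgt F\<^esub> on_arr F (\<eta> X) = Ident (Tgt F) (on_obj F X)) \<and>
            (\<forall>Y\<in>Obj (Tgt F).
               on_arr G (\<epsilon> Y) \<cdot>\<^bsub>Src F\<^esub> \<eta> (on_obj G Y) = Ident (Src F) (on_obj G Y)))"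

text \<open>Additivity need not be demanded in the next two definitions: a functor between abelian categories
  that preserves exactness of \<open>0 \<rightarrow> X \<rightarrow> Y \<rightarrow> Z\<close>, or of short exact sequences, preserves zero objects
  and split exact sequences, hence biproducts.\<close>

definition left_exact :: "('o, 'm, 'p, 'n) fctr \<Rightarrow> bool" where
  "left_exact F \<longleftrightarrow> is_functor F \<and> abelian (Src F) \<and> abelian (Tgt F) \<and>
     (\<forall>k f. is_kernel (Src F) k f \<longrightarrow> is_kernel (Tgt F) (on_arr F k) (on_arr F f))"

definition exact :: "('o, 'm, 'p, 'n) fctr \<Rightarrow> bool" where
  "exact F \<longleftrightarrow> is_functor F \<and> abelian (Src F) \<and> abelian (Tgt F) \<and>
     (\<forall>f g. short_exact (Src F) f g \<longrightarrow> short_exact (Tgt F) (on_arr F f) (on_arr F g))"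

section \<open>Locally noetherian Grothendieck categories\<close>

text \<open>Smallness is relative to the type \<open>'u\<close>, which plays the role of the universe of all sets:
  a collection is small if it has strictly smaller cardinality than \<open>'u\<close>. If the cardinality of \<open>'u\<close>
  is inaccessible this is smallness in the sense of a Grothendieck universe. Families indexed by a small
  set may then be indexed by a small subset of \<open>'u\<close>.\<close>

definition small :: "'u itself \<Rightarrow> 'a set \<Rightarrow> bool" where
  "small U S \<longleftrightarrow> S \<prec> (UNIV :: 'u set)"

definition is_coproduct ::
    "('o, 'm) category \<Rightarrow> 'i set \<Rightarrow> ('i \<Rightarrow> 'o) \<Rightarrow> 'o \<Rightarrow> ('i \<Rightarrow> 'm) \<Rightarrow> bool" where
  "is_coproduct C I X S \<iota> \<longleftrightarrow> S \<in> Obj C \<and> (\<forall>i\<in>I. \<iota> i \<in> Hom C (X i) S) \<and>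
     (\<forall>W\<in>Obj C. \<forall>f. (\<forall>i\<in>I. f i \<in> Hom C (X i) W) \<longrightarrow>
        (\<exists>!u. u \<in> Hom C S W \<and> (\<forall>i\<in>I. u \<cdot>\<^bsub>C\<^esub> \<iota> i = f i)))"

definition has_small_coproducts :: "'u itself \<Rightarrow> ('o, 'm) category \<Rightarrow> bool" where
  "has_small_coproducts U C \<longleftrightarrow>
     (\<forall>(I :: 'u set) X. small U I \<longrightarrow> X ` I \<subseteq> Obj C \<longrightarrow> (\<exists>S \<iota>. is_coproduct C I X S \<iota>))"

definition filtered :: "('j, 'k) category \<Rightarrow> bool" where
  "filtered J \<longleftrightarrow> is_category J \<and> Obj J \<noteq> {} \<and>
     (\<forall>i\<in>Obj J. \<forall>j\<in>Obj J. \<exists>k\<in>Obj J. Hom J i k \<noteq> {} \<and> Hom J j k \<noteq> {}) \<and>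
     (\<forall>u\<in>Arr J. \<forall>v\<in>Arr J. Dom J u = Dom J v \<longrightarrow> Cod J u = Cod J v \<longrightarrow>
        (\<exists>w\<in>Arr J. Dom J w = Cod J u \<and> w \<cdot>\<^bsub>J\<^esub> u = w \<cdot>\<^bsub>J\<^esub> v))"

definition is_cocone :: "('j, 'k, 'o, 'm) fctr \<Rightarrow> 'o \<Rightarrow> ('j \<Rightarrow> 'm) \<Rightarrow> bool" where
  "is_cocone X L \<iota> \<longleftrightarrow> is_functor X \<and> L \<in> Obj (Tgt X) \<and>
     (\<forall>j\<in>Obj (Src X). \<iota> j \<in> Hom (Tgt X) (on_obj X j) L) \<and>
     (\<forall>a\<in>Arr (Src X). \<iota> (Cod (Src X) a) \<cdot>\<^bsub>Tgt X\<^esub> on_arr X a = \<iota> (Dom (Src X) a))"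

definition is_colimit :: "('j, 'k, 'o, 'm) fctr \<Rightarrow> 'o \<Rightarrow> ('j \<Rightarrow> 'm) \<Rightarrow> bool" where
  "is_colimit X L \<iota> \<longleftrightarrow> is_cocone X L \<iota> \<and>
     (\<forall>W \<kappa>. is_cocone X W \<kappa> \<longrightarrow>
        (\<exists>!u. u \<in> Hom (Tgt X) L W \<and> (\<forall>j\<in>Obj (Src X). u \<cdot>\<^bsub>Tgt X\<^esub> \<iota> j = \<kappa> j)))"

text \<open>For every pointwise short exact sequence \<open>X \<Rightarrow> Y \<Rightarrow> Z\<close> of diagrams indexed by a small filtered
  category, the induced sequence of colimits is short exact.\<close>

definition filtered_colimits_exact :: "'u itself \<Rightarrow> ('o, 'm) category \<Rightarrow> bool" where
  "filtered_colimits_exact U C \<longleftrightarrow>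
     (\<forall>(J :: ('u, 'u) category) X Y Z \<phi> \<psi> LX LY LZ \<iota>X \<iota>Y \<iota>Z f g.
        filtered J \<longrightarrow> small U (Obj J) \<longrightarrow> small U (Arr J) \<longrightarrow>
        Src X = J \<longrightarrow> Tgt X = C \<longrightarrow> nat_trans X Y \<phi> \<longrightarrow> nat_trans Y Z \<psi> \<longrightarrow>
        (\<forall>j\<in>Obj J. short_exact C (\<phi> j) (\<psi> j)) \<longrightarrow>
        is_colimit X LX \<iota>X \<longrightarrow> is_colimit Y LY \<iota>Y \<longrightarrow> is_colimit Z LZ \<iota>Z \<longrightarrow>
        f \<in> Hom C LX LY \<longrightarrow> (\<forall>j\<in>Obj J. f \<cdot>\<^bsub>C\<^esub> \<iota>X j = \<iota>Y j \<cdot>\<^bsub>C\<^esub> \<phi> j) \<longrightarrow>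
        g \<in> Hom C LY LZ \<longrightarrow> (\<forall>j\<in>Obj J. g \<cdot>\<^bsub>C\<^esub> \<iota>Y j = \<iota>Z j \<cdot>\<^bsub>C\<^esub> \<psi> j) \<longrightarrow>
        short_exact C f g)"

definition generating :: "('o, 'm) category \<Rightarrow> 'o set \<Rightarrow> bool" where
  "generating C \<G> \<longleftrightarrow> \<G> \<subseteq> Obj C \<and>
     (\<forall>f\<in>Arr C. \<forall>g\<in>Arr C. Dom C f = Dom C g \<longrightarrow> Cod C f = Cod C g \<longrightarrow> f \<noteq> g \<longrightarrow>
        (\<exists>G\<in>\<G>. \<exists>h\<in>Hom C G (Dom C f). f \<cdot>\<^bsub>C\<^esub> h \<noteq> g \<cdot>\<^bsub>C\<^esub> h))"

definition grothendieck :: "'u itself \<Rightarrow> ('o, 'm) category \<Rightarrow> bool" where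
  "grothendieck U C \<longleftrightarrow> abelian C \<and>
     (\<forall>X\<in>Obj C. \<forall>Y\<in>Obj C. small U (Hom C X Y)) \<and>
     has_small_coproducts U C \<and> filtered_colimits_exact U C \<and>
     (\<exists>G\<in>Obj C. generating C {G})"

definition factors_through :: "('o, 'm) category \<Rightarrow> 'm \<Rightarrow> 'm \<Rightarrow> bool" where
  "factors_through C i j \<longleftrightarrow> (\<exists>u\<in>Hom C (Dom C i) (Dom C j). j \<cdot>\<^bsub>C\<^esub> u = i)"

text \<open>Subobjects are represented by monomorphisms, ordered by \<^const>\<open>factors_through\<close>.\<close>

definition noetherian_obj :: "('o, 'm) category \<Rightarrow> 'o \<Rightarrow> bool" where
  "noetherian_obj C M \<longleftrightarrow> M \<in> Obj C \<and>
     (\<forall>s :: nat \<Rightarrow> 'm. (\<forall>n. monic C (s n) \<and> Cod C (s n) = M \<and> factors_through C (s n) (s (Suc n))) \<longrightarrow>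
        (\<exists>n. \<forall>k\<ge>n. factors_through C (s k) (s n)))"

definition locally_noetherian_grothendieck :: "'u itself \<Rightarrow> ('o, 'm) category \<Rightarrow> bool" where
  "locally_noetherian_grothendieck U C \<longleftrightarrow> grothendieck U C \<and>
     (\<exists>\<G>. small U \<G> \<and> generating C \<G> \<and> (\<forall>G\<in>\<G>. noetherian_obj C G))"

section \<open>Preradical functors\<close>

text \<open>A subobject of the identity functor is represented by a functor \<open>\<gamma>\<close> with a natural monomorphism
  \<open>\<iota>\<close> into the identity functor; naturality of \<open>\<iota>\<close> says that \<open>\<gamma>(f)\<close> is the restriction of \<open>f\<close>.
  Two representatives define the same subobject if they are isomorphic over the identity functor.\<close>

type_synonym ('o, 'm) subfunctor = "('o, 'm, 'o, 'm) fctr \<times> ('o \<Rightarrow> 'm)"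

definition preradical :: "('o, 'm) category \<Rightarrow> ('o, 'm) subfunctor \<Rightarrow> bool" where
  "preradical A = (\<lambda>(\<gamma>, \<iota>). Src \<gamma> = A \<and> Tgt \<gamma> = A \<and> nat_trans \<gamma> (id_functor A) \<iota> \<and>
     (\<forall>M\<in>Obj A. monic A (\<iota> M)))"

definition radical :: "('o, 'm) category \<Rightarrow> ('o, 'm) subfunctor \<Rightarrow> bool" where
  "radical A = (\<lambda>(\<gamma>, \<iota>). preradical A (\<gamma>, \<iota>) \<and>
     (\<forall>M\<in>Obj A. \<forall>p. is_cokernel A p (\<iota> M) \<longrightarrow> zero_obj A (on_obj \<gamma> (Cod A p))))"

definition same_subfunctor ::
    "('o, 'm) category \<Rightarrow> ('o, 'm) subfunctor \<Rightarrow> ('o, 'm) subfunctor \<Rightarrow> bool" where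
  "same_subfunctor A = (\<lambda>(\<gamma>, \<iota>) (\<gamma>', \<iota>').
     \<exists>\<theta>. nat_iso \<gamma> \<gamma>' \<theta> \<and> (\<forall>M\<in>Obj A. \<iota>' M \<cdot>\<^bsub>A\<^esub> \<theta> M = \<iota> M))"

definition left_exact_radicals :: "('o, 'm) category \<Rightarrow> ('o, 'm) subfunctor set set" where
  "left_exact_radicals A =
     {{s. preradical A s \<and> same_subfunctor A r s} | r. radical A r \<and> left_exact (fst r)}"

section \<open>Exact functors with a full and faithful right adjoint\<close>

definition exact_ff_radj :: "('o, 'm) category \<Rightarrow> ('o, 'm, 'd, 'e) fctr set" where
  "exact_ff_radj A = {F. Src F = A \<and> exact F \<and> (\<exists>G. right_adjoint F G \<and> full_faithful G)}"

definition equiv_under :: "('o, 'm, 'd, 'e) fctr \<Rightarrow> ('o, 'm, 'd, 'e) fctr \<Rightarrow> ('d, 'e, 'd, 'e) fctr \<Rightarrow> bool"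
  where
  "equiv_under F F' H \<longleftrightarrow> is_equivalence H \<and> Src H = Tgt F \<and> Tgt H = Tgt F' \<and>
     nat_isomorphic (comp_functor H F) F'"

definition fctr_sim :: "('o, 'm, 'd, 'e) fctr \<Rightarrow> ('o, 'm, 'd, 'e) fctr \<Rightarrow> bool" where
  "fctr_sim F F' \<longleftrightarrow> (\<exists>H. equiv_under F F' H \<and> (\<forall>H'. equiv_under F F' H' \<longrightarrow> nat_isomorphic H' H))"

definition fctr_class :: "('o, 'm) category \<Rightarrow> ('o, 'm, 'd, 'e) fctr \<Rightarrow> ('o, 'm, 'd, 'e) fctr set" where
  "fctr_class A F = {F' \<in> exact_ff_radj A. fctr_sim F F'}"

definition fctr_classes :: "('o, 'm) category \<Rightarrow> ('o, 'm, 'd, 'e) fctr set set" where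
  "fctr_classes A = {fctr_class A F | F. F \<in> exact_ff_radj A}"

end

theory Submission
  imports Defs
begin

text \<open>
  Both sides are classified by the same classes of objects. A left exact radical \<open>\<gamma>\<close> is determined by
  its hereditary torsion class \<open>{M. \<gamma> M = M}\<close>. An exact functor \<open>F\<close> with full and faithful right adjoint \<open>G\<close> is
  determined up to \<open>\<sim>\<close> by \<open>{M. F M = 0}\<close>: if \<open>F'\<close> (with right adjoint \<open>G'\<close>) has the same kernel, then \<open>F'\<close>
  inverts the unit \<open>\<eta>\<close> of the adjunction, because \<open>ker \<eta>\<close> and \<open>coker \<eta>\<close> are killed by \<open>F\<close>; so \<open>F' G\<close> is an equivalence
  with inverse \<open>F G'\<close>, and it is the only \<open>H\<close> with \<open>H F \<cong> F'\<close> since \<open>H \<cong> H F G\<close>. The kernel of \<open>F\<close> is the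
  torsion class of the left exact radical \<open>ker \<eta>\<close>. Conversely, a hereditary torsion class is the kernel of the
  reflection onto its closed objects: divide \<open>M\<close> by its torsion, embed the quotient \<open>M'\<close> in an injective \<open>E\<close>,
  let \<open>N\<close> be the preimage in \<open>E\<close> of the torsion of \<open>E / M'\<close>, and divide \<open>N\<close> by its torsion. The reflection
  preserves kernels, and this makes the full subcategory of closed objects abelian and the reflector exact.
\<close>

section \<open>Abelian categories\<close>

text \<open>Objects of an abstract category have no elements, so preservation of kernels by the
  localization is proved by chasing arrows up to density. An arrow into a localized object lifts
  along the unit after restriction along a dense arrow (\<open>dense_pullback\<close>), torsion
  errors disappear after a further dense restriction, and the outcome descends because dense arrows
  cancel against torsion-free targets. The abelian structure of the quotient category has to be
  derived. A full and faithful right adjoint makes its hom-sets copies of hom-sets of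
  \<open>A\<close>, and its products, kernels and cokernels are images under \<open>F\<close> of
  those formed in \<open>A\<close>, corrected by the invertible counit. In HOL the targets of the
  functors range over categories on fixed types \<open>'d\<close> and \<open>'e\<close>; the
  injections \<open>a\<close> and \<open>b\<close> say that these types have room for a copy of the
  closed objects and their arrows. No explicit map between the two sides is written down: each is a
  quotient by the fibres of a map to sets of objects, and it suffices that both maps have the same
  range.\<close>

locale cat =
  fixes C :: "('o, 'm) category"
  assumes is_category: "is_category C"
begin

abbreviation cmp :: "'m \<Rightarrow> 'm \<Rightarrow> 'm" (infixr "\<cdot>" 70) where "g \<cdot> f \<equiv> Comp C g f"
abbreviation arr :: "'m \<Rightarrow> bool" where "arr f \<equiv> f \<in> Arr C"
abbreviation obj :: "'o \<Rightarrow> bool" where "obj X \<equiv> X \<in> Obj C"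
abbreviation dom :: "'m \<Rightarrow> 'o" where "dom \<equiv> Dom C"
abbreviation cod :: "'m \<Rightarrow> 'o" where "cod \<equiv> Cod C"
abbreviation ide :: "'o \<Rightarrow> 'm" where "ide \<equiv> Ident C"

lemma Hom_iff: "f \<in> Hom C X Y \<longleftrightarrow> arr f \<and> dom f = X \<and> cod f = Y"
  by (auto simp: Hom_def)

lemma obj_dom_cod [simp]: "arr f \<Longrightarrow> obj (dom f)" "arr f \<Longrightarrow> obj (cod f)"
  using is_category by (auto simp: is_category_def)

lemma ide_simps [simp]:
  "obj X \<Longrightarrow> arr (ide X)" "obj X \<Longrightarrow> dom (ide X) = X" "obj X \<Longrightarrow> cod (ide X) = X"
  using is_category by (auto simp: is_category_def Hom_def)

lemma cmp_simps [simp]: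
  assumes "arr f" "arr g" "cod f = dom g"
  shows "arr (g \<cdot> f)" "dom (g \<cdot> f) = dom f" "cod (g \<cdot> f) = cod g"
  using is_category assms by (auto simp: is_category_def Hom_def)

lemma cmp_ide [simp]:
  "arr f \<Longrightarrow> dom f = X \<Longrightarrow> f \<cdot> ide X = f" "arr f \<Longrightarrow> cod f = X \<Longrightarrow> ide X \<cdot> f = f"
  using is_category by (auto simp: is_category_def)

lemma cmp_assoc [simp]:
  "\<lbrakk>arr f; arr g; arr h; cod f = dom g; cod g = dom h\<rbrakk> \<Longrightarrow> (h \<cdot> g) \<cdot> f = h \<cdot> (g \<cdot> f)"
  using is_category by (simp add: is_category_def)

text \<open>Turns an equation between composites into a rewrite rule for right-nested composites.\<close>

lemma cmp_eq:
  assumes "g \<cdot> f = k" "arr f" "arr g" "cod f = dom g" "arr x" "cod x = dom f"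
  shows "g \<cdot> (f \<cdot> x) = k \<cdot> x"
  using assms by (metis cmp_assoc)

lemma monicI:
  assumes "arr f"
    and "\<And>g h. \<lbrakk>arr g; arr h; dom g = dom h; cod g = dom f; cod h = dom f; f \<cdot> g = f \<cdot> h\<rbrakk> \<Longrightarrow> g = h"
  shows "monic C f"
  using assms unfolding monic_def by blast

lemma monic_arr [simp]: "monic C f \<Longrightarrow> arr f"
  by (simp add: monic_def)

text \<open>The equality of domains that \<open>monic\<close> asks for is read off from the
  equation, since a composite has the domain of its right factor.\<close>

lemma monic_cancel:
  assumes "monic C f" "f \<cdot> g = f \<cdot> h" "arr g" "arr h" "cod g = dom f" "cod h = dom f"
  shows "g = h"
proof -
  have "dom (f \<cdot> g) = dom g" "dom (f \<cdot> h) = dom h"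
    using assms(1,3-) by simp_all
  then show ?thesis
    using assms unfolding monic_def by metis
qed

lemma epicI:
  assumes "arr f"
    and "\<And>g h. \<lbrakk>arr g; arr h; cod g = cod h; dom g = cod f; dom h = cod f; g \<cdot> f = h \<cdot> f\<rbrakk> \<Longrightarrow> g = h"
  shows "epic C f"
  using assms unfolding epic_def by blast

lemma epic_arr [simp]: "epic C f \<Longrightarrow> arr f"
  by (simp add: epic_def)

lemma epic_cancel:
  assumes "epic C f" "g \<cdot> f = h \<cdot> f" "arr g" "arr h" "dom g = cod f" "dom h = cod f"
  shows "g = h"
proof -
  have "cod (g \<cdot> f) = cod g" "cod (h \<cdot> f) = cod h"
    using assms(1,3-) by simp_all
  then show ?thesis
    using assms unfolding epic_def by metis
qed

lemma monic_cmp: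
  assumes "monic C f" "monic C g" "cod f = dom g"
  shows "monic C (g \<cdot> f)"
proof (rule monicI)
  fix x y assume a: "arr x" "arr y" "dom x = dom y" "cod x = dom (g \<cdot> f)" "cod y = dom (g \<cdot> f)"
    "(g \<cdot> f) \<cdot> x = (g \<cdot> f) \<cdot> y"
  then have "f \<cdot> x = f \<cdot> y"
    by - (rule monic_cancel[OF assms(2)], use assms in auto)
  then show "x = y"
    using a assms by - (rule monic_cancel[OF assms(1)], auto)
qed (use assms in simp)

lemma epic_cmp:
  assumes "epic C f" "epic C g" "cod f = dom g"
  shows "epic C (g \<cdot> f)"
proof (rule epicI)
  fix x y assume a: "arr x" "arr y" "cod x = cod y" "dom x = cod (g \<cdot> f)" "dom y = cod (g \<cdot> f)"
    "x \<cdot> (g \<cdot> f) = y \<cdot> (g \<cdot> f)"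
  then have "x \<cdot> g = y \<cdot> g"
    using assms by - (rule epic_cancel[OF assms(1)], auto)
  then show "x = y"
    using a assms by - (rule epic_cancel[OF assms(2)], auto)
qed (use assms in simp)

lemma monic_of_cmp:
  assumes "monic C (g \<cdot> f)" "arr f" "arr g" "cod f = dom g"
  shows "monic C f"
proof (rule monicI)
  fix x y assume a: "arr x" "arr y" "dom x = dom y" "cod x = dom f" "cod y = dom f" "f \<cdot> x = f \<cdot> y"
  then have "(g \<cdot> f) \<cdot> x = (g \<cdot> f) \<cdot> y"
    using assms by simp
  then show "x = y"
    by (rule monic_cancel[OF assms(1)]) (use a assms in auto)
qed (use assms in simp)

lemma epic_of_cmp:
  assumes "epic C (g \<cdot> f)" "arr f" "arr g" "cod f = dom g"
  shows "epic C g"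
proof (rule epicI)
  fix x y assume a: "arr x" "arr y" "cod x = cod y" "dom x = cod g" "dom y = cod g" "x \<cdot> g = y \<cdot> g"
  then have "x \<cdot> (g \<cdot> f) = y \<cdot> (g \<cdot> f)"
    using assms by (metis cmp_assoc)
  then show "x = y"
    by (rule epic_cancel[OF assms(1)]) (use a assms in auto)
qed (use assms in simp)

lemma monic_ide: "obj X \<Longrightarrow> monic C (ide X)"
  by (rule monicI) auto

lemma epic_ide: "obj X \<Longrightarrow> epic C (ide X)"
  by (rule epicI) auto

lemma iso_arrI:
  assumes "arr f" "arr g" "dom g = cod f" "cod g = dom f" "g \<cdot> f = ide (dom f)" "f \<cdot> g = ide (cod f)"
  shows "iso_arr C f"
  using assms by (auto simp: iso_arr_def Hom_iff intro!: bexI[of _ g])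

lemma iso_arrE:
  assumes "iso_arr C f"
  obtains g where "arr f" "arr g" "dom g = cod f" "cod g = dom f" "g \<cdot> f = ide (dom f)"
    "f \<cdot> g = ide (cod f)"
proof -
  obtain g where g: "arr f" "arr g" "dom g = cod f" "cod g = dom f" "g \<cdot> f = ide (dom f)"
    "f \<cdot> g = ide (cod f)"
    using assms by (auto simp: iso_arr_def Hom_iff)
  then show ?thesis
    using that iso_arrI[of g f] by simp
qed

lemma iso_monic: "iso_arr C f \<Longrightarrow> monic C f"
  by (metis iso_arrE monic_ide monic_of_cmp obj_dom_cod(1))

lemma iso_epic: "iso_arr C f \<Longrightarrow> epic C f"
  by (metis iso_arrE epic_ide epic_of_cmp obj_dom_cod(2))

lemma iso_arr_arr [simp]: "iso_arr C f \<Longrightarrow> arr f"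
  by (simp add: iso_arr_def)

lemma iso_ide [simp]: "obj X \<Longrightarrow> iso_arr C (ide X)"
  by (rule iso_arrI[of _ "ide X"]) auto

lemma iso_cmp:
  assumes "iso_arr C f" "iso_arr C g" "cod f = dom g"
  shows "iso_arr C (g \<cdot> f)"
proof -
  obtain f' where f: "arr f" "arr f'" "dom f' = cod f" "cod f' = dom f" "f' \<cdot> f = ide (dom f)"
    "f \<cdot> f' = ide (cod f)"
    using iso_arrE[OF assms(1)] by metis
  obtain g' where g: "arr g" "arr g'" "dom g' = cod g" "cod g' = dom g" "g' \<cdot> g = ide (dom g)"
    "g \<cdot> g' = ide (cod g)"
    using iso_arrE[OF assms(2)] by metis
  show ?thesis
    by (rule iso_arrI[of _ "f' \<cdot> g'"])
      (use f g assms(3) cmp_eq[OF g(5)] cmp_eq[OF f(6)] in simp_all)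
qed

lemma iso_of_split:
  assumes "monic C f" "arr g" "dom g = cod f" "cod g = dom f" "f \<cdot> g = ide (cod f)"
  shows "iso_arr C f"
proof (rule iso_arrI)
  have "f \<cdot> (g \<cdot> f) = f \<cdot> ide (dom f)"
    using assms cmp_eq[OF assms(5)] by simp
  then show "g \<cdot> f = ide (dom f)"
    by (rule monic_cancel[OF assms(1)]) (use assms in auto)
qed (use assms in auto)

lemma iso_of_split':
  assumes "epic C f" "arr g" "dom g = cod f" "cod g = dom f" "g \<cdot> f = ide (dom f)"
  shows "iso_arr C f"
proof (rule iso_arrI)
  have "(f \<cdot> g) \<cdot> f = ide (cod f) \<cdot> f"
    using assms by simp
  then show "f \<cdot> g = ide (cod f)"
    by (rule epic_cancel[OF assms(1)]) (use assms in auto)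
qed (use assms in auto)

lemma zero_obj_unique_to:
  "\<lbrakk>zero_obj C Z; arr f; arr g; cod f = Z; cod g = Z; dom f = dom g\<rbrakk> \<Longrightarrow> f = g"
  unfolding zero_obj_def by (metis Hom_iff obj_dom_cod(1))

lemma zero_obj_unique_from:
  "\<lbrakk>zero_obj C Z; arr f; arr g; dom f = Z; dom g = Z; cod f = cod g\<rbrakk> \<Longrightarrow> f = g"
  unfolding zero_obj_def by (metis Hom_iff obj_dom_cod(2))

end

subsection \<open>Additive structure\<close>

text \<open>\<open>abelian\<close> asserts only that an additive structure exists; naming the matrix
  of that existential lets a chosen structure become a locale parameter.\<close>

definition additive_on :: "('o, 'm) category \<Rightarrow> ('m \<Rightarrow> 'm \<Rightarrow> 'm) \<Rightarrow> ('o \<Rightarrow> 'o \<Rightarrow> 'm) \<Rightarrow> bool" where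
  "additive_on C add zer \<longleftrightarrow>
     (\<forall>X\<in>Obj C. \<forall>Y\<in>Obj C.
        comm_group \<lparr>carrier = Hom C X Y, mult = add, one = zer X Y\<rparr>) \<and>
     (\<forall>X\<in>Obj C. \<forall>Y\<in>Obj C. \<forall>Z\<in>Obj C. \<forall>f\<in>Hom C X Y. \<forall>f'\<in>Hom C X Y. \<forall>g\<in>Hom C Y Z. \<forall>g'\<in>Hom C Y Z.
        g \<cdot>\<^bsub>C\<^esub> add f f' = add (g \<cdot>\<^bsub>C\<^esub> f) (g \<cdot>\<^bsub>C\<^esub> f') \<and>
        add g g' \<cdot>\<^bsub>C\<^esub> f = add (g \<cdot>\<^bsub>C\<^esub> f) (g' \<cdot>\<^bsub>C\<^esub> f))"

lemma preadditive_iff: "preadditive C \<longleftrightarrow> (\<exists>add zer. additive_on C add zer)"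
  unfolding preadditive_def additive_on_def ..

locale preadd = cat C for C :: "('o, 'm) category" +
  fixes add :: "'m \<Rightarrow> 'm \<Rightarrow> 'm" and zer :: "'o \<Rightarrow> 'o \<Rightarrow> 'm"
  assumes additive_on: "additive_on C add zer"
begin

abbreviation "hom_group X Y \<equiv> \<lparr>carrier = Hom C X Y, mult = add, one = zer X Y\<rparr>"

lemma comm_group_hom: "obj X \<Longrightarrow> obj Y \<Longrightarrow> comm_group (hom_group X Y)"
  using additive_on by (simp add: additive_on_def)

lemma zer_simps [simp]:
  assumes "obj X" "obj Y"
  shows "arr (zer X Y)" "dom (zer X Y) = X" "cod (zer X Y) = Y"
proof -
  interpret G: comm_group "hom_group X Y" using comm_group_hom[OF assms] .
  show "arr (zer X Y)" "dom (zer X Y) = X" "cod (zer X Y) = Y"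
    using G.one_closed by (auto simp: Hom_iff)
qed

lemma add_simps [simp]:
  assumes "arr f" "arr g" "dom f = dom g" "cod f = cod g"
  shows "arr (add f g)" "dom (add f g) = dom g" "cod (add f g) = cod g"
proof -
  interpret G: comm_group "hom_group (dom g) (cod g)" using comm_group_hom assms by simp
  show "arr (add f g)" "dom (add f g) = dom g" "cod (add f g) = cod g"
    using G.m_closed[of f g] assms by (auto simp: Hom_iff)
qed

lemma cmp_add:
  assumes "arr f" "arr g" "dom f = dom g" "cod f = cod g" "arr h" "dom h = cod g"
  shows "h \<cdot> add f g = add (h \<cdot> f) (h \<cdot> g)"
proof -
  have "f \<in> Hom C (dom f) (cod f)" "g \<in> Hom C (dom f) (cod f)" "h \<in> Hom C (cod f) (cod h)"
    using assms by (auto simp: Hom_iff)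
  then show ?thesis
    using additive_on assms(1,5) obj_dom_cod unfolding additive_on_def by blast
qed

lemma add_cmp:
  assumes "arr f" "arr g" "dom f = dom g" "cod f = cod g" "arr h" "cod h = dom g"
  shows "add f g \<cdot> h = add (f \<cdot> h) (g \<cdot> h)"
proof -
  have "f \<in> Hom C (dom f) (cod f)" "g \<in> Hom C (dom f) (cod f)" "h \<in> Hom C (dom h) (dom f)"
    using assms by (auto simp: Hom_iff)
  then show ?thesis
    using additive_on assms(1,5) obj_dom_cod unfolding additive_on_def by blast
qed

lemma add_zer:
  assumes "arr f" "X = dom f" "Y = cod f"
  shows "add f (zer X Y) = f" "add (zer X Y) f = f"
proof -
  interpret G: comm_group "hom_group (dom f) (cod f)" using comm_group_hom assms by simp
  show "add f (zer X Y) = f" "add (zer X Y) f = f"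
    using G.r_one[of f] G.l_one[of f] assms by (auto simp: Hom_iff)
qed

lemma add_commute:
  assumes "arr f" "arr g" "dom f = dom g" "cod f = cod g"
  shows "add f g = add g f"
proof -
  interpret G: comm_group "hom_group (dom g) (cod g)" using comm_group_hom assms by simp
  show ?thesis
    using G.m_comm[of f g] assms by (auto simp: Hom_iff)
qed

lemma add_self_zer:
  assumes "arr f" "add f f = f"
  shows "f = zer (dom f) (cod f)"
proof -
  interpret G: comm_group "hom_group (dom f) (cod f)" using comm_group_hom assms by simp
  show ?thesis
    using G.l_cancel_one[of f f] assms by (auto simp: Hom_iff)
qed

text \<open>Distributivity makes \<open>g \<cdot> zer X Y\<close> idempotent for addition, and the
  only idempotent of a group is its unit.\<close>

lemma cmp_zer [simp]:
  assumes "arr g" "obj X" "dom g = Y"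
  shows "g \<cdot> zer X Y = zer X (cod g)"
  using add_self_zer[of "g \<cdot> zer X Y"] cmp_add[of "zer X Y" "zer X Y" g] assms
    add_zer(1)[of "zer X Y" X Y] by auto

lemma zer_cmp [simp]:
  assumes "arr g" "obj Y" "cod g = X"
  shows "zer X Y \<cdot> g = zer (dom g) Y"
  using add_self_zer[of "zer X Y \<cdot> g"] add_cmp[of "zer X Y" "zer X Y" g] assms
    add_zer(1)[of "zer X Y" X Y] by auto

definition neg :: "'m \<Rightarrow> 'm" where
  "neg f = inv\<^bsub>hom_group (dom f) (cod f)\<^esub> f"

lemma neg_simps [simp]:
  assumes "arr f"
  shows "arr (neg f)" "dom (neg f) = dom f" "cod (neg f) = cod f"
proof -
  interpret G: comm_group "hom_group (dom f) (cod f)" using comm_group_hom assms by simp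
  show "arr (neg f)" "dom (neg f) = dom f" "cod (neg f) = cod f"
    using G.inv_closed[of f] assms unfolding neg_def by (auto simp: Hom_iff)
qed

lemma add_neg:
  assumes "arr f"
  shows "add f (neg f) = zer (dom f) (cod f)"
proof -
  interpret G: comm_group "hom_group (dom f) (cod f)" using comm_group_hom assms by simp
  show ?thesis
    using G.r_inv[of f] assms unfolding neg_def by (auto simp: Hom_iff)
qed

lemma add_eq_zer:
  assumes "arr f" "arr g" "dom f = dom g" "cod f = cod g" "add f g = zer (dom f) (cod f)"
  shows "g = neg f"
proof -
  interpret G: comm_group "hom_group (dom f) (cod f)" using comm_group_hom assms by simp
  show ?thesis
    using G.inv_equality[of g f] assms add_commute[of f g] unfolding neg_def by (auto simp: Hom_iff)
qed

definition diff :: "'m \<Rightarrow> 'm \<Rightarrow> 'm" where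
  "diff f g = add f (neg g)"

lemma diff_simps [simp]:
  assumes "arr f" "arr g" "dom f = dom g" "cod f = cod g"
  shows "arr (diff f g)" "dom (diff f g) = dom g" "cod (diff f g) = cod g"
  using assms by (simp_all add: diff_def)

lemma diff_self: "arr f \<Longrightarrow> diff f f = zer (dom f) (cod f)"
  by (simp add: diff_def add_neg)

lemma diff_eq_zer:
  assumes "arr f" "arr g" "dom f = dom g" "cod f = cod g" "diff f g = zer (dom f) (cod f)"
  shows "f = g"
proof -
  interpret G: comm_group "hom_group (dom g) (cod g)" using comm_group_hom assms by simp
  have "neg g = inv\<^bsub>hom_group (dom g) (cod g)\<^esub> g" "neg g \<in> carrier (hom_group (dom g) (cod g))"
    using assms neg_simps[of g] by (auto simp: neg_def Hom_iff simp del: neg_simps)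
  then show ?thesis
    using G.inv_equality[of f "neg g"] G.inv_inv[of g] assms
    unfolding diff_def by (auto simp: Hom_iff)
qed

lemma cmp_neg: "arr f \<Longrightarrow> arr h \<Longrightarrow> dom h = cod f \<Longrightarrow> h \<cdot> neg f = neg (h \<cdot> f)"
  using cmp_add[of f "neg f" h] add_neg[of f] by (intro add_eq_zer) auto

lemma neg_cmp: "arr f \<Longrightarrow> arr h \<Longrightarrow> cod h = dom f \<Longrightarrow> neg f \<cdot> h = neg (f \<cdot> h)"
  using add_cmp[of f "neg f" h] add_neg[of f] by (intro add_eq_zer) auto

lemma cmp_diff:
  "\<lbrakk>arr f; arr g; dom f = dom g; cod f = cod g; arr h; dom h = cod g\<rbrakk> \<Longrightarrow>
    h \<cdot> diff f g = diff (h \<cdot> f) (h \<cdot> g)"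
  by (simp add: diff_def cmp_add cmp_neg)

lemma diff_cmp:
  "\<lbrakk>arr f; arr g; dom f = dom g; cod f = cod g; arr h; cod h = dom g\<rbrakk> \<Longrightarrow>
    diff f g \<cdot> h = diff (f \<cdot> h) (g \<cdot> h)"
  by (simp add: diff_def add_cmp neg_cmp)

text \<open>The difference of two arrows turns the equality of their composites into the vanishing
  of a single composite.\<close>

lemma monicI_zer:
  assumes "arr f" "\<And>t. \<lbrakk>arr t; cod t = dom f; f \<cdot> t = zer (dom t) (cod f)\<rbrakk> \<Longrightarrow> t = zer (dom t) (dom f)"
  shows "monic C f"
proof (rule monicI)
  fix g h assume a: "arr g" "arr h" "dom g = dom h" "cod g = dom f" "cod h = dom f" "f \<cdot> g = f \<cdot> h"
  then have "f \<cdot> diff g h = zer (dom h) (cod f)"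
    using assms(1) diff_self[of "f \<cdot> h"] by (simp add: cmp_diff)
  then have "diff g h = zer (dom g) (cod g)"
    using assms(2)[of "diff g h"] a by simp
  then show "g = h"
    using a by - (rule diff_eq_zer, auto)
qed fact

lemma epicI_zer:
  assumes "arr f" "\<And>t. \<lbrakk>arr t; dom t = cod f; t \<cdot> f = zer (dom f) (cod t)\<rbrakk> \<Longrightarrow> t = zer (cod f) (cod t)"
  shows "epic C f"
proof (rule epicI)
  fix g h assume a: "arr g" "arr h" "cod g = cod h" "dom g = cod f" "dom h = cod f" "g \<cdot> f = h \<cdot> f"
  then have "diff g h \<cdot> f = zer (dom f) (cod h)"
    using assms(1) diff_self[of "h \<cdot> f"] by (simp add: diff_cmp)
  then have "diff g h = zer (dom g) (cod g)"
    using assms(2)[of "diff g h"] a by simp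
  then show "g = h"
    using a by - (rule diff_eq_zer, auto)
qed fact

lemma monic_zerD:
  "\<lbrakk>monic C f; f \<cdot> t = zer (dom t) (cod f); arr t; cod t = dom f\<rbrakk> \<Longrightarrow> t = zer (dom t) (dom f)"
  by (rule monic_cancel) auto

lemma epic_zerD:
  "\<lbrakk>epic C f; t \<cdot> f = zer (dom f) (cod t); arr t; dom t = cod f\<rbrakk> \<Longrightarrow> t = zer (cod f) (cod t)"
  by (rule epic_cancel) auto

lemma zero_objI:
  assumes "obj Z" "ide Z = zer Z Z"
  shows "zero_obj C Z"
proof -
  have to: "f = zer X Z" if "arr f" "dom f = X" "cod f = Z" for f X
    using cmp_ide(2)[of f Z] that assms by auto
  have "from": "f = zer Z X" if "arr f" "dom f = Z" "cod f = X" for f X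
    using cmp_ide(1)[of f Z] that assms by auto
  show ?thesis
    unfolding zero_obj_def Hom_iff
  proof (intro conjI ballI)
    fix X assume X: "obj X"
    show "\<exists>!f. arr f \<and> dom f = X \<and> cod f = Z"
      by (rule ex1I[of _ "zer X Z"]) (use X assms(1) to in auto)
    show "\<exists>!f. arr f \<and> dom f = Z \<and> cod f = X"
      by (rule ex1I[of _ "zer Z X"]) (use X assms(1) "from" in auto)
  qed (rule assms(1))
qed

lemma zero_obj_ide: "zero_obj C Z \<Longrightarrow> ide Z = zer Z Z"
  by (rule zero_obj_unique_to) (auto simp: zero_obj_def)

lemma zero_arr_of_zero_obj:
  assumes "zero_obj C Z" "arr f" "dom f = Z \<or> cod f = Z"
  shows "f = zer (dom f) (cod f)"
  using assms zero_obj_unique_to[OF assms(1), of f "zer (dom f) (cod f)"]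
    zero_obj_unique_from[OF assms(1), of f "zer (dom f) (cod f)"] by auto

end

section \<open>Kernels and cokernels in additive categories\<close>

locale additive_cat = preadd C add zer for C :: "('o, 'm) category" and add zer +
  assumes zero_obj_exists: "\<exists>Z. zero_obj C Z"
begin

text \<open>Kernels and cokernels are defined by factoring through a zero object, while calculations
  use the neutral elements \<open>zer\<close>; this is the bridge between the two notions.\<close>

lemma zero_arr_iff: "zero_arr C f \<longleftrightarrow> arr f \<and> f = zer (dom f) (cod f)"
proof
  assume "zero_arr C f"
  then obtain Z g h where z: "arr f" "zero_obj C Z" "arr g" "dom g = dom f" "cod g = Z"
    "arr h" "dom h = Z" "cod h = cod f" "f = h \<cdot> g"
    unfolding zero_arr_def Bex_def Hom_iff by blast
  have "g = zer (dom f) Z"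
    using zero_arr_of_zero_obj[OF z(2,3)] z(4,5) by metis
  then show "arr f \<and> f = zer (dom f) (cod f)"
    using z by (metis cmp_zer obj_dom_cod(1))
next
  assume f: "arr f \<and> f = zer (dom f) (cod f)"
  obtain Z where Z: "zero_obj C Z"
    using zero_obj_exists by blast
  then have "obj Z"
    by (simp add: zero_obj_def)
  then show "zero_arr C f"
    unfolding zero_arr_def Bex_def Hom_iff
  proof (intro conjI exI)
    show "f = zer Z (cod f) \<cdot> zer (dom f) Z"
      using f \<open>obj Z\<close> by simp
  qed (use f Z \<open>obj Z\<close> in simp_all)
qed

lemma zero_arr_zer [simp]: "obj X \<Longrightarrow> obj Y \<Longrightarrow> zero_arr C (zer X Y)"
  by (simp add: zero_arr_iff)

lemma zero_arr_cmp:
  assumes "arr f" "arr g" "cod f = dom g"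
  shows "zero_arr C (g \<cdot> f) \<longleftrightarrow> g \<cdot> f = zer (dom f) (cod g)"
  unfolding zero_arr_iff cmp_simps(2,3)[OF assms] using assms by (metis cmp_simps(1))

lemma kernel_simps:
  assumes "is_kernel C k f"
  shows "arr k" "arr f" "cod k = dom f" "f \<cdot> k = zer (dom k) (cod f)"
  using assms zero_arr_cmp[of k f] unfolding is_kernel_def by auto

lemma kernel_factor:
  assumes "is_kernel C k f" "arr h" "cod h = dom f" "f \<cdot> h = zer (dom h) (cod f)"
  obtains u where "arr u" "dom u = dom h" "cod u = dom k" "k \<cdot> u = h"
proof -
  have "zero_arr C (f \<cdot> h)"
    using assms kernel_simps[OF assms(1)] by (simp add: zero_arr_cmp)
  then show ?thesis
    using assms that unfolding is_kernel_def Hom_iff by blast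
qed

lemma kernel_monic:
  assumes "is_kernel C k f"
  shows "monic C k"
proof (rule monicI)
  note k = kernel_simps[OF assms]
  fix g h assume a: "arr g" "arr h" "dom g = dom h" "cod g = dom k" "cod h = dom k" "k \<cdot> g = k \<cdot> h"
  have "zero_arr C (f \<cdot> (k \<cdot> h))"
    using a k by (simp add: zero_arr_cmp cmp_eq[OF k(4)])
  then have "\<exists>!u. u \<in> Hom C (dom (k \<cdot> h)) (dom k) \<and> k \<cdot> u = k \<cdot> h"
    using assms[unfolded is_kernel_def, THEN conjunct2, THEN conjunct2, THEN conjunct2,
        THEN conjunct2, THEN bspec, of "k \<cdot> h"] a(2,5) k by simp
  then show "g = h"
    using a k unfolding Hom_iff by (metis cmp_simps(2))
qed (use kernel_simps[OF assms] in auto)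

lemma kernelI:
  assumes "monic C k" "arr f" "cod k = dom f" "f \<cdot> k = zer (dom k) (cod f)"
    and "\<And>h. \<lbrakk>arr h; cod h = dom f; f \<cdot> h = zer (dom h) (cod f)\<rbrakk> \<Longrightarrow>
      \<exists>u. arr u \<and> dom u = dom h \<and> cod u = dom k \<and> k \<cdot> u = h"
  shows "is_kernel C k f"
  unfolding is_kernel_def Hom_iff
proof (intro conjI ballI impI)
  show "zero_arr C (f \<cdot> k)"
    using assms by (simp add: zero_arr_cmp)
  fix h assume h: "arr h" "cod h = dom f" "zero_arr C (f \<cdot> h)"
  then have "f \<cdot> h = zer (dom h) (cod f)"
    using assms by (simp add: zero_arr_cmp)
  with h obtain u where "arr u \<and> dom u = dom h \<and> cod u = dom k \<and> k \<cdot> u = h"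
    using assms(2) assms(5)[of h] by auto
  then show "\<exists>!u. (arr u \<and> dom u = dom h \<and> cod u = dom k) \<and> k \<cdot> u = h"
    using monic_cancel[OF assms(1)] by metis
qed (use assms in auto)

lemma cokernel_simps:
  assumes "is_cokernel C p f"
  shows "arr p" "arr f" "dom p = cod f" "p \<cdot> f = zer (dom f) (cod p)"
  using assms zero_arr_cmp[of f p] unfolding is_cokernel_def by auto

lemma cokernel_factor:
  assumes "is_cokernel C p f" "arr h" "dom h = cod f" "h \<cdot> f = zer (dom f) (cod h)"
  obtains u where "arr u" "dom u = cod p" "cod u = cod h" "u \<cdot> p = h"
proof -
  have "zero_arr C (h \<cdot> f)"
    using assms cokernel_simps[OF assms(1)] by (simp add: zero_arr_cmp)
  then show ?thesis
    using assms that unfolding is_cokernel_def Hom_iff by blast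
qed

lemma cokernel_epic:
  assumes "is_cokernel C p f"
  shows "epic C p"
proof (rule epicI)
  note k = cokernel_simps[OF assms]
  fix g h assume a: "arr g" "arr h" "cod g = cod h" "dom g = cod p" "dom h = cod p" "g \<cdot> p = h \<cdot> p"
  have "zero_arr C ((h \<cdot> p) \<cdot> f)"
    using a(2,5) k by simp
  then have "\<exists>!u. u \<in> Hom C (cod p) (cod (h \<cdot> p)) \<and> u \<cdot> p = h \<cdot> p"
    using assms[unfolded is_cokernel_def, THEN conjunct2, THEN conjunct2, THEN conjunct2,
        THEN conjunct2, THEN bspec, of "h \<cdot> p"] a(2,5) k by simp
  then show "g = h"
    using a k unfolding Hom_iff by (metis cmp_simps(3))
qed (use cokernel_simps[OF assms] in auto)

lemma cokernelI:
  assumes "epic C p" "arr f" "dom p = cod f" "p \<cdot> f = zer (dom f) (cod p)"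
    and "\<And>h. \<lbrakk>arr h; dom h = cod f; h \<cdot> f = zer (dom f) (cod h)\<rbrakk> \<Longrightarrow>
      \<exists>u. arr u \<and> dom u = cod p \<and> cod u = cod h \<and> u \<cdot> p = h"
  shows "is_cokernel C p f"
  unfolding is_cokernel_def Hom_iff
proof (intro conjI ballI impI)
  show "zero_arr C (p \<cdot> f)"
    using assms by (simp add: zero_arr_cmp)
  fix h assume h: "arr h" "dom h = cod f" "zero_arr C (h \<cdot> f)"
  then have "h \<cdot> f = zer (dom f) (cod h)"
    using assms by (simp add: zero_arr_cmp)
  with h obtain u where "arr u \<and> dom u = cod p \<and> cod u = cod h \<and> u \<cdot> p = h"
    using assms(2) assms(5)[of h] by auto
  then show "\<exists>!u. (arr u \<and> dom u = cod p \<and> cod u = cod h) \<and> u \<cdot> p = h"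
    using epic_cancel[OF assms(1)] by metis
qed (use assms in auto)

text \<open>When \<open>f\<close> is zero the identity factors through its kernel, which gives the
  monic \<open>k\<close> a right inverse.\<close>

lemma kernel_of_zer_iso:
  assumes "is_kernel C k f" "f = zer (dom f) (cod f)"
  shows "iso_arr C k"
proof -
  note ks = kernel_simps[OF assms(1)]
  have "f \<cdot> ide (dom f) = zer (dom f) (cod f)"
    using ks assms(2) by simp
  then obtain u where "arr u" "dom u = dom f" "cod u = dom k" "k \<cdot> u = ide (dom f)"
    using kernel_factor[OF assms(1), of "ide (dom f)"] ks by auto
  then show ?thesis
    using iso_of_split[OF kernel_monic[OF assms(1)]] ks by auto
qed

lemma cokernel_of_zer_iso:
  assumes "is_cokernel C p f" "f = zer (dom f) (cod f)"
  shows "iso_arr C p"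
proof -
  note ps = cokernel_simps[OF assms(1)]
  have "ide (cod f) \<cdot> f = zer (dom f) (cod f)"
    using ps assms(2) by simp
  then obtain u where "arr u" "dom u = cod p" "cod u = cod f" "u \<cdot> p = ide (cod f)"
    using cokernel_factor[OF assms(1), of "ide (cod f)"] ps by auto
  then show ?thesis
    using iso_of_split'[OF cokernel_epic[OF assms(1)]] ps by auto
qed

text \<open>Kernels move along a square whose left side is invertible. The right side
  \<open>c\<close> need only be monic, because it only has to detect zero composites;
  \<open>b\<close> changes the representative of the subobject. The counit and its inverse provide
  such squares.\<close>

lemma kernel_transport:
  assumes "is_kernel C k f" "iso_arr C a" "dom a = dom f" "iso_arr C b" "cod b = dom k"
    "monic C c" "dom c = cod f" "arr g" "dom g = cod a" "g \<cdot> a = c \<cdot> f"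
  shows "is_kernel C (a \<cdot> (k \<cdot> b)) g"
proof -
  note k = kernel_simps[OF assms(1)]
  obtain a' where a: "arr a" "arr a'" "dom a' = cod a" "cod a' = dom a" "a' \<cdot> a = ide (dom a)"
    "a \<cdot> a' = ide (cod a)"
    using iso_arrE[OF assms(2)] by metis
  obtain b' where b: "arr b" "arr b'" "dom b' = cod b" "cod b' = dom b" "b' \<cdot> b = ide (dom b)"
    "b \<cdot> b' = ide (cod b)"
    using iso_arrE[OF assms(4)] by metis
  have c: "arr c" using assms(6) by simp
  have gc: "cod g = cod c"
    using cmp_simps(3)[of a g] cmp_simps(3)[of f c] a(1) c k(2) assms(7-10) by metis
  show ?thesis
  proof (rule kernelI)
    show "monic C (a \<cdot> (k \<cdot> b))"
      using assms a b k by (intro monic_cmp iso_monic kernel_monic[OF assms(1)]) auto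
    show "g \<cdot> (a \<cdot> (k \<cdot> b)) = zer (dom (a \<cdot> (k \<cdot> b))) (cod g)"
      using a b c k assms(3,5,7,8,9) gc
      by (simp add: cmp_eq[OF assms(10)] cmp_eq[OF k(4)])
    fix h assume h: "arr h" "cod h = dom g" "g \<cdot> h = zer (dom h) (cod g)"
    have "c \<cdot> (f \<cdot> (a' \<cdot> h)) = g \<cdot> (a \<cdot> (a' \<cdot> h))"
      using a c k assms(3,7,8,9) h(1,2) by (simp add: cmp_eq[OF assms(10)])
    also have "\<dots> = zer (dom h) (cod c)"
      using a h assms(8,9) gc by (simp add: cmp_eq[OF a(6)])
    finally have "f \<cdot> (a' \<cdot> h) = zer (dom h) (cod f)"
      using monic_zerD[OF assms(6), of "f \<cdot> (a' \<cdot> h)"] a k assms(3,7,8,9) h(1,2) by simp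
    then obtain u where u: "arr u" "dom u = dom h" "cod u = dom k" "k \<cdot> u = a' \<cdot> h"
      using kernel_factor[OF assms(1), of "a' \<cdot> h"] a assms(3,9) h(1,2) by auto
    have "(a \<cdot> (k \<cdot> b)) \<cdot> (b' \<cdot> u) = h"
      using a b k u h(1,2) assms(3,5,9) by (simp add: cmp_eq[OF b(6)] cmp_eq[OF a(6)])
    then show "\<exists>u. arr u \<and> dom u = dom h \<and> cod u = dom (a \<cdot> (k \<cdot> b)) \<and> (a \<cdot> (k \<cdot> b)) \<cdot> u = h"
      using a b k u assms(3,5) by (intro exI[of _ "b' \<cdot> u"]) auto
  qed (use assms a b k in auto)
qed

lemma cokernel_transport:
  assumes "is_cokernel C p f" "iso_arr C a" "cod a = cod f" "iso_arr C b" "dom b = cod p"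
    "epic C c" "cod c = dom f" "arr g" "cod g = dom a" "a \<cdot> g = f \<cdot> c"
  shows "is_cokernel C (b \<cdot> (p \<cdot> a)) g"
proof -
  note p = cokernel_simps[OF assms(1)]
  obtain a' where a: "arr a" "arr a'" "dom a' = cod a" "cod a' = dom a" "a' \<cdot> a = ide (dom a)"
    "a \<cdot> a' = ide (cod a)"
    using iso_arrE[OF assms(2)] by metis
  obtain b' where b: "arr b" "arr b'" "dom b' = cod b" "cod b' = dom b" "b' \<cdot> b = ide (dom b)"
    "b \<cdot> b' = ide (cod b)"
    using iso_arrE[OF assms(4)] by metis
  have c: "arr c" using assms(6) by simp
  have gc: "dom g = dom c"
    using cmp_simps(2)[of g a] cmp_simps(2)[of c f] a(1) c p(2) assms(7-10) by metis
  show ?thesis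
  proof (rule cokernelI)
    show "epic C (b \<cdot> (p \<cdot> a))"
      using assms a b p by (intro epic_cmp iso_epic cokernel_epic[OF assms(1)]) auto
    show "(b \<cdot> (p \<cdot> a)) \<cdot> g = zer (dom g) (cod (b \<cdot> (p \<cdot> a)))"
      using a b c p assms(3,5,7,8,9) gc
      by (simp add: assms(10) cmp_eq[OF p(4)])
    fix h assume h: "arr h" "dom h = cod g" "h \<cdot> g = zer (dom g) (cod h)"
    have "((h \<cdot> a') \<cdot> f) \<cdot> c = h \<cdot> (a' \<cdot> (a \<cdot> g))"
      using a c p assms(3,7,8,9) h(1,2) by (simp add: assms(10))
    also have "\<dots> = zer (dom c) (cod h)"
      using a h assms(8,9) gc by (simp add: cmp_eq[OF a(5)])
    finally have "(h \<cdot> a') \<cdot> f = zer (dom f) (cod h)"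
      using epic_zerD[OF assms(6), of "(h \<cdot> a') \<cdot> f"] a p assms(3,7,8,9) h(1,2) by simp
    then obtain u where u: "arr u" "dom u = cod p" "cod u = cod h" "u \<cdot> p = h \<cdot> a'"
      using cokernel_factor[OF assms(1), of "h \<cdot> a'"] a assms(3,9) h(1,2) by auto
    have "(u \<cdot> b') \<cdot> (b \<cdot> (p \<cdot> a)) = h"
      using a b p u h(1,2) assms(3,5,9) by (simp add: cmp_eq[OF b(5)] cmp_eq[OF u(4)])
    then show "\<exists>u. arr u \<and> dom u = cod (b \<cdot> (p \<cdot> a)) \<and> cod u = cod h \<and> u \<cdot> (b \<cdot> (p \<cdot> a)) = h"
      using a b p u assms(3,5) by (intro exI[of _ "u \<cdot> b'"]) auto
  qed (use assms a b p in auto)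
qed

end

section \<open>Image factorizations, biproducts and pullbacks in abelian categories\<close>

locale abcat = additive_cat C add zer for C :: "('o, 'm) category" and add zer +
  assumes abelian: "abelian C"
begin

lemma kernel_exists: "arr f \<Longrightarrow> \<exists>k. is_kernel C k f"
  using abelian by (simp add: abelian_def)

lemma cokernel_exists: "arr f \<Longrightarrow> \<exists>p. is_cokernel C p f"
  using abelian by (simp add: abelian_def)

text \<open>The monic is a kernel of some \<open>g\<close>. Since \<open>g\<close> factors through
  the cokernel \<open>p\<close>, whatever \<open>p\<close> kills is killed by \<open>g\<close> and
  factors through \<open>m\<close>.\<close>

lemma monic_kernel_of_cokernel:
  assumes "monic C m" "is_cokernel C p m"
  shows "is_kernel C m p"
proof -
  obtain g where g: "is_kernel C m g"
    using abelian assms(1) by (auto simp: abelian_def)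
  note p = cokernel_simps[OF assms(2)] and gs = kernel_simps[OF g]
  obtain v where v: "arr v" "dom v = cod p" "cod v = cod g" "v \<cdot> p = g"
    using cokernel_factor[OF assms(2) gs(2) gs(3)[symmetric] gs(4)] by metis
  show ?thesis
  proof (rule kernelI)
    fix h assume h: "arr h" "cod h = dom p" "p \<cdot> h = zer (dom h) (cod p)"
    have "g \<cdot> h = v \<cdot> (p \<cdot> h)"
      using v h p by (metis cmp_assoc)
    then have "g \<cdot> h = zer (dom h) (cod g)"
      using v h by simp
    then show "\<exists>u. arr u \<and> dom u = dom h \<and> cod u = dom m \<and> m \<cdot> u = h"
      using kernel_factor[OF g h(1)] h gs(3) p(3) by metis
  qed (use assms(1) p in auto)
qed

lemma epic_cokernel_of_kernel:
  assumes "epic C e" "is_kernel C k e"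
  shows "is_cokernel C e k"
proof -
  obtain g where g: "is_cokernel C e g"
    using abelian assms(1) by (auto simp: abelian_def)
  note p = kernel_simps[OF assms(2)] and gs = cokernel_simps[OF g]
  obtain v where v: "arr v" "dom v = dom g" "cod v = dom k" "k \<cdot> v = g"
    using kernel_factor[OF assms(2) gs(2) gs(3)[symmetric] gs(4)] by metis
  show ?thesis
  proof (rule cokernelI)
    fix h assume h: "arr h" "dom h = cod k" "h \<cdot> k = zer (dom k) (cod h)"
    have "h \<cdot> g = (h \<cdot> k) \<cdot> v"
      using v h p by (metis cmp_assoc)
    then have "h \<cdot> g = zer (dom g) (cod h)"
      using v h p by simp
    then show "\<exists>u. arr u \<and> dom u = cod e \<and> cod u = cod h \<and> u \<cdot> e = h"
      using cokernel_factor[OF g h(1)] h gs(3) p(3) by metis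
  qed (use assms(1) p in auto)
qed

text \<open>The cokernel of an epic is zero, so the monic, being its kernel, is split by a
  factorization of the identity.\<close>

lemma mono_epi_iso:
  assumes "monic C f" "epic C f"
  shows "iso_arr C f"
proof -
  obtain p where p: "is_cokernel C p f"
    using cokernel_exists[of f] assms by auto
  note ps = cokernel_simps[OF p]
  have "p = zer (cod f) (cod p)"
    using epic_zerD[OF assms(2)] ps by simp
  then have "p \<cdot> ide (cod f) = zer (cod f) (cod p)"
    using ps by simp
  then obtain u where "arr u" "dom u = cod f" "cod u = dom f" "f \<cdot> u = ide (cod f)"
    using kernel_factor[OF monic_kernel_of_cokernel[OF assms(1) p], of "ide (cod f)"] ps by auto
  then show ?thesis
    using iso_of_split assms(1) by blast
qed

text \<open>The epic part is the cokernel of the kernel; the point is that the induced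
  \<open>m\<close> is monic. If \<open>m\<close> kills \<open>t\<close>, it factors through the
  cokernel \<open>q\<close> of \<open>t\<close>, and then \<open>e\<close> turns out to factor
  through \<open>q \<cdot> e\<close>, which splits \<open>q\<close> and forces \<open>t\<close> to
  vanish.\<close>

lemma image_factorization:
  assumes "arr f"
  obtains k e m where "is_kernel C k f" "is_cokernel C e k" "epic C e" "monic C m"
    "dom e = dom f" "cod e = dom m" "cod m = cod f" "m \<cdot> e = f"
proof -
  obtain k where k: "is_kernel C k f"
    using kernel_exists[OF assms] by auto
  note ks = kernel_simps[OF k]
  obtain e where e: "is_cokernel C e k"
    using cokernel_exists[OF ks(1)] by auto
  note es = cokernel_simps[OF e]
  obtain m where m: "arr m" "dom m = cod e" "cod m = cod f" "m \<cdot> e = f"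
    using cokernel_factor[OF e ks(2) ks(3)[symmetric] ks(4)] by metis
  have ee: "epic C e"
    using cokernel_epic[OF e] .
  have "monic C m"
  proof (rule monicI_zer)
    fix t assume t: "arr t" "cod t = dom m" "m \<cdot> t = zer (dom t) (cod m)"
    obtain q where q: "is_cokernel C q t"
      using cokernel_exists[OF t(1)] by auto
    note qs = cokernel_simps[OF q]
    \<comment> \<open>As an epic, \<open>q \<cdot> e\<close> is the cokernel of its kernel
      \<open>l\<close>. Since \<open>f\<close> factors through \<open>q \<cdot> e\<close>, it kills
      \<open>l\<close>; hence \<open>l\<close> factors through \<open>k\<close> and is killed by
      \<open>e\<close>.\<close>
    have qe: "epic C (q \<cdot> e)"
      using epic_cmp[OF ee cokernel_epic[OF q]] qs t m by simp
    then obtain l where l: "is_kernel C l (q \<cdot> e)"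
      using kernel_exists[OF epic_arr] by blast
    have c: "is_cokernel C (q \<cdot> e) l"
      using qe l by (rule epic_cokernel_of_kernel)
    note ls = cokernel_simps[OF c]
    obtain m' where m': "arr m'" "dom m' = cod q" "cod m' = cod m" "m' \<cdot> q = m"
      using cokernel_factor[OF q m(1)] t by metis
    have ty: "dom q = cod e" "cod l = dom e" "arr l"
      using ls qs t m es by auto
    have "f \<cdot> l = m' \<cdot> ((q \<cdot> e) \<cdot> l)"
      using m' m es qs ty cmp_eq[OF m'(4)] cmp_eq[OF m(4)] by simp
    then have "f \<cdot> l = zer (dom l) (cod f)"
      using ls m' m qs es ty by simp
    then obtain w where w: "arr w" "dom w = dom l" "cod w = dom k" "k \<cdot> w = l"
      using kernel_factor[OF k, of l] ty es ks by auto
    have "e \<cdot> l = (e \<cdot> k) \<cdot> w"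
      using w es ks by (metis cmp_assoc)
    then have "e \<cdot> l = zer (dom l) (cod e)"
      using w es ks by simp
    then obtain r where r: "arr r" "dom r = cod q" "cod r = cod e" "r \<cdot> (q \<cdot> e) = e"
      using cokernel_factor[OF c, of e] ty es qs by auto
    have "(r \<cdot> q) \<cdot> e = ide (cod e) \<cdot> e"
      using r ty es qs by simp
    then have rq: "r \<cdot> q = ide (cod e)"
      by (rule epic_cancel[OF ee]) (use r ty es qs in auto)
    have "t = (r \<cdot> q) \<cdot> t"
      using rq t m by simp
    also have "\<dots> = r \<cdot> (q \<cdot> t)"
      using r qs t m by simp
    also have "\<dots> = zer (dom t) (dom m)"
      using r qs t m by simp
    finally show "t = zer (dom t) (dom m)" .
  qed (use m in simp)
  then show ?thesis
    using that[OF k e ee] es ks m by simp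
qed

lemma short_exactI_monic:
  assumes "monic C m" "is_cokernel C p m"
  shows "short_exact C m p"
  using assms monic_kernel_of_cokernel by (simp add: short_exact_def)

lemma short_exactI_epic:
  assumes "epic C e" "is_kernel C k e"
  shows "short_exact C k e"
  using assms epic_cokernel_of_kernel by (simp add: short_exact_def)

lemma product_exists:
  assumes "obj X" "obj Y"
  obtains P p q where "obj P" "is_product C X Y P p q"
proof -
  obtain P p q where P: "is_product C X Y P p q"
    using abelian assms unfolding abelian_def by blast
  then have "obj P"
    unfolding is_product_def Hom_iff by auto
  then show ?thesis
    using that P by blast
qed

lemma biproduct_exists:
  assumes "obj X" "obj Y"
  obtains P p q i j where "obj P" "arr p" "dom p = P" "cod p = X" "arr q" "dom q = P" "cod q = Y"
    "arr i" "dom i = X" "cod i = P" "arr j" "dom j = Y" "cod j = P"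
    "p \<cdot> i = ide X" "q \<cdot> i = zer X Y" "p \<cdot> j = zer Y X" "q \<cdot> j = ide Y"
    "add (i \<cdot> p) (j \<cdot> q) = ide P"
proof -
  obtain P p q where P: "obj P" "is_product C X Y P p q"
    using product_exists assms by metis
  have ex: "\<exists>!u. (arr u \<and> dom u = W \<and> cod u = P) \<and> p \<cdot> u = f \<and> q \<cdot> u = g"
    if "obj W" "arr f" "dom f = W" "cod f = X" "arr g" "dom g = W" "cod g = Y" for W f g
    using P(2) that unfolding is_product_def Ball_def Hom_iff by blast
  have p: "arr p" "dom p = P" "cod p = X" and q: "arr q" "dom q = P" "cod q = Y"
    using P(2) unfolding is_product_def Hom_iff by auto
  obtain i where i: "arr i" "dom i = X" "cod i = P" "p \<cdot> i = ide X" "q \<cdot> i = zer X Y"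
    using ex[of X "ide X" "zer X Y"] assms by auto
  obtain j where j: "arr j" "dom j = Y" "cod j = P" "p \<cdot> j = zer Y X" "q \<cdot> j = ide Y"
    using ex[of Y "zer Y X" "ide Y"] assms by auto
  \<comment> \<open>\<open>s\<close> has the same two components as the identity of the product, so
    the two agree by the universal property.\<close>
  define s where "s = add (i \<cdot> p) (j \<cdot> q)"
  have s: "arr s" "dom s = P" "cod s = P"
    using i j p q by (auto simp: s_def)
  have "p \<cdot> s = add (p \<cdot> (i \<cdot> p)) (p \<cdot> (j \<cdot> q))"
    using i j p q by (simp add: s_def cmp_add)
  also have "\<dots> = p"
    using i j p q assms P(1) cmp_eq[OF i(4)] cmp_eq[OF j(4)] by (simp add: add_zer)
  finally have ps: "p \<cdot> s = p" .
  have "q \<cdot> s = add (q \<cdot> (i \<cdot> p)) (q \<cdot> (j \<cdot> q))"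
    using i j p q by (simp add: s_def cmp_add)
  also have "\<dots> = q"
    using i j p q assms P(1) cmp_eq[OF i(5)] cmp_eq[OF j(5)] by (simp add: add_zer)
  finally have qs: "q \<cdot> s = q" .
  obtain w where w: "\<And>u. arr u \<Longrightarrow> dom u = P \<Longrightarrow> cod u = P \<Longrightarrow> p \<cdot> u = p \<Longrightarrow> q \<cdot> u = q \<Longrightarrow> u = w"
    using ex[of P p q] p q P(1) by blast
  have "s = ide P"
    using w[of s] w[of "ide P"] p q s ps qs P(1) by simp
  then show ?thesis
    using that[OF P(1)] p q i j s_def by metis
qed

text \<open>The pullback of \<open>e\<close> and \<open>g\<close> is the kernel \<open>k\<close> of \<open>e \<cdot> p - g \<cdot> q\<close> on the biproduct; since \<open>e\<close> is epic so is
  this difference, which is therefore the cokernel of \<open>k\<close>.\<close>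

lemma epic_pullback:
  assumes "epic C e" "arr g" "cod g = cod e"
  obtains x s where "arr x" "epic C s" "dom x = dom s" "cod x = dom e" "cod s = dom g"
    "e \<cdot> x = g \<cdot> s"
    "\<And>t. \<lbrakk>arr t; cod t = dom s; x \<cdot> t = zer (dom t) (dom e); s \<cdot> t = zer (dom t) (dom g)\<rbrakk>
      \<Longrightarrow> t = zer (dom t) (dom s)"
proof -
  have e: "arr e"
    using assms(1) by simp
  obtain P p q i j where b: "obj P" "arr p" "dom p = P" "cod p = dom e" "arr q" "dom q = P" "cod q = dom g"
    "arr i" "dom i = dom e" "cod i = P" "arr j" "dom j = dom g" "cod j = P"
    "p \<cdot> i = ide (dom e)" "q \<cdot> i = zer (dom e) (dom g)" "p \<cdot> j = zer (dom g) (dom e)" "q \<cdot> j = ide (dom g)"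
    "add (i \<cdot> p) (j \<cdot> q) = ide P"
    by (rule biproduct_exists[OF obj_dom_cod(1)[OF e] obj_dom_cod(1)[OF assms(2)]])
  define d where "d = diff (e \<cdot> p) (g \<cdot> q)"
  have d: "arr d" "dom d = P" "cod d = cod e"
    using b e assms by (auto simp: d_def)
  have "d \<cdot> i = diff (e \<cdot> (p \<cdot> i)) (g \<cdot> (q \<cdot> i))"
    using b e assms by (simp add: d_def diff_cmp)
  also have "\<dots> = e"
  proof -
    have "neg (zer (dom e) (cod e)) = zer (dom e) (cod e)"
      using add_neg[of "zer (dom e) (cod e)"] add_zer(2)[of "neg (zer (dom e) (cod e))"] e by simp
    then show ?thesis
      using b e assms by (simp add: diff_def add_zer)
  qed
  finally have di: "d \<cdot> i = e" .
  have "epic C d"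
    using assms(1) epic_of_cmp[of d i] di b d by simp
  obtain k where k: "is_kernel C k d"
    using kernel_exists[OF d(1)] by auto
  note ks = kernel_simps[OF k]
  have c: "is_cokernel C d k"
    using \<open>epic C d\<close> k by (rule epic_cokernel_of_kernel)
  have df: "diff (e \<cdot> (p \<cdot> k)) (g \<cdot> (q \<cdot> k)) = zer (dom k) (cod e)"
    using ks(4) b d ks e assms by (simp add: d_def diff_cmp)
  have eq: "e \<cdot> (p \<cdot> k) = g \<cdot> (q \<cdot> k)"
    by (rule diff_eq_zer) (use b d ks e assms df in auto)
  \<comment> \<open>A \<open>t\<close> that kills \<open>q \<cdot> k\<close> satisfies
    \<open>t \<cdot> q = z \<cdot> d\<close>. Restricting to \<open>i\<close> gives
    \<open>z \<cdot> e = 0\<close>, hence \<open>z = 0\<close>; restricting to \<open>j\<close> then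
    gives \<open>t = 0\<close>.\<close>
  have ep: "epic C (q \<cdot> k)"
  proof (rule epicI_zer)
    fix t assume t: "arr t" "dom t = cod (q \<cdot> k)" "t \<cdot> (q \<cdot> k) = zer (dom (q \<cdot> k)) (cod t)"
    then have "(t \<cdot> q) \<cdot> k = zer (dom k) (cod t)"
      using b d ks by simp
    then obtain z where z: "arr z" "dom z = cod d" "cod z = cod t" "z \<cdot> d = t \<cdot> q"
      using cokernel_factor[OF c, of "t \<cdot> q"] t b d ks by auto
    have "z \<cdot> e = (t \<cdot> q) \<cdot> i"
      using z b d di by (metis cmp_assoc)
    also have "\<dots> = zer (dom e) (cod t)"
      using t b d ks e by simp
    finally have "z = zer (cod e) (cod t)"
      using epic_zerD[OF assms(1), of z] z d by simp
    then have "t \<cdot> q = zer P (cod t)"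
      using z d t by simp
    then have "(t \<cdot> q) \<cdot> j = zer (dom g) (cod t)"
      using b t by simp
    then show "t = zer (cod (q \<cdot> k)) (cod t)"
      using b t d ks by simp
  qed (use b d ks in simp)
  show ?thesis
  proof (rule that[OF _ ep _ _ _ eq])
    fix t assume t: "arr t" "cod t = dom (q \<cdot> k)" "(p \<cdot> k) \<cdot> t = zer (dom t) (dom e)"
      "(q \<cdot> k) \<cdot> t = zer (dom t) (dom g)"
    \<comment> \<open>The decomposition of the identity of \<open>P\<close> expresses
      \<open>k \<cdot> t\<close> by its two components, both zero by assumption.\<close>
    have "k \<cdot> t = add (i \<cdot> p) (j \<cdot> q) \<cdot> (k \<cdot> t)"
      using b t d ks by simp
    also have "\<dots> = add (i \<cdot> ((p \<cdot> k) \<cdot> t)) (j \<cdot> ((q \<cdot> k) \<cdot> t))"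
    proof -
      have tt: "cod t = dom k" using b t d ks by simp
      have "add (i \<cdot> p) (j \<cdot> q) \<cdot> (k \<cdot> t) = add ((i \<cdot> p) \<cdot> (k \<cdot> t)) ((j \<cdot> q) \<cdot> (k \<cdot> t))"
        by (rule add_cmp) (use b t(1) d ks tt in auto)
      also have "\<dots> = add (i \<cdot> ((p \<cdot> k) \<cdot> t)) (j \<cdot> ((q \<cdot> k) \<cdot> t))"
        using b t(1) d ks tt by simp
      finally show ?thesis .
    qed
    also have "\<dots> = zer (dom t) P"
      unfolding t(3,4) using b t(1) by (simp add: add_zer)
    finally show "t = zer (dom t) (dom (q \<cdot> k))"
      using monic_zerD[OF kernel_monic[OF k], of t] b t d ks by simp
  qed (use b d ks in auto)
qed

end

lemma abelian_abcat:
  assumes "abelian C"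
  obtains add zer where "abcat C add zer"
  using assms unfolding abcat_def additive_cat_def additive_cat_axioms_def preadd_def cat_def
    preadd_axioms_def abcat_axioms_def
  by (auto simp: abelian_def preadditive_iff)

section \<open>Functors and adjunctions\<close>

locale ftr = A: cat A + B: cat B
  for A :: "('o, 'm) category" and B :: "('p, 'n) category" +
  fixes F :: "('o, 'm, 'p, 'n) fctr"
  assumes is_functor: "is_functor F" and Src [simp]: "Src F = A" and Tgt [simp]: "Tgt F = B"
begin

lemma obj [simp]: "X \<in> Obj A \<Longrightarrow> on_obj F X \<in> Obj B"
  using is_functor by (simp add: is_functor_def)

lemma arr [simp]:
  assumes "f \<in> Arr A"
  shows "on_arr F f \<in> Arr B" "Dom B (on_arr F f) = on_obj F (Dom A f)"
    "Cod B (on_arr F f) = on_obj F (Cod A f)"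
  using is_functor assms by (auto simp: is_functor_def Hom_def)

lemma ide [simp]: "X \<in> Obj A \<Longrightarrow> on_arr F (Ident A X) = Ident B (on_obj F X)"
  using is_functor by (simp add: is_functor_def)

lemma cmp:
  "\<lbrakk>f \<in> Arr A; g \<in> Arr A; Cod A f = Dom A g\<rbrakk> \<Longrightarrow> on_arr F (g \<cdot>\<^bsub>A\<^esub> f) = on_arr F g \<cdot>\<^bsub>B\<^esub> on_arr F f"
  using is_functor by (simp add: is_functor_def)

lemma iso:
  assumes "iso_arr A f"
  shows "iso_arr B (on_arr F f)"
proof -
  obtain g where g: "f \<in> Arr A" "g \<in> Arr A" "Dom A g = Cod A f" "Cod A g = Dom A f"
    "g \<cdot>\<^bsub>A\<^esub> f = Ident A (Dom A f)" "f \<cdot>\<^bsub>A\<^esub> g = Ident A (Cod A f)"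
    using A.iso_arrE[OF assms] by metis
  show ?thesis
    by (rule B.iso_arrI[of _ "on_arr F g"]) (use g cmp[of f g] cmp[of g f] in auto)
qed

end

lemma ftrI: "is_functor F \<Longrightarrow> Src F = A \<Longrightarrow> Tgt F = B \<Longrightarrow> ftr A B F"
  by (auto simp: ftr_def cat_def ftr_axioms_def is_functor_def)

lemma comp_functor_simps [simp]:
  "Src (comp_functor G F) = Src F" "Tgt (comp_functor G F) = Tgt G"
  "on_obj (comp_functor G F) X = on_obj G (on_obj F X)"
  "on_arr (comp_functor G F) f = on_arr G (on_arr F f)"
  by (simp_all add: comp_functor_def)

lemma id_functor_simps [simp]:
  "Src (id_functor C) = C" "Tgt (id_functor C) = C" "on_obj (id_functor C) X = X"
  "on_arr (id_functor C) f = f"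
  by (simp_all add: id_functor_def)

lemma is_functor_id: "is_category C \<Longrightarrow> is_functor (id_functor C)"
  by (auto simp: is_functor_def is_category_def Hom_def)

lemma is_functor_comp:
  assumes "is_functor F" "is_functor G" "Src G = Tgt F"
  shows "is_functor (comp_functor G F)"
  using assms unfolding is_functor_def by (auto simp: Hom_def)

section \<open>Calculus of natural isomorphisms\<close>

lemma nat_isoI:
  assumes "is_functor F" "is_functor G" "Src F = A" "Src G = A" "Tgt F = B" "Tgt G = B"
    and "\<And>X. X \<in> Obj A \<Longrightarrow> iso_arr B (t X)"
    and "\<And>X. X \<in> Obj A \<Longrightarrow> Dom B (t X) = on_obj F X"
    and "\<And>X. X \<in> Obj A \<Longrightarrow> Cod B (t X) = on_obj G X"
    and "\<And>f. f \<in> Arr A \<Longrightarrow> on_arr G f \<cdot>\<^bsub>B\<^esub> t (Dom A f) = t (Cod A f) \<cdot>\<^bsub>B\<^esub> on_arr F f"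
  shows "nat_iso F G t"
  using assms unfolding nat_iso_def nat_trans_def Hom_def by (auto simp: iso_arr_def)

lemma nat_isoD:
  assumes "nat_iso F G t" "Src F = A" "Tgt F = B"
  shows "is_functor F" "is_functor G" "Src G = A" "Tgt G = B"
    "\<And>X. X \<in> Obj A \<Longrightarrow> iso_arr B (t X)"
    "\<And>X. X \<in> Obj A \<Longrightarrow> Dom B (t X) = on_obj F X"
    "\<And>X. X \<in> Obj A \<Longrightarrow> Cod B (t X) = on_obj G X"
    "\<And>f. f \<in> Arr A \<Longrightarrow> on_arr G f \<cdot>\<^bsub>B\<^esub> t (Dom A f) = t (Cod A f) \<cdot>\<^bsub>B\<^esub> on_arr F f"
  using assms unfolding nat_iso_def nat_trans_def Hom_def by auto

lemma nat_isomorphic_sym: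
  assumes "nat_isomorphic F G"
  shows "nat_isomorphic G F"
proof -
  define A B where AB: "A = Src F" "B = Tgt F"
  obtain t where t: "nat_iso F G t"
    using assms by (auto simp: nat_isomorphic_def)
  note ts = nat_isoD[OF t AB(1,2)[symmetric]]
  interpret F: ftr A B F using ts AB[symmetric] by (intro ftrI) auto
  interpret G: ftr A B G using ts AB[symmetric] by (intro ftrI) auto
  have "\<exists>s. s \<in> Arr B \<and> Dom B s = on_obj G X \<and> Cod B s = on_obj F X \<and>
      s \<cdot>\<^bsub>B\<^esub> t X = Ident B (on_obj F X) \<and> t X \<cdot>\<^bsub>B\<^esub> s = Ident B (on_obj G X)"
    if "X \<in> Obj A" for X
    by (rule F.B.iso_arrE[OF ts(5)[OF that]]) (use ts(6,7)[OF that] in auto)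
  then obtain s where s: "\<And>X. X \<in> Obj A \<Longrightarrow> s X \<in> Arr B"
    "\<And>X. X \<in> Obj A \<Longrightarrow> Dom B (s X) = on_obj G X"
    "\<And>X. X \<in> Obj A \<Longrightarrow> Cod B (s X) = on_obj F X"
    "\<And>X. X \<in> Obj A \<Longrightarrow> s X \<cdot>\<^bsub>B\<^esub> t X = Ident B (on_obj F X)"
    "\<And>X. X \<in> Obj A \<Longrightarrow> t X \<cdot>\<^bsub>B\<^esub> s X = Ident B (on_obj G X)"
    by metis
  have "nat_iso G F s"
  proof (rule nat_isoI[OF ts(2,1) ts(3) AB(1)[symmetric] ts(4) AB(2)[symmetric]])
    fix X assume X: "X \<in> Obj A"
    show "iso_arr B (s X)"
      by (rule F.B.iso_arrI[of _ "t X"]) (use X s ts in auto)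
  next
    fix f assume f: "f \<in> Arr A"
    let ?X = "Dom A f" and ?Y = "Cod A f"
    have XY: "?X \<in> Obj A" "?Y \<in> Obj A"
      using f by auto
    note a = s[OF XY(1)] s[OF XY(2)] ts(6,7)[OF XY(1)] ts(6,7)[OF XY(2)]
      F.B.iso_arr_arr[OF ts(5)[OF XY(1)]] F.B.iso_arr_arr[OF ts(5)[OF XY(2)]]
    have "on_arr F f \<cdot>\<^bsub>B\<^esub> s ?X = s ?Y \<cdot>\<^bsub>B\<^esub> (t ?Y \<cdot>\<^bsub>B\<^esub> (on_arr F f \<cdot>\<^bsub>B\<^esub> s ?X))"
      using f a by (simp add: F.B.cmp_eq[OF a(9)])
    also have "\<dots> = s ?Y \<cdot>\<^bsub>B\<^esub> (on_arr G f \<cdot>\<^bsub>B\<^esub> (t ?X \<cdot>\<^bsub>B\<^esub> s ?X))"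
      using f a by (simp add: F.B.cmp_eq[OF ts(8)[OF f, symmetric]] del: a(5))
    also have "\<dots> = s ?Y \<cdot>\<^bsub>B\<^esub> on_arr G f"
      using f a by simp
    finally show "on_arr F f \<cdot>\<^bsub>B\<^esub> s ?X = s ?Y \<cdot>\<^bsub>B\<^esub> on_arr G f" .
  qed (use s in auto)
  then show ?thesis
    unfolding nat_isomorphic_def by blast
qed

lemma nat_isomorphic_trans:
  assumes "nat_isomorphic F G" "nat_isomorphic G H"
  shows "nat_isomorphic F H"
proof -
  define A B where AB: "A = Src F" "B = Tgt F"
  obtain t s where t: "nat_iso F G t" and s: "nat_iso G H s"
    using assms by (auto simp: nat_isomorphic_def)
  note ts = nat_isoD[OF t AB(1,2)[symmetric]]
  note ss = nat_isoD[OF s ts(3,4)]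
  interpret F: ftr A B F using ts AB[symmetric] by (intro ftrI) auto
  interpret G: ftr A B G using ts AB[symmetric] by (intro ftrI) auto
  interpret H: ftr A B H using ss AB[symmetric] by (intro ftrI) auto
  have "nat_iso F H (\<lambda>X. s X \<cdot>\<^bsub>B\<^esub> t X)"
  proof (rule nat_isoI[OF ts(1) ss(2) AB(1)[symmetric] ss(3) AB(2)[symmetric] ss(4)])
    fix f assume f: "f \<in> Arr A"
    let ?X = "Dom A f" and ?Y = "Cod A f"
    have XY: "?X \<in> Obj A" "?Y \<in> Obj A"
      using f by auto
    note a = ts(6,7)[OF XY(1)] ts(6,7)[OF XY(2)] ss(6,7)[OF XY(1)] ss(6,7)[OF XY(2)]
      F.B.iso_arr_arr[OF ts(5)[OF XY(1)]] F.B.iso_arr_arr[OF ts(5)[OF XY(2)]]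
      F.B.iso_arr_arr[OF ss(5)[OF XY(1)]] F.B.iso_arr_arr[OF ss(5)[OF XY(2)]]
    show "on_arr H f \<cdot>\<^bsub>B\<^esub> (s ?X \<cdot>\<^bsub>B\<^esub> t ?X) = (s ?Y \<cdot>\<^bsub>B\<^esub> t ?Y) \<cdot>\<^bsub>B\<^esub> on_arr F f"
      using f a by (simp add: F.B.cmp_eq[OF ss(8)[OF f]] ts(8)[OF f])
  qed (use ts ss in \<open>auto intro!: F.B.iso_cmp\<close>)
  then show ?thesis
    unfolding nat_isomorphic_def by blast
qed

lemma nat_isomorphic_comp_left:
  assumes "nat_isomorphic F G" "is_functor H" "Src H = Tgt F"
  shows "nat_isomorphic (comp_functor H F) (comp_functor H G)"
proof -
  define A B E where AB: "A = Src F" "B = Tgt F" "E = Tgt H"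
  obtain t where t: "nat_iso F G t"
    using assms by (auto simp: nat_isomorphic_def)
  note ts = nat_isoD[OF t AB(1,2)[symmetric]]
  interpret F: ftr A B F using ts AB[symmetric] by (intro ftrI) auto
  interpret G: ftr A B G using ts AB[symmetric] by (intro ftrI) auto
  interpret H: ftr B E H using assms AB[symmetric] by (intro ftrI) auto
  have "nat_iso (comp_functor H F) (comp_functor H G) (\<lambda>X. on_arr H (t X))"
  proof (rule nat_isoI[of _ _ A E])
    show "is_functor (comp_functor H F)" "is_functor (comp_functor H G)"
      using ts assms AB[symmetric] by (auto intro!: is_functor_comp)
    fix f assume f: "f \<in> Arr A"
    let ?X = "Dom A f" and ?Y = "Cod A f"
    have XY: "?X \<in> Obj A" "?Y \<in> Obj A"
      using f by auto
    note a = ts(6,7)[OF XY(1)] ts(6,7)[OF XY(2)]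
      F.B.iso_arr_arr[OF ts(5)[OF XY(1)]] F.B.iso_arr_arr[OF ts(5)[OF XY(2)]]
    show "on_arr (comp_functor H G) f \<cdot>\<^bsub>E\<^esub> on_arr H (t ?X) =
        on_arr H (t ?Y) \<cdot>\<^bsub>E\<^esub> on_arr (comp_functor H F) f"
      using f a by (simp flip: H.cmp add: ts(8)[OF f])
  qed (use ts assms AB[symmetric] in \<open>auto intro!: H.iso\<close>)
  then show ?thesis
    unfolding nat_isomorphic_def by blast
qed

lemma nat_isomorphic_comp_right:
  assumes "nat_isomorphic F G" "is_functor H" "Tgt H = Src F"
  shows "nat_isomorphic (comp_functor F H) (comp_functor G H)"
proof -
  define A B E where AB: "A = Src F" "B = Tgt F" "E = Src H"
  obtain t where t: "nat_iso F G t"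
    using assms by (auto simp: nat_isomorphic_def)
  note ts = nat_isoD[OF t AB(1,2)[symmetric]]
  interpret H: ftr E A H using assms AB[symmetric] by (intro ftrI) auto
  have "nat_iso (comp_functor F H) (comp_functor G H) (\<lambda>X. t (on_obj H X))"
  proof (rule nat_isoI[of _ _ E B])
    show "is_functor (comp_functor F H)" "is_functor (comp_functor G H)"
      using ts assms AB[symmetric] by (auto intro!: is_functor_comp)
    fix f assume "f \<in> Arr E"
    then show "on_arr (comp_functor G H) f \<cdot>\<^bsub>B\<^esub> t (on_obj H (Dom E f)) =
        t (on_obj H (Cod E f)) \<cdot>\<^bsub>B\<^esub> on_arr (comp_functor F H) f"
      using ts(8)[of "on_arr H f"] by simp
  qed (use ts assms AB[symmetric] in auto)
  then show ?thesis
    unfolding nat_isomorphic_def by blast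
qed

section \<open>Adjunctions\<close>

locale adjunction = F: ftr A D F + G: ftr D A G
  for A :: "('o, 'm) category" and D :: "('p, 'n) category" and F G +
  fixes \<eta> :: "'o \<Rightarrow> 'm" and \<epsilon> :: "'p \<Rightarrow> 'n"
  assumes unit: "nat_trans (id_functor A) (comp_functor G F) \<eta>"
    and counit: "nat_trans (comp_functor F G) (id_functor D) \<epsilon>"
    and triangle_F: "X \<in> Obj A \<Longrightarrow> \<epsilon> (on_obj F X) \<cdot>\<^bsub>D\<^esub> on_arr F (\<eta> X) = Ident D (on_obj F X)"
    and triangle_G: "Y \<in> Obj D \<Longrightarrow> on_arr G (\<epsilon> Y) \<cdot>\<^bsub>A\<^esub> \<eta> (on_obj G Y) = Ident A (on_obj G Y)"
begin

lemma unit_simps [simp]: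
  assumes "X \<in> Obj A"
  shows "\<eta> X \<in> Arr A" "Dom A (\<eta> X) = X" "Cod A (\<eta> X) = on_obj G (on_obj F X)"
  using unit assms by (auto simp: nat_trans_def Hom_def)

lemma unit_natural:
  "f \<in> Arr A \<Longrightarrow> on_arr G (on_arr F f) \<cdot>\<^bsub>A\<^esub> \<eta> (Dom A f) = \<eta> (Cod A f) \<cdot>\<^bsub>A\<^esub> f"
  using unit by (auto simp: nat_trans_def)

lemma counit_simps [simp]:
  assumes "Y \<in> Obj D"
  shows "\<epsilon> Y \<in> Arr D" "Dom D (\<epsilon> Y) = on_obj F (on_obj G Y)" "Cod D (\<epsilon> Y) = Y"
  using counit assms by (auto simp: nat_trans_def Hom_def)

lemma counit_natural:
  "g \<in> Arr D \<Longrightarrow> g \<cdot>\<^bsub>D\<^esub> \<epsilon> (Dom D g) = \<epsilon> (Cod D g) \<cdot>\<^bsub>D\<^esub> on_arr F (on_arr G g)"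
  using counit by (auto simp: nat_trans_def)

text \<open>This is the surjective half of the hom-set bijection: naturality of the unit followed by
  the triangle identity for \<open>G\<close>.\<close>

lemma transpose:
  assumes "X \<in> Obj A" "Y \<in> Obj D" "f \<in> Arr A" "Dom A f = X" "Cod A f = on_obj G Y"
  shows "on_arr G (\<epsilon> Y \<cdot>\<^bsub>D\<^esub> on_arr F f) \<cdot>\<^bsub>A\<^esub> \<eta> X = f"
  using assms unit_natural[of f] F.A.cmp_eq[OF triangle_G[of Y]] by (simp add: G.cmp)

text \<open>This is the injective half: an arrow out of \<open>F X\<close> is recovered from its
  transpose by the triangle identity for \<open>F\<close>. Equations between arrows out of
  \<open>F X\<close> are thereby checked in \<open>A\<close>.\<close>

lemma transpose_inject:
  assumes "g \<in> Arr D" "g' \<in> Arr D" "X \<in> Obj A" "Dom D g = on_obj F X" "Dom D g' = on_obj F X"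
    "Cod D g = Cod D g'" "on_arr G g \<cdot>\<^bsub>A\<^esub> \<eta> X = on_arr G g' \<cdot>\<^bsub>A\<^esub> \<eta> X"
  shows "g = g'"
proof -
  have "h = \<epsilon> (Cod D h) \<cdot>\<^bsub>D\<^esub> on_arr F (on_arr G h \<cdot>\<^bsub>A\<^esub> \<eta> X)"
    if "h \<in> Arr D" "Dom D h = on_obj F X" for h
  proof -
    have "h = h \<cdot>\<^bsub>D\<^esub> (\<epsilon> (on_obj F X) \<cdot>\<^bsub>D\<^esub> on_arr F (\<eta> X))"
      using that assms(3) triangle_F by simp
    also have "\<dots> = \<epsilon> (Cod D h) \<cdot>\<^bsub>D\<^esub> on_arr F (on_arr G h \<cdot>\<^bsub>A\<^esub> \<eta> X)"
      using that assms(3) counit_natural[of h] F.B.cmp_eq[OF counit_natural[of h]] by (simp add: F.cmp)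
    finally show ?thesis .
  qed
  from this[of g] this[of g'] show ?thesis
    unfolding assms(6,7) using assms(1,2,4,5) by simp
qed

text \<open>Arrows into \<open>G\<close> of the domain are transposed to \<open>D\<close>, cancelled
  against \<open>f\<close> there, and transposed back.\<close>

lemma right_monic:
  assumes "monic D f"
  shows "monic A (on_arr G f)"
proof (rule F.A.monicI)
  have f: "f \<in> Arr D"
    using assms by simp
  then show "on_arr G f \<in> Arr A"
    by simp
  fix g h assume a: "g \<in> Arr A" "h \<in> Arr A" "Dom A g = Dom A h" "Cod A g = Dom A (on_arr G f)"
    "Cod A h = Dom A (on_arr G f)" "on_arr G f \<cdot>\<^bsub>A\<^esub> g = on_arr G f \<cdot>\<^bsub>A\<^esub> h"
  let ?t = "\<lambda>g. \<epsilon> (Dom D f) \<cdot>\<^bsub>D\<^esub> on_arr F g"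
  have t: "f \<cdot>\<^bsub>D\<^esub> ?t g' = \<epsilon> (Cod D f) \<cdot>\<^bsub>D\<^esub> on_arr F (on_arr G f \<cdot>\<^bsub>A\<^esub> g')"
    if "g' \<in> Arr A" "Cod A g' = Dom A (on_arr G f)" for g'
    using that f F.B.cmp_eq[OF counit_natural[OF f]] by (simp add: F.cmp)
  have "f \<cdot>\<^bsub>D\<^esub> ?t g = f \<cdot>\<^bsub>D\<^esub> ?t h"
    unfolding t[OF a(1,4)] t[OF a(2,5)] a(6) ..
  then have "?t g = ?t h"
    by (rule F.B.monic_cancel[OF assms]) (use a(1,2,4,5) f in auto)
  moreover have "on_arr G (?t g) \<cdot>\<^bsub>A\<^esub> \<eta> (Dom A g) = g" "on_arr G (?t h) \<cdot>\<^bsub>A\<^esub> \<eta> (Dom A h) = h"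
    by (rule transpose; use a(1,2,4,5) f in simp)+
  ultimately show "g = h"
    using a(3) by metis
qed

lemma left_epic:
  assumes "epic A f"
  shows "epic D (on_arr F f)"
proof (rule F.B.epicI)
  have f: "f \<in> Arr A"
    using assms by simp
  then show "on_arr F f \<in> Arr D"
    by simp
  fix g h assume a: "g \<in> Arr D" "h \<in> Arr D" "Cod D g = Cod D h" "Dom D g = Cod D (on_arr F f)"
    "Dom D h = Cod D (on_arr F f)" "g \<cdot>\<^bsub>D\<^esub> on_arr F f = h \<cdot>\<^bsub>D\<^esub> on_arr F f"
  have t: "(on_arr G g' \<cdot>\<^bsub>A\<^esub> \<eta> (Cod A f)) \<cdot>\<^bsub>A\<^esub> f = on_arr G (g' \<cdot>\<^bsub>D\<^esub> on_arr F f) \<cdot>\<^bsub>A\<^esub> \<eta> (Dom A f)"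
    if "g' \<in> Arr D" "Dom D g' = Cod D (on_arr F f)" for g'
    using that f unit_natural[OF f] by (simp add: G.cmp)
  have "(on_arr G g \<cdot>\<^bsub>A\<^esub> \<eta> (Cod A f)) \<cdot>\<^bsub>A\<^esub> f = (on_arr G h \<cdot>\<^bsub>A\<^esub> \<eta> (Cod A f)) \<cdot>\<^bsub>A\<^esub> f"
    unfolding t[OF a(1,4)] t[OF a(2,5)] a(6) ..
  then have "on_arr G g \<cdot>\<^bsub>A\<^esub> \<eta> (Cod A f) = on_arr G h \<cdot>\<^bsub>A\<^esub> \<eta> (Cod A f)"
    by (rule F.A.epic_cancel[OF assms]) (use a(1,2,4,5) f in auto)
  then show "g = h"
    by (intro transpose_inject[of g h "Cod A f"]) (use a f in auto)
qed

end

lemma right_adjoint_iff: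
  "right_adjoint F G \<longleftrightarrow> (\<exists>\<eta> \<epsilon>. adjunction (Src F) (Tgt F) F G \<eta> \<epsilon>)"
  unfolding right_adjoint_def adjunction_def adjunction_axioms_def
  by (auto simp: ftr_def ftr_axioms_def intro: ftrI) (auto simp: cat_def is_functor_def)

section \<open>Adjunctions with full and faithful right adjoint\<close>

locale reflection = adjunction A D F G \<eta> \<epsilon>
  for A :: "('o, 'm) category" and D :: "('p, 'n) category" and F G \<eta> \<epsilon> +
  assumes ff: "full_faithful G"
begin

lemma full:
  assumes "X \<in> Obj D" "Y \<in> Obj D" "f \<in> Arr A" "Dom A f = on_obj G X" "Cod A f = on_obj G Y"
  obtains g where "g \<in> Arr D" "Dom D g = X" "Cod D g = Y" "on_arr G g = f"
proof -
  have "f \<in> on_arr G ` Hom D X Y"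
    using ff assms unfolding full_faithful_def bij_betw_def by (simp add: F.A.Hom_iff)
  then show ?thesis
    using that by (auto simp: F.B.Hom_iff)
qed

lemma faithful:
  assumes "f \<in> Arr D" "g \<in> Arr D" "Dom D f = Dom D g" "Cod D f = Cod D g" "on_arr G f = on_arr G g"
  shows "f = g"
proof -
  have "inj_on (on_arr G) (Hom D (Dom D g) (Cod D g))"
    using ff assms unfolding full_faithful_def bij_betw_def by simp
  then show ?thesis
    using assms by (auto simp: inj_on_def F.B.Hom_iff)
qed

text \<open>Fullness lifts the unit at \<open>G Y\<close> to \<open>D\<close>; by the triangle
  identity for \<open>G\<close> the lift is inverse to the counit.\<close>

definition counit_inv :: "'p \<Rightarrow> 'n" where
  "counit_inv Y = (SOME s. s \<in> Arr D \<and> Dom D s = Y \<and> Cod D s = on_obj F (on_obj G Y) \<and>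
     on_arr G s = \<eta> (on_obj G Y))"

lemma counit_inv_simps [simp]:
  assumes "Y \<in> Obj D"
  shows "counit_inv Y \<in> Arr D" "Dom D (counit_inv Y) = Y" "Cod D (counit_inv Y) = on_obj F (on_obj G Y)"
    "\<epsilon> Y \<cdot>\<^bsub>D\<^esub> counit_inv Y = Ident D Y"
    "counit_inv Y \<cdot>\<^bsub>D\<^esub> \<epsilon> Y = Ident D (on_obj F (on_obj G Y))"
proof -
  have "\<exists>s. s \<in> Arr D \<and> Dom D s = Y \<and> Cod D s = on_obj F (on_obj G Y) \<and> on_arr G s = \<eta> (on_obj G Y)"
    using full[of Y "on_obj F (on_obj G Y)" "\<eta> (on_obj G Y)"] assms by auto
  then have "counit_inv Y \<in> Arr D \<and> Dom D (counit_inv Y) = Y \<and>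
      Cod D (counit_inv Y) = on_obj F (on_obj G Y) \<and> on_arr G (counit_inv Y) = \<eta> (on_obj G Y)"
    unfolding counit_inv_def by (rule someI_ex)
  then have s: "counit_inv Y \<in> Arr D" "Dom D (counit_inv Y) = Y"
    "Cod D (counit_inv Y) = on_obj F (on_obj G Y)" "on_arr G (counit_inv Y) = \<eta> (on_obj G Y)"
    by auto
  then show "counit_inv Y \<in> Arr D" "Dom D (counit_inv Y) = Y" "Cod D (counit_inv Y) = on_obj F (on_obj G Y)"
    by auto
  show "\<epsilon> Y \<cdot>\<^bsub>D\<^esub> counit_inv Y = Ident D Y"
    by (rule faithful) (use s assms triangle_G[OF assms] in \<open>auto simp: G.cmp\<close>)
  show "counit_inv Y \<cdot>\<^bsub>D\<^esub> \<epsilon> Y = Ident D (on_obj F (on_obj G Y))"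
    by (rule transpose_inject[of _ _ "on_obj G Y"])
       (use s assms triangle_G[OF assms] in \<open>auto simp: G.cmp\<close>)
qed

lemma counit_iso:
  assumes "Y \<in> Obj D"
  shows "iso_arr D (\<epsilon> Y)" "iso_arr D (counit_inv Y)"
  by (rule F.B.iso_arrI[of _ "counit_inv Y"], use assms in auto)
     (rule F.B.iso_arrI[of _ "\<epsilon> Y"], use assms in auto)

lemma counit_inv_natural:
  assumes "f \<in> Arr D"
  shows "counit_inv (Cod D f) \<cdot>\<^bsub>D\<^esub> f = on_arr F (on_arr G f) \<cdot>\<^bsub>D\<^esub> counit_inv (Dom D f)"
proof (rule F.B.monic_cancel[OF F.B.iso_monic[OF counit_iso(1)[of "Cod D f"]]])
  show "\<epsilon> (Cod D f) \<cdot>\<^bsub>D\<^esub> (counit_inv (Cod D f) \<cdot>\<^bsub>D\<^esub> f) =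
      \<epsilon> (Cod D f) \<cdot>\<^bsub>D\<^esub> (on_arr F (on_arr G f) \<cdot>\<^bsub>D\<^esub> counit_inv (Dom D f))"
    using F.B.cmp_eq[OF counit_inv_simps(4)[of "Cod D f"]] F.B.cmp_eq[OF counit_natural[OF assms, symmetric]] assms
    by simp
qed (use assms in auto)

text \<open>The triangle identity makes \<open>F \<eta>\<close> a section of an invertible counit.
  That a reflector inverts its own unit is what later allows two reflectors to be compared.\<close>

lemma left_unit_iso:
  assumes "X \<in> Obj A"
  shows "iso_arr D (on_arr F (\<eta> X))"
proof -
  let ?Y = "on_obj F X"
  have "on_arr F (\<eta> X) = counit_inv ?Y \<cdot>\<^bsub>D\<^esub> (\<epsilon> ?Y \<cdot>\<^bsub>D\<^esub> on_arr F (\<eta> X))"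
    using assms by (simp add: F.B.cmp_eq[OF counit_inv_simps(5)] del: triangle_F)
  then have "on_arr F (\<eta> X) = counit_inv ?Y"
    using triangle_F[OF assms] assms by simp
  then show ?thesis
    using counit_iso(2)[of ?Y] assms by simp
qed

end

section \<open>Reflective subcategories with a left exact reflector\<close>

locale additive_reflection = reflection A D F G \<eta> \<epsilon> + A: abcat A add zer
  for A :: "('o, 'm) category" and D :: "('p, 'n) category" and F G \<eta> \<epsilon> add zer
begin

abbreviation "arrD f \<equiv> f \<in> Arr D"

text \<open>On each hom-set this inverts the bijection given by the full and faithful
  \<open>G\<close>, so the group structure of hom-sets can be carried over from \<open>A\<close> to
  \<open>D\<close>.\<close>

definition lift :: "'p \<Rightarrow> 'p \<Rightarrow> 'm \<Rightarrow> 'n" where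
  "lift X Y f = (SOME g. arrD g \<and> Dom D g = X \<and> Cod D g = Y \<and> on_arr G g = f)"

lemma lift_simps [simp]:
  assumes "X \<in> Obj D" "Y \<in> Obj D" "f \<in> Arr A" "Dom A f = on_obj G X" "Cod A f = on_obj G Y"
  shows "arrD (lift X Y f)" "Dom D (lift X Y f) = X" "Cod D (lift X Y f) = Y" "on_arr G (lift X Y f) = f"
proof -
  have "\<exists>g. arrD g \<and> Dom D g = X \<and> Cod D g = Y \<and> on_arr G g = f"
    using full[OF assms] by metis
  from someI_ex[OF this] show "arrD (lift X Y f)" "Dom D (lift X Y f) = X"
    "Cod D (lift X Y f) = Y" "on_arr G (lift X Y f) = f"
    by (auto simp: lift_def)
qed

definition addD :: "'n \<Rightarrow> 'n \<Rightarrow> 'n" where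
  "addD f g = lift (Dom D f) (Cod D f) (add (on_arr G f) (on_arr G g))"

definition zerD :: "'p \<Rightarrow> 'p \<Rightarrow> 'n" where
  "zerD X Y = lift X Y (zer (on_obj G X) (on_obj G Y))"

definition negD :: "'n \<Rightarrow> 'n" where
  "negD f = lift (Dom D f) (Cod D f) (A.neg (on_arr G f))"

lemma addD_arr [simp]:
  assumes "arrD f" "arrD g" "Dom D f = Dom D g" "Cod D f = Cod D g"
  shows "arrD (addD f g)" "Dom D (addD f g) = Dom D g" "Cod D (addD f g) = Cod D g"
    "on_arr G (addD f g) = add (on_arr G f) (on_arr G g)"
  using assms by (simp_all add: addD_def)

lemma zerD_arr [simp]:
  assumes "X \<in> Obj D" "Y \<in> Obj D"
  shows "arrD (zerD X Y)" "Dom D (zerD X Y) = X" "Cod D (zerD X Y) = Y"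
    "on_arr G (zerD X Y) = zer (on_obj G X) (on_obj G Y)"
  using assms by (simp_all add: zerD_def)

lemma negD_arr [simp]:
  assumes "arrD f"
  shows "arrD (negD f)" "Dom D (negD f) = Dom D f" "Cod D (negD f) = Cod D f"
    "on_arr G (negD f) = A.neg (on_arr G f)"
  using assms by (simp_all add: negD_def)

lemma add_assoc_A:
  assumes "f \<in> Hom A X Y" "g \<in> Hom A X Y" "h \<in> Hom A X Y" "X \<in> Obj A" "Y \<in> Obj A"
  shows "add (add f g) h = add f (add g h)"
proof -
  interpret H: comm_group "A.hom_group X Y"
    using A.comm_group_hom assms by simp
  show ?thesis
    using H.m_assoc[of f g h] assms by simp
qed

lemma additive_on_D: "additive_on D addD zerD"
  unfolding additive_on_def
proof (intro conjI ballI)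
  fix X Y assume XY: "X \<in> Obj D" "Y \<in> Obj D"
  show "comm_group \<lparr>carrier = Hom D X Y, mult = addD, one = zerD X Y\<rparr>"
  proof (rule comm_groupI, simp_all only: partial_object.simps monoid.simps F.B.Hom_iff)
    fix f g h assume f: "arrD f \<and> Dom D f = X \<and> Cod D f = Y"
    show "addD (zerD X Y) f = f"
      by (rule faithful) (use f XY in \<open>auto simp: A.add_zer\<close>)
    show "\<exists>k\<in>Hom D X Y. addD k f = zerD X Y"
    proof (rule bexI[of _ "negD f"])
      show "addD (negD f) f = zerD X Y"
        by (rule faithful)
          (use f XY A.add_neg[of "on_arr G f"] A.add_commute[of "on_arr G f" "A.neg (on_arr G f)"] in auto)
    qed (use f in \<open>auto simp: F.B.Hom_iff\<close>)
    assume g: "arrD g \<and> Dom D g = X \<and> Cod D g = Y"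
    show "addD f g = addD g f"
      by (rule faithful) (use f g A.add_commute[of "on_arr G f" "on_arr G g"] in auto)
    show "arrD (addD f g) \<and> Dom D (addD f g) = X \<and> Cod D (addD f g) = Y"
      using f g by simp
    assume h: "arrD h \<and> Dom D h = X \<and> Cod D h = Y"
    show "addD (addD f g) h = addD f (addD g h)"
      by (rule faithful)
        (use f g h XY add_assoc_A[of "on_arr G f" "on_obj G X" "on_obj G Y" "on_arr G g" "on_arr G h"]
          in \<open>auto simp: F.A.Hom_iff\<close>)
  qed (use XY in simp)
next
  fix X Y Z f f' g g'
  assume a: "f \<in> Hom D X Y" "f' \<in> Hom D X Y" "g \<in> Hom D Y Z" "g' \<in> Hom D Y Z"
  then have a': "arrD f" "arrD f'" "arrD g" "arrD g'" "Dom D f = X" "Dom D f' = X" "Cod D f = Y" "Cod D f' = Y"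
    "Dom D g = Y" "Dom D g' = Y" "Cod D g = Z" "Cod D g' = Z"
    by (auto simp: F.B.Hom_iff)
  show "g \<cdot>\<^bsub>D\<^esub> addD f f' = addD (g \<cdot>\<^bsub>D\<^esub> f) (g \<cdot>\<^bsub>D\<^esub> f')"
    by (rule faithful) (use a' in \<open>simp_all add: G.cmp A.cmp_add\<close>)
  show "addD g g' \<cdot>\<^bsub>D\<^esub> f = addD (g \<cdot>\<^bsub>D\<^esub> f) (g' \<cdot>\<^bsub>D\<^esub> f)"
    by (rule faithful) (use a' in \<open>simp_all add: G.cmp A.add_cmp\<close>)
qed

lemma left_zer:
  assumes "X \<in> Obj A" "Y \<in> Obj A"
  shows "on_arr F (zer X Y) = zerD (on_obj F X) (on_obj F Y)"
  by (rule transpose_inject[of _ _ X]) (use assms unit_natural[of "zer X Y"] in auto)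

text \<open>Both sides have the same transpose, the unit composed with \<open>add f g\<close>,
  because composition distributes over addition.\<close>

lemma left_add:
  assumes "f \<in> Arr A" "g \<in> Arr A" "Dom A f = Dom A g" "Cod A f = Cod A g"
  shows "on_arr F (add f g) = addD (on_arr F f) (on_arr F g)"
  by (rule transpose_inject[of _ _ "Dom A g"])
    (use assms unit_natural[of "add f g"] unit_natural[of f] unit_natural[of g]
      in \<open>auto simp: A.add_cmp A.cmp_add\<close>)

lemma zero_obj_D: "\<exists>Z. zero_obj D Z"
proof -
  interpret D: preadd D addD zerD
    using additive_on_D by unfold_locales
  obtain Z where Z: "zero_obj A Z"
    using A.zero_obj_exists by blast
  then have ZA: "Z \<in> Obj A"
    by (simp add: zero_obj_def)
  have "zero_obj D (on_obj F Z)"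
  proof (rule D.zero_objI)
    show "Ident D (on_obj F Z) = zerD (on_obj F Z) (on_obj F Z)"
      using left_zer[OF ZA ZA] A.zero_obj_ide[OF Z] ZA by (metis F.ide)
  qed (use ZA in simp)
  then show ?thesis ..
qed

sublocale D: additive_cat D addD zerD
  using additive_on_D zero_obj_D by unfold_locales

text \<open>A biproduct is described by equations, which the additive \<open>F\<close> preserves. So
  \<open>F\<close> of a biproduct of \<open>G X\<close> and \<open>G Y\<close> is a product of
  \<open>F (G X)\<close> and \<open>F (G Y)\<close>, and the counits identify these with
  \<open>X\<close> and \<open>Y\<close>.\<close>

lemma product_D:
  assumes "X \<in> Obj D" "Y \<in> Obj D"
  shows "\<exists>P p q. is_product D X Y P p q"
proof -
  have GXY: "on_obj G X \<in> Obj A" "on_obj G Y \<in> Obj A"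
    using assms by auto
  obtain P p q i j where b: "P \<in> Obj A" "p \<in> Arr A" "Dom A p = P" "Cod A p = on_obj G X"
    "q \<in> Arr A" "Dom A q = P" "Cod A q = on_obj G Y"
    "i \<in> Arr A" "Dom A i = on_obj G X" "Cod A i = P" "j \<in> Arr A" "Dom A j = on_obj G Y" "Cod A j = P"
    "p \<cdot>\<^bsub>A\<^esub> i = Ident A (on_obj G X)" "q \<cdot>\<^bsub>A\<^esub> i = zer (on_obj G X) (on_obj G Y)"
    "p \<cdot>\<^bsub>A\<^esub> j = zer (on_obj G Y) (on_obj G X)" "q \<cdot>\<^bsub>A\<^esub> j = Ident A (on_obj G Y)"
    "add (i \<cdot>\<^bsub>A\<^esub> p) (j \<cdot>\<^bsub>A\<^esub> q) = Ident A P"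
    by (rule A.biproduct_exists[OF GXY])
  let ?p = "\<epsilon> X \<cdot>\<^bsub>D\<^esub> on_arr F p" and ?q = "\<epsilon> Y \<cdot>\<^bsub>D\<^esub> on_arr F q"
  note pi = F.cmp[of i p, unfolded b(14)] and qi = F.cmp[of i q, unfolded b(15)]
    and pj = F.cmp[of j p, unfolded b(16)] and qj = F.cmp[of j q, unfolded b(17)]
  let ?sX = "counit_inv X" and ?sY = "counit_inv Y"
  have idP: "addD (on_arr F i \<cdot>\<^bsub>D\<^esub> on_arr F p) (on_arr F j \<cdot>\<^bsub>D\<^esub> on_arr F q) = Ident D (on_obj F P)"
    using left_add[of "i \<cdot>\<^bsub>A\<^esub> p" "j \<cdot>\<^bsub>A\<^esub> q"] b by (simp add: F.cmp)
  have "is_product D X Y (on_obj F P) ?p ?q"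
    unfolding is_product_def F.B.Hom_iff Ball_def
  proof (intro conjI allI impI)
    fix W f g assume fg: "W \<in> Obj D" "arrD f \<and> Dom D f = W \<and> Cod D f = X" "arrD g \<and> Dom D g = W \<and> Cod D g = Y"
    define u where "u = addD (on_arr F i \<cdot>\<^bsub>D\<^esub> (?sX \<cdot>\<^bsub>D\<^esub> f)) (on_arr F j \<cdot>\<^bsub>D\<^esub> (?sY \<cdot>\<^bsub>D\<^esub> g))"
    have u: "arrD u" "Dom D u = W" "Cod D u = on_obj F P"
      using b fg assms by (auto simp: u_def)
    have "on_arr F p \<cdot>\<^bsub>D\<^esub> u = ?sX \<cdot>\<^bsub>D\<^esub> f"
      using b fg assms GXY F.B.cmp_eq[OF pi[symmetric]] F.B.cmp_eq[OF pj[symmetric]]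
      by (simp add: u_def D.cmp_add left_zer D.add_zer)
    then have pu: "?p \<cdot>\<^bsub>D\<^esub> u = f"
      using u b fg assms F.B.cmp_eq[OF counit_inv_simps(4)[of X]] by simp
    have "on_arr F q \<cdot>\<^bsub>D\<^esub> u = ?sY \<cdot>\<^bsub>D\<^esub> g"
      using b fg assms GXY F.B.cmp_eq[OF qi[symmetric]] F.B.cmp_eq[OF qj[symmetric]]
      by (simp add: u_def D.cmp_add left_zer D.add_zer)
    then have qu: "?q \<cdot>\<^bsub>D\<^esub> u = g"
      using u b fg assms F.B.cmp_eq[OF counit_inv_simps(4)[of Y]] by simp
    show "\<exists>!u. (arrD u \<and> Dom D u = W \<and> Cod D u = on_obj F P) \<and> ?p \<cdot>\<^bsub>D\<^esub> u = f \<and> ?q \<cdot>\<^bsub>D\<^esub> u = g"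
    proof (rule ex1I[of _ u])
      fix v assume v: "(arrD v \<and> Dom D v = W \<and> Cod D v = on_obj F P) \<and> ?p \<cdot>\<^bsub>D\<^esub> v = f \<and> ?q \<cdot>\<^bsub>D\<^esub> v = g"
      have "v = addD (on_arr F i \<cdot>\<^bsub>D\<^esub> on_arr F p) (on_arr F j \<cdot>\<^bsub>D\<^esub> on_arr F q) \<cdot>\<^bsub>D\<^esub> v"
        using v idP by simp
      also have "\<dots> = addD ((on_arr F i \<cdot>\<^bsub>D\<^esub> on_arr F p) \<cdot>\<^bsub>D\<^esub> v) ((on_arr F j \<cdot>\<^bsub>D\<^esub> on_arr F q) \<cdot>\<^bsub>D\<^esub> v)"
        by (rule D.add_cmp) (use v b in auto)
      also have "\<dots> = addD (on_arr F i \<cdot>\<^bsub>D\<^esub> (?sX \<cdot>\<^bsub>D\<^esub> (?p \<cdot>\<^bsub>D\<^esub> v))) (on_arr F j \<cdot>\<^bsub>D\<^esub> (?sY \<cdot>\<^bsub>D\<^esub> (?q \<cdot>\<^bsub>D\<^esub> v)))"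
        using v[THEN conjunct1] b assms
        by (simp add: F.B.cmp_eq[OF counit_inv_simps(5)])
      also have "\<dots> = u"
        using v by (simp add: u_def)
      finally show "v = u" .
    qed (use u pu qu in simp)
  qed (use b assms in auto)
  then show ?thesis
    by blast
qed

text \<open>A right adjoint preserves limits: the test arrow is transposed to \<open>D\<close>,
  factored through the kernel there, and transposed back.\<close>

lemma right_kernel:
  assumes "is_kernel D k f"
  shows "is_kernel A (on_arr G k) (on_arr G f)"
proof -
  note k = D.kernel_simps[OF assms]
  show ?thesis
  proof (rule A.kernelI)
    show "monic A (on_arr G k)"
      by (rule right_monic[OF D.kernel_monic[OF assms]])
    show "on_arr G f \<cdot>\<^bsub>A\<^esub> on_arr G k = zer (Dom A (on_arr G k)) (Cod A (on_arr G f))"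
      using k G.cmp[of k f] by simp
    fix h assume h: "h \<in> Arr A" "Cod A h = Dom A (on_arr G f)"
      "on_arr G f \<cdot>\<^bsub>A\<^esub> h = zer (Dom A h) (Cod A (on_arr G f))"
    have hc: "Cod A h = on_obj G (Dom D f)"
      using h(2) k by simp
    let ?g = "\<epsilon> (Dom D f) \<cdot>\<^bsub>D\<^esub> on_arr F h"
    have g: "arrD ?g" "Dom D ?g = on_obj F (Dom A h)" "Cod D ?g = Dom D f"
      using h(1) hc k by auto
    have Gg: "on_arr G ?g \<cdot>\<^bsub>A\<^esub> \<eta> (Dom A h) = h"
      by (rule transpose) (use h(1) hc k in auto)
    have "f \<cdot>\<^bsub>D\<^esub> ?g = \<epsilon> (Cod D f) \<cdot>\<^bsub>D\<^esub> on_arr F (on_arr G f \<cdot>\<^bsub>A\<^esub> h)"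
      using h(1) hc k F.B.cmp_eq[OF counit_natural[of f]] by (simp add: F.cmp)
    also have "\<dots> = zerD (Dom D ?g) (Cod D f)"
      unfolding h(3) using h(1) hc k by (simp add: left_zer)
    finally obtain v where v: "arrD v" "Dom D v = Dom D ?g" "Cod D v = Dom D k" "k \<cdot>\<^bsub>D\<^esub> v = ?g"
      using D.kernel_factor[OF assms g(1,3)] by metis
    have "on_arr G k \<cdot>\<^bsub>A\<^esub> (on_arr G v \<cdot>\<^bsub>A\<^esub> \<eta> (Dom A h)) = on_arr G (k \<cdot>\<^bsub>D\<^esub> v) \<cdot>\<^bsub>A\<^esub> \<eta> (Dom A h)"
      using v(1-3) g k h(1) by (simp add: G.cmp)
    also have "\<dots> = h"
      unfolding v(4) by (rule Gg)
    finally show "\<exists>u. u \<in> Arr A \<and> Dom A u = Dom A h \<and> Cod A u = Dom A (on_arr G k) \<and> on_arr G k \<cdot>\<^bsub>A\<^esub> u = h"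
      using v g k h(1) by (intro exI[of _ "on_arr G v \<cdot>\<^bsub>A\<^esub> \<eta> (Dom A h)"]) auto
  qed (use k in auto)
qed

text \<open>If \<open>F M\<close> is zero, so is the target of the unit; conversely the triangle
  identity writes the identity of \<open>F M\<close> as a composite with
  \<open>F (\<eta> M)\<close>.\<close>

lemma left_zero_iff:
  assumes "M \<in> Obj A"
  shows "zero_obj D (on_obj F M) \<longleftrightarrow> \<eta> M = zer M (on_obj G (on_obj F M))"
proof
  assume "zero_obj D (on_obj F M)"
  then have "Ident D (on_obj F M) = zerD (on_obj F M) (on_obj F M)"
    by (rule D.zero_obj_ide)
  then have "on_arr G (Ident D (on_obj F M)) = on_arr G (zerD (on_obj F M) (on_obj F M))"
    by simp
  then have i: "Ident A (on_obj G (on_obj F M)) = zer (on_obj G (on_obj F M)) (on_obj G (on_obj F M))"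
    using assms by simp
  have "\<eta> M = Ident A (on_obj G (on_obj F M)) \<cdot>\<^bsub>A\<^esub> \<eta> M"
    using assms by simp
  then show "\<eta> M = zer M (on_obj G (on_obj F M))"
    unfolding i using assms by simp
next
  assume "\<eta> M = zer M (on_obj G (on_obj F M))"
  then have "\<epsilon> (on_obj F M) \<cdot>\<^bsub>D\<^esub> zerD (on_obj F M) (on_obj F (on_obj G (on_obj F M))) = Ident D (on_obj F M)"
    using triangle_F[OF assms] assms by (simp add: left_zer)
  then show "zero_obj D (on_obj F M)"
    using assms by (intro D.zero_objI) auto
qed

text \<open>The full and faithful \<open>G\<close> reflects kernels. Left exactness of the reflector
  thus becomes a statement about the endofunctor \<open>G F\<close> of \<open>A\<close>, where the
  abelian structure is available.\<close>

lemma left_kernel_of_right_left: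
  assumes "is_kernel A k f" and GFk: "is_kernel A (on_arr G (on_arr F k)) (on_arr G (on_arr F f))"
  shows "is_kernel D (on_arr F k) (on_arr F f)"
proof -
  note k = A.kernel_simps[OF assms(1)]
  show ?thesis
  proof (rule D.kernelI)
    show "monic D (on_arr F k)"
    proof (rule F.B.monicI)
      fix g h assume a: "arrD g" "arrD h" "Dom D g = Dom D h" "Cod D g = Dom D (on_arr F k)"
        "Cod D h = Dom D (on_arr F k)" "on_arr F k \<cdot>\<^bsub>D\<^esub> g = on_arr F k \<cdot>\<^bsub>D\<^esub> h"
      have "on_arr G (on_arr F k \<cdot>\<^bsub>D\<^esub> g) = on_arr G (on_arr F k \<cdot>\<^bsub>D\<^esub> h)"
        unfolding a(6) ..
      then have "on_arr G (on_arr F k) \<cdot>\<^bsub>A\<^esub> on_arr G g = on_arr G (on_arr F k) \<cdot>\<^bsub>A\<^esub> on_arr G h"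
        using a(1,2,4,5) k by (simp add: G.cmp)
      then have "on_arr G g = on_arr G h"
        by (rule F.A.monic_cancel[OF A.kernel_monic[OF GFk]]) (use a(1,2,4,5) k in auto)
      then show "g = h"
        by (rule faithful[rotated 4]) (use a in auto)
    qed (use k in simp)
    show "on_arr F f \<cdot>\<^bsub>D\<^esub> on_arr F k = zerD (Dom D (on_arr F k)) (Cod D (on_arr F f))"
      using k F.cmp[of k f] by (simp add: left_zer)
    fix h assume h: "arrD h" "Cod D h = Dom D (on_arr F f)"
      "on_arr F f \<cdot>\<^bsub>D\<^esub> h = zerD (Dom D h) (Cod D (on_arr F f))"
    have "on_arr G (on_arr F f) \<cdot>\<^bsub>A\<^esub> on_arr G h = zer (Dom A (on_arr G h)) (Cod A (on_arr G (on_arr F f)))"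
      using h k G.cmp[of h "on_arr F f"] by simp
    then obtain u where u: "u \<in> Arr A" "Dom A u = Dom A (on_arr G h)" "Cod A u = Dom A (on_arr G (on_arr F k))"
      "on_arr G (on_arr F k) \<cdot>\<^bsub>A\<^esub> u = on_arr G h"
      using A.kernel_factor[OF GFk, of "on_arr G h"] h k by auto
    obtain v where v: "arrD v" "Dom D v = Dom D h" "Cod D v = Dom D (on_arr F k)" "on_arr G v = u"
      using full[of "Dom D h" "Dom D (on_arr F k)" u] u h k by auto
    have "on_arr F k \<cdot>\<^bsub>D\<^esub> v = h"
      by (rule faithful) (use v u h k in \<open>simp_all add: G.cmp\<close>)
    then show "\<exists>u. arrD u \<and> Dom D u = Dom D h \<and> Cod D u = Dom D (on_arr F k) \<and> on_arr F k \<cdot>\<^bsub>D\<^esub> u = h"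
      using v by blast
  qed (use k in simp_all)
qed

text \<open>A left adjoint preserves colimits; the transpose of the test arrow is factored through
  \<open>p\<close> in \<open>A\<close>.\<close>

lemma left_cokernel:
  assumes "is_cokernel A p f"
  shows "is_cokernel D (on_arr F p) (on_arr F f)"
proof -
  note p = A.cokernel_simps[OF assms]
  show ?thesis
  proof (rule D.cokernelI)
    show "epic D (on_arr F p)"
      by (rule left_epic[OF A.cokernel_epic[OF assms]])
    show "on_arr F p \<cdot>\<^bsub>D\<^esub> on_arr F f = zerD (Dom D (on_arr F f)) (Cod D (on_arr F p))"
      using p F.cmp[of f p] by (simp add: left_zer)
    fix h assume h: "arrD h" "Dom D h = Cod D (on_arr F f)"
      "h \<cdot>\<^bsub>D\<^esub> on_arr F f = zerD (Dom D (on_arr F f)) (Cod D h)"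
    have "(on_arr G h \<cdot>\<^bsub>A\<^esub> \<eta> (Cod A f)) \<cdot>\<^bsub>A\<^esub> f = on_arr G (h \<cdot>\<^bsub>D\<^esub> on_arr F f) \<cdot>\<^bsub>A\<^esub> \<eta> (Dom A f)"
      using h(1,2) p unit_natural[of f] by (simp add: G.cmp)
    also have "\<dots> = zer (Dom A f) (on_obj G (Cod D h))"
      unfolding h(3) using h(1,2) p by simp
    finally obtain u where u: "u \<in> Arr A" "Dom A u = Cod A p" "Cod A u = on_obj G (Cod D h)"
      "u \<cdot>\<^bsub>A\<^esub> p = on_arr G h \<cdot>\<^bsub>A\<^esub> \<eta> (Cod A f)"
      using A.cokernel_factor[OF assms, of "on_arr G h \<cdot>\<^bsub>A\<^esub> \<eta> (Cod A f)"] h(1,2) p by auto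
    define v where "v = \<epsilon> (Cod D h) \<cdot>\<^bsub>D\<^esub> on_arr F u"
    have v: "arrD v" "Dom D v = Cod D (on_arr F p)" "Cod D v = Cod D h"
      using u h p by (auto simp: v_def)
    have Gv: "on_arr G v \<cdot>\<^bsub>A\<^esub> \<eta> (Cod A p) = u"
      unfolding v_def by (rule transpose) (use u h p in auto)
    have "v \<cdot>\<^bsub>D\<^esub> on_arr F p = h"
      by (rule transpose_inject[of _ _ "Dom A p"])
        (use v u h(1,2) p unit_natural[of p] F.A.cmp_eq[OF Gv] in \<open>auto simp: G.cmp\<close>)
    then show "\<exists>u. arrD u \<and> Dom D u = Cod D (on_arr F p) \<and> Cod D u = Cod D h \<and> u \<cdot>\<^bsub>D\<^esub> on_arr F p = h"
      using v by blast
  qed (use p in simp_all)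
qed

end

section \<open>The abelian structure induced by a reflector that preserves kernels\<close>

locale exact_reflection = additive_reflection A D F G \<eta> \<epsilon> add zer
  for A :: "('o, 'm) category" and D :: "('p, 'n) category" and F G \<eta> \<epsilon> add zer +
  assumes left_kernel: "is_kernel A k f \<Longrightarrow> is_kernel D (on_arr F k) (on_arr F f)"
begin

text \<open>Up to the counit, \<open>f\<close> is \<open>F (G f)\<close>, and \<open>F\<close>
  carries the kernel of \<open>G f\<close> to a kernel.\<close>

lemma kernel_D:
  assumes "arrD f"
  shows "\<exists>k. is_kernel D k f"
proof -
  obtain k where k: "is_kernel A k (on_arr G f)"
    using A.kernel_exists[of "on_arr G f"] assms by auto
  note ks = A.kernel_simps[OF k]
  have "is_kernel D (\<epsilon> (Dom D f) \<cdot>\<^bsub>D\<^esub> (on_arr F k \<cdot>\<^bsub>D\<^esub> Ident D (on_obj F (Dom A k)))) f"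
    by (rule D.kernel_transport[OF left_kernel[OF k], where c = "\<epsilon> (Cod D f)"])
      (use assms ks counit_natural[of f] in \<open>auto simp: counit_iso F.B.iso_monic\<close>)
  then show ?thesis ..
qed

lemma cokernel_D:
  assumes "arrD f"
  shows "\<exists>p. is_cokernel D p f"
proof -
  obtain p where p: "is_cokernel A p (on_arr G f)"
    using A.cokernel_exists[of "on_arr G f"] assms by auto
  note ps = A.cokernel_simps[OF p]
  have "is_cokernel D (Ident D (on_obj F (Cod A p)) \<cdot>\<^bsub>D\<^esub> (on_arr F p \<cdot>\<^bsub>D\<^esub> counit_inv (Cod D f))) f"
    by (rule D.cokernel_transport[OF left_cokernel[OF p], where c = "counit_inv (Dom D f)"])
      (use assms ps counit_inv_natural[of f] in \<open>auto simp: counit_iso F.B.iso_epic\<close>)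
  then show ?thesis ..
qed

text \<open>\<open>G f\<close> is monic, hence the kernel of its cokernel in \<open>A\<close>;
  applying \<open>F\<close> and correcting by the counit presents \<open>f\<close> itself as a
  kernel.\<close>

lemma monic_D_kernel:
  assumes "monic D f"
  shows "\<exists>g. is_kernel D f g"
proof -
  have f: "arrD f"
    using assms by simp
  obtain c where c: "is_cokernel A c (on_arr G f)"
    using A.cokernel_exists[of "on_arr G f"] f by auto
  have k: "is_kernel A (on_arr G f) c"
    by (rule A.monic_kernel_of_cokernel[OF right_monic[OF assms] c])
  note ks = A.kernel_simps[OF k]
  let ?s = "counit_inv (Cod D f)" and ?t = "counit_inv (Dom D f)"
  have "is_kernel D (\<epsilon> (Cod D f) \<cdot>\<^bsub>D\<^esub> (on_arr F (on_arr G f) \<cdot>\<^bsub>D\<^esub> ?t)) (on_arr F c \<cdot>\<^bsub>D\<^esub> ?s)"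
    by (rule D.kernel_transport[OF left_kernel[OF k], where c = "Ident D (on_obj F (Cod A c))"])
      (use f ks in \<open>auto simp: counit_iso F.B.monic_ide\<close>)
  moreover have "\<epsilon> (Cod D f) \<cdot>\<^bsub>D\<^esub> (on_arr F (on_arr G f) \<cdot>\<^bsub>D\<^esub> ?t) = f"
    using f F.B.cmp_eq[OF counit_natural[OF f, symmetric]] by simp
  ultimately show ?thesis
    by metis
qed

text \<open>A right adjoint may fail to preserve epics, so \<open>G f\<close> is first factored as
  \<open>m \<cdot> e\<close>. Epicness of \<open>f\<close> makes \<open>F m\<close> epic; as
  \<open>F m\<close> is the kernel of \<open>F c\<close>, this forces \<open>F c = 0\<close> and
  makes \<open>F m\<close> invertible. So \<open>f\<close> agrees with the cokernel
  \<open>F e\<close> up to isomorphisms.\<close>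

lemma epic_D_cokernel:
  assumes "epic D f"
  shows "\<exists>g. is_cokernel D f g"
proof -
  have f: "arrD f"
    using assms by simp
  obtain k e m where i: "is_kernel A k (on_arr G f)" "is_cokernel A e k" "epic A e" "monic A m"
    "Dom A e = Dom A (on_arr G f)" "Cod A e = Dom A m" "Cod A m = Cod A (on_arr G f)"
    "m \<cdot>\<^bsub>A\<^esub> e = on_arr G f"
    using A.image_factorization[of "on_arr G f"] f by auto
  have ar: "m \<in> Arr A" "e \<in> Arr A" "k \<in> Arr A" "Cod A k = Dom A e"
    using i A.cokernel_simps[OF i(2)] by auto
  obtain c where c: "is_cokernel A c m"
    using A.cokernel_exists ar by auto
  have kc: "is_kernel A m c"
    by (rule A.monic_kernel_of_cokernel[OF i(4) c])
  note cs = A.kernel_simps[OF kc]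
  have kFc: "is_kernel D (on_arr F m) (on_arr F c)"
    by (rule left_kernel[OF kc])
  note kFcs = D.kernel_simps[OF kFc]
  have fe: "\<epsilon> (Cod D f) \<cdot>\<^bsub>D\<^esub> (on_arr F m \<cdot>\<^bsub>D\<^esub> on_arr F e) = f \<cdot>\<^bsub>D\<^esub> \<epsilon> (Dom D f)"
    using counit_natural[OF f] F.cmp[of e m] ar i by simp
  have "epic D (f \<cdot>\<^bsub>D\<^esub> \<epsilon> (Dom D f))"
    using assms f by (intro F.B.epic_cmp) (auto simp: counit_iso F.B.iso_epic)
  let ?s = "counit_inv (Cod D f)" and ?t = "counit_inv (Dom D f)"
  have sfe: "?s \<cdot>\<^bsub>D\<^esub> (f \<cdot>\<^bsub>D\<^esub> \<epsilon> (Dom D f)) = on_arr F m \<cdot>\<^bsub>D\<^esub> on_arr F e"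
    using fe[symmetric] f i ar by (simp add: F.B.cmp_eq[OF counit_inv_simps(5)])
  have "epic D (?s \<cdot>\<^bsub>D\<^esub> (f \<cdot>\<^bsub>D\<^esub> \<epsilon> (Dom D f)))"
    by (rule F.B.epic_cmp[OF \<open>epic D (f \<cdot>\<^bsub>D\<^esub> _)\<close> F.B.iso_epic[OF counit_iso(2)]]) (use f in simp_all)
  then have "epic D (on_arr F m)"
    unfolding sfe by (rule F.B.epic_of_cmp) (use ar i in auto)
  then have "on_arr F c = zerD (Dom D (on_arr F c)) (Cod D (on_arr F c))"
    using D.epic_zerD[of "on_arr F m" "on_arr F c"] kFcs by simp
  then have "iso_arr D (on_arr F m)"
    by (rule D.kernel_of_zer_iso[OF kFc])
  then have im: "iso_arr D (\<epsilon> (Cod D f) \<cdot>\<^bsub>D\<^esub> on_arr F m)"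
    using f ar i by (intro F.B.iso_cmp) (auto simp: counit_iso)
  have "is_cokernel D ((\<epsilon> (Cod D f) \<cdot>\<^bsub>D\<^esub> on_arr F m) \<cdot>\<^bsub>D\<^esub> (on_arr F e \<cdot>\<^bsub>D\<^esub> ?t)) (\<epsilon> (Dom D f) \<cdot>\<^bsub>D\<^esub> on_arr F k)"
    by (rule D.cokernel_transport[OF left_cokernel[OF i(2)] counit_iso(2) _ im, where c = "Ident D (on_obj F (Dom A k))"])
      (use f ar i in \<open>auto simp: F.B.epic_ide F.B.cmp_eq[OF counit_inv_simps(5)]\<close>)
  moreover have "(\<epsilon> (Cod D f) \<cdot>\<^bsub>D\<^esub> on_arr F m) \<cdot>\<^bsub>D\<^esub> (on_arr F e \<cdot>\<^bsub>D\<^esub> ?t) = (f \<cdot>\<^bsub>D\<^esub> \<epsilon> (Dom D f)) \<cdot>\<^bsub>D\<^esub> ?t"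
    unfolding fe[symmetric] using f ar i by simp
  moreover have "(f \<cdot>\<^bsub>D\<^esub> \<epsilon> (Dom D f)) \<cdot>\<^bsub>D\<^esub> ?t = f"
    using f by simp
  ultimately show ?thesis
    by metis
qed

lemma abelian_D: "abelian D"
  unfolding abelian_def
  using F.B.is_category additive_on_D zero_obj_D product_D kernel_D cokernel_D
    monic_D_kernel epic_D_cokernel
  by (auto simp: preadditive_iff)

lemma exact_F: "exact F"
  unfolding exact_def short_exact_def
  using F.is_functor A.abelian abelian_D left_kernel left_cokernel by simp

end

section \<open>Hereditary torsion theories\<close>

locale torsion_class = abcat C add zer
  for C :: "('o, 'm) category" and add zer +
  fixes tors :: "'o set"
begin

definition tfree :: "'o \<Rightarrow> bool" where
  "tfree F \<longleftrightarrow> obj F \<and> (\<forall>f. arr f \<longrightarrow> dom f \<in> tors \<longrightarrow> cod f = F \<longrightarrow> f = zer (dom f) F)"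

text \<open>A morphism is dense if its cokernel is torsion; testing against torsion-free targets makes the
  closure properties immediate.\<close>

definition dense :: "'m \<Rightarrow> bool" where
  "dense s \<longleftrightarrow> arr s \<and> (\<forall>t. arr t \<longrightarrow> dom t = cod s \<longrightarrow> tfree (cod t) \<longrightarrow>
     t \<cdot> s = zer (dom s) (cod t) \<longrightarrow> t = zer (cod s) (cod t))"

text \<open>These arrows become invertible in the quotient. All monics killed by \<open>f\<close>
  are tested instead of a chosen kernel, which keeps the condition free of choices.\<close>

definition torsion_iso :: "'m \<Rightarrow> bool" where
  "torsion_iso f \<longleftrightarrow> dense f \<and> (\<forall>t. monic C t \<longrightarrow> cod t = dom f \<longrightarrow> f \<cdot> t = zer (dom t) (cod f) \<longrightarrow> dom t \<in> tors)"

definition torsion_injective :: "'o \<Rightarrow> bool" where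
  "torsion_injective N \<longleftrightarrow> obj N \<and> (\<forall>m g. monic C m \<longrightarrow> dense m \<longrightarrow> arr g \<longrightarrow> dom g = dom m \<longrightarrow> cod g = N \<longrightarrow>
     (\<exists>h. arr h \<and> dom h = cod m \<and> cod h = N \<and> h \<cdot> m = g))"

text \<open>These are the closed objects of Gabriel localization: arrows into them extend uniquely
  along every \<open>torsion_iso\<close>, existence coming from torsion-injectivity and uniqueness
  from torsion-freeness.\<close>

definition closed :: "'o \<Rightarrow> bool" where
  "closed N \<longleftrightarrow> tfree N \<and> torsion_injective N"

lemma tfree_obj [simp]: "tfree F \<Longrightarrow> obj F"
  by (simp add: tfree_def)

lemma tfree_zer: "\<lbrakk>tfree (cod f); arr f; dom f \<in> tors\<rbrakk> \<Longrightarrow> f = zer (dom f) (cod f)"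
  unfolding tfree_def by blast

lemma closed_tfree [simp]: "closed N \<Longrightarrow> tfree N"
  by (simp add: closed_def)

lemma dense_arr [simp]: "dense s \<Longrightarrow> arr s"
  by (simp add: dense_def)

lemma dense_zerD:
  "\<lbrakk>dense s; t \<cdot> s = zer (dom s) (cod t); arr t; dom t = cod s; tfree (cod t)\<rbrakk> \<Longrightarrow> t = zer (cod s) (cod t)"
  unfolding dense_def by blast

text \<open>Towards torsion-free targets a dense arrow acts as an epic; the difference of the two
  arrows is what density sends to zero.\<close>

lemma dense_cancel:
  assumes "dense s" "t \<cdot> s = t' \<cdot> s" "arr t" "arr t'" "dom t = cod s" "dom t' = cod s"
    "cod t = cod t'" "tfree (cod t')"
  shows "t = t'"
proof -
  have "diff t t' \<cdot> s = zer (dom s) (cod t')"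
    using assms diff_self[of "t' \<cdot> s"] by (simp add: diff_cmp)
  then have "diff t t' = zer (dom t) (cod t)"
    using dense_zerD[OF assms(1), of "diff t t'"] assms(1,3-) by simp
  then show ?thesis
    by (rule diff_eq_zer[rotated 4]) (use assms in auto)
qed

lemma denseI:
  assumes "arr s" "\<And>t. \<lbrakk>arr t; dom t = cod s; tfree (cod t); t \<cdot> s = zer (dom s) (cod t)\<rbrakk> \<Longrightarrow> t = zer (cod s) (cod t)"
  shows "dense s"
  using assms unfolding dense_def by blast

lemma epic_dense: "epic C e \<Longrightarrow> dense e"
  by (rule denseI) (auto intro: epic_zerD)

lemma dense_cmp:
  assumes "dense f" "dense g" "cod f = dom g"
  shows "dense (g \<cdot> f)"
proof (rule denseI)
  fix t assume t: "arr t" "dom t = cod (g \<cdot> f)" "tfree (cod t)" "t \<cdot> (g \<cdot> f) = zer (dom (g \<cdot> f)) (cod t)"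
  then have "t \<cdot> g = zer (dom g) (cod t)"
    using dense_zerD[OF assms(1), of "t \<cdot> g"] assms by simp
  then show "t = zer (cod (g \<cdot> f)) (cod t)"
    using dense_zerD[OF assms(2), of t] t assms by simp
qed (use assms in simp)

lemma dense_of_cmp:
  assumes "dense (g \<cdot> f)" "arr f" "arr g" "cod f = dom g"
  shows "dense g"
proof (rule denseI)
  fix t assume t: "arr t" "dom t = cod g" "tfree (cod t)" "t \<cdot> g = zer (dom g) (cod t)"
  then have "t \<cdot> (g \<cdot> f) = zer (dom (g \<cdot> f)) (cod t)"
    using assms(2-) cmp_eq[OF t(4)] by simp
  then show "t = zer (cod g) (cod t)"
    using dense_zerD[OF assms(1), of t] t assms(2-) by simp
qed (use assms in simp)

end

section \<open>Closed objects of a hereditary torsion theory\<close>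

locale torsion_theory = torsion_class C add zer tors
  for C :: "('o, 'm) category" and add zer tors +
  assumes tors_obj: "tors \<subseteq> Obj C"
    and tors_sub: "monic C m \<Longrightarrow> cod m \<in> tors \<Longrightarrow> dom m \<in> tors"
    and tors_quotient: "epic C e \<Longrightarrow> dom e \<in> tors \<Longrightarrow> cod e \<in> tors"
    and torsion_part: "obj M \<Longrightarrow> \<exists>t p. short_exact C t p \<and> cod t = M \<and> dom t \<in> tors \<and> tfree (cod p)"
begin

text \<open>An arrow that vanishes on \<open>ker w\<close> factors through the image of
  \<open>w\<close>. That image is a subobject of a torsion object, hence torsion, and has no nonzero
  arrow to a torsion-free object.\<close>

lemma dense_kernel:
  assumes "is_kernel C j w" "cod w \<in> tors"
  shows "dense j"
proof (rule denseI)
  note j = kernel_simps[OF assms(1)]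
  obtain k e m where i: "is_kernel C k w" "is_cokernel C e k" "epic C e" "monic C m"
    "dom e = dom w" "cod e = dom m" "cod m = cod w" "m \<cdot> e = w"
    using image_factorization[OF j(2)] .
  note k = kernel_simps[OF i(1)]
  obtain u where u: "arr u" "dom u = dom k" "cod u = dom j" "j \<cdot> u = k"
    using kernel_factor[OF assms(1) k(1,3,4)] .
  fix t assume t: "arr t" "dom t = cod j" "tfree (cod t)" "t \<cdot> j = zer (dom j) (cod t)"
  have "t \<cdot> k = t \<cdot> (j \<cdot> u)"
    unfolding u(4) ..
  also have "\<dots> = zer (dom k) (cod t)"
    using u(1-3) t j cmp_eq[OF t(4)] by simp
  finally obtain v where v: "arr v" "dom v = cod e" "cod v = cod t" "v \<cdot> e = t"
    using cokernel_factor[OF i(2) t(1)] t j k by auto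
  have "dom m \<in> tors"
    using tors_sub[OF i(4)] i(7) assms(2) by simp
  then have "v = zer (dom v) (cod v)"
    using tfree_zer[of v] v t i by simp
  then have "v \<cdot> e = zer (dom e) (cod t)"
    using zer_cmp[of e "cod t" "dom v"] v t i by (metis epic_arr obj_dom_cod(2))
  then show "t = zer (cod j) (cod t)"
    using v t j i by simp
qed (use kernel_simps[OF assms(1)] in simp)

text \<open>The tested form of density does give a torsion cokernel: the torsion-free quotient of
  the cokernel receives an arrow that vanishes on \<open>s\<close>, so it is zero and the torsion
  part is everything.\<close>

lemma dense_cokernel_tors:
  assumes "dense s" "is_cokernel C q s"
  shows "cod q \<in> tors"
proof -
  note q = cokernel_simps[OF assms(2)]
  obtain t p where tp: "short_exact C t p" "cod t = cod q" "dom t \<in> tors" "tfree (cod p)"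
    using torsion_part[of "cod q"] q by auto
  then have t: "is_kernel C t p"
    by (simp add: short_exact_def)
  note ts = kernel_simps[OF t]
  have "p \<cdot> q = zer (cod s) (cod p)"
    using dense_zerD[OF assms(1), of "p \<cdot> q"] q ts tp by simp
  then have "p = zer (dom p) (cod p)"
    using epic_zerD[OF cokernel_epic[OF assms(2)], of p] q ts tp by simp
  then have "epic C t"
    using kernel_of_zer_iso[OF t] by (simp add: iso_epic)
  then show ?thesis
    using tors_quotient[of t] tp by simp
qed

text \<open>The image of an arrow killed by \<open>q \<cdot> k\<close> embeds both into the torsion
  \<open>dom b\<close> and into the torsion-free \<open>dom k\<close>, so it is zero.\<close>

lemma tfree_monic_quotient:
  assumes "monic C k" "tfree (dom k)" "is_kernel C b q" "dom b \<in> tors" "cod k = dom q"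
  shows "monic C (q \<cdot> k)"
proof (rule monicI_zer)
  note b = kernel_simps[OF assms(3)]
  have k: "arr k" using assms by simp
  fix x assume x: "arr x" "cod x = dom (q \<cdot> k)" "(q \<cdot> k) \<cdot> x = zer (dom x) (cod (q \<cdot> k))"
  obtain l e m where i: "is_kernel C l x" "is_cokernel C e l" "epic C e" "monic C m"
    "dom e = dom x" "cod e = dom m" "cod m = cod x" "m \<cdot> e = x"
    using image_factorization[OF x(1)] .
  have em: "arr e" "arr m" using i by auto
  have "(q \<cdot> (k \<cdot> m)) \<cdot> e = zer (dom e) (cod q)"
    using x i em k b assms(5) by simp
  then have "q \<cdot> (k \<cdot> m) = zer (dom (k \<cdot> m)) (cod q)"
    using epic_zerD[OF i(3), of "q \<cdot> (k \<cdot> m)"] x i em k b assms(5) by simp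
  then obtain y where y: "arr y" "dom y = dom (k \<cdot> m)" "cod y = dom b" "b \<cdot> y = k \<cdot> m"
    using kernel_factor[OF assms(3), of "k \<cdot> m"] x i em k b assms(5) by auto
  have "monic C (k \<cdot> m)"
    using monic_cmp[OF i(4) assms(1)] x i em k b assms(5) by simp
  then have "monic C y"
    using monic_of_cmp[of b y] y b by simp
  then have "dom m \<in> tors"
    using tors_sub[of y] y assms(4) em x i k b assms(5) by simp
  then have "m = zer (dom m) (cod m)"
    using tfree_zer[of m] em x i k b assms(2,5) by simp
  then have "m \<cdot> e = zer (dom x) (cod x)"
    using zer_cmp[of e "cod m" "dom m"] em i by (metis obj_dom_cod(2))
  then show "x = zer (dom x) (dom (q \<cdot> k))"
    using i x by simp
qed (use assms kernel_simps[OF assms(3)] in simp)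

text \<open>Along the image factorization of \<open>f\<close>: \<open>g\<close> kills the torsion
  kernel because \<open>N\<close> is torsion-free, hence factors through \<open>e\<close>; the
  remaining monic \<open>m\<close> is dense, so torsion-injectivity of \<open>N\<close> extends
  further.\<close>

lemma closed_extend:
  assumes "closed N" "torsion_iso f" "arr g" "dom g = dom f" "cod g = N"
  obtains h where "arr h" "dom h = cod f" "cod h = N" "h \<cdot> f = g"
proof -
  have f: "dense f" "arr f"
    using assms(2) by (auto simp: torsion_iso_def)
  obtain k e m where i: "is_kernel C k f" "is_cokernel C e k" "epic C e" "monic C m"
    "dom e = dom f" "cod e = dom m" "cod m = cod f" "m \<cdot> e = f"
    using image_factorization[OF f(2)] .
  have em: "arr e" "arr m" using i by auto
  note k = kernel_simps[OF i(1)]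
  have "dom k \<in> tors"
    using assms(2) kernel_monic[OF i(1)] k unfolding torsion_iso_def by blast
  then have "g \<cdot> k = zer (dom k) (cod g)"
    using tfree_zer[of "g \<cdot> k"] assms k by simp
  then obtain g' where g': "arr g'" "dom g' = cod e" "cod g' = cod g" "g' \<cdot> e = g"
    using cokernel_factor[OF i(2) assms(3)] assms k by auto
  have "dense m"
    by (rule dense_of_cmp[of m e]) (use i f em in auto)
  then obtain h where h: "arr h" "dom h = cod m" "cod h = N" "h \<cdot> m = g'"
    using assms(1,5) i(4,6) g' unfolding closed_def torsion_injective_def by metis
  have "h \<cdot> (m \<cdot> e) = g"
    using cmp_eq[OF h(4), of e] h em i g' by simp
  then show ?thesis
    using that h i by simp
qed

text \<open>The envelope is \<open>dom n\<close>, the preimage in \<open>E\<close> of the torsion of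
  \<open>cod c\<close>. It is just large enough for \<open>j\<close> to stay dense, and it inherits
  extensions from \<open>E\<close> because \<open>E\<close> modulo \<open>dom n\<close> embeds into
  the torsion-free \<open>cod e\<close>.\<close>

lemma torsion_injective_envelope:
  assumes "injective_obj C E" "monic C i" "cod i = E"
  obtains j where "monic C j" "dense j" "dom j = dom i" "torsion_injective (cod j)"
proof -
  have i: "arr i" using assms by simp
  obtain c where c: "is_cokernel C c i"
    using cokernel_exists[OF i] by blast
  note cs = cokernel_simps[OF c]
  obtain \<tau> e where e: "short_exact C \<tau> e" "cod \<tau> = cod c" "dom \<tau> \<in> tors" "tfree (cod e)"
    using torsion_part[of "cod c"] cs by auto
  then have \<tau>: "is_kernel C \<tau> e"
    by (simp add: short_exact_def)
  note \<tau>s = kernel_simps[OF \<tau>]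
  have ec: "arr (e \<cdot> c)" "dom (e \<cdot> c) = E" "cod (e \<cdot> c) = cod e"
    using cs \<tau>s e assms by auto
  obtain n where n: "is_kernel C n (e \<cdot> c)"
    using kernel_exists[OF ec(1)] by blast
  note ns = kernel_simps[OF n]
  have dce: "dom e = cod c" using \<tau>s e by simp
  have "(e \<cdot> c) \<cdot> i = zer (dom i) (cod (e \<cdot> c))"
    using cs \<tau>s e assms by simp
  then obtain j where j: "arr j" "dom j = dom i" "cod j = dom n" "n \<cdot> j = i"
    using kernel_factor[OF n i] ec assms by auto
  have jm: "monic C j"
    using monic_of_cmp[of n j] j ns assms by simp
  have "e \<cdot> (c \<cdot> n) = zer (dom (c \<cdot> n)) (cod e)"
    using ns ec cs \<tau>s e assms by simp
  then obtain w where w: "arr w" "dom w = dom (c \<cdot> n)" "cod w = dom \<tau>" "\<tau> \<cdot> w = c \<cdot> n"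
    using kernel_factor[OF \<tau>, of "c \<cdot> n"] ns ec cs \<tau>s e assms by auto
  have ncd: "cod n = cod i" "dom c = cod i" using ns ec assms cs by auto
  have ki: "is_kernel C i c"
    by (rule monic_kernel_of_cokernel[OF assms(2) c])
  \<comment> \<open>\<open>w\<close> sends the envelope to the torsion of \<open>cod c\<close>;
    exhibiting \<open>j\<close> as its kernel makes \<open>j\<close> dense.\<close>
  have "is_kernel C j w"
  proof (rule kernelI[OF jm w(1)])
    have "\<tau> \<cdot> (w \<cdot> j) = c \<cdot> i"
      using cmp_eq[OF w(4), of j] w(1-3) j ns(1) cs(1) ncd \<tau>s(1) by simp
    then have "\<tau> \<cdot> (w \<cdot> j) = zer (dom (w \<cdot> j)) (cod \<tau>)"
      using cs(1,4) w(1-3) j(1-3) ns(1) ncd e(2) by simp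
    then show "w \<cdot> j = zer (dom j) (cod w)"
      using monic_zerD[OF kernel_monic[OF \<tau>], of "w \<cdot> j"] w(1-3) j(1-3) ns(1) cs(1) ncd \<tau>s(1) by simp
    fix h assume h: "arr h" "cod h = dom w" "w \<cdot> h = zer (dom h) (cod w)"
    have "c \<cdot> (n \<cdot> h) = \<tau> \<cdot> (w \<cdot> h)"
      using cmp_eq[OF w(4), of h] w(1-3) h(1,2) ns(1) cs(1) ncd \<tau>s(1) by simp
    also have "\<dots> = zer (dom h) (cod c)"
      unfolding h(3) using w(1-3) h(1,2) e \<tau>s by simp
    finally obtain u where u: "arr u" "dom u = dom h" "cod u = dom i" "i \<cdot> u = n \<cdot> h"
      using kernel_factor[OF ki, of "n \<cdot> h"] w(1-3) h(1,2) ns cs ncd by auto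
    have "n \<cdot> (j \<cdot> u) = n \<cdot> h"
      using cmp_eq[OF j(4), of u] j u ns by simp
    then have "j \<cdot> u = h"
      by (rule monic_cancel[OF kernel_monic[OF n]]) (use j u h w(1-3) ns cs ncd in auto)
    then show "\<exists>u. arr u \<and> dom u = dom h \<and> cod u = dom j \<and> j \<cdot> u = h"
      using u j by auto
  qed (use w j ns cs ncd in simp)
  then have jd: "dense j"
    by (rule dense_kernel) (use w e in simp)
  have "torsion_injective (cod j)"
    unfolding torsion_injective_def
  proof (intro conjI allI impI)
    fix m g assume m: "monic C m" "dense m" "arr g" "dom g = dom m" "cod g = cod j"
    have "n \<cdot> g \<in> Hom C (dom m) E"
      using m j ns ec by (simp add: Hom_iff)
    then obtain h where h: "arr h" "dom h = cod m" "cod h = E" "h \<cdot> m = n \<cdot> g"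
      using assms(1) m(1) unfolding injective_obj_def Bex_def Hom_iff by blast
    \<comment> \<open>The extension \<open>h\<close> into \<open>E\<close> lands in
      \<open>dom n\<close>: \<open>(e \<cdot> c) \<cdot> h\<close> vanishes on the dense
      \<open>m\<close> and its target is torsion-free.\<close>
    have "((e \<cdot> c) \<cdot> h) \<cdot> m = (e \<cdot> c) \<cdot> (n \<cdot> g)"
      using h m(1) ec by simp
    also have "\<dots> = zer (dom m) (cod e)"
      using cmp_eq[OF ns(4), of g] m j ns ec \<tau>s(2) by simp
    finally have "(e \<cdot> c) \<cdot> h = zer (dom h) (cod (e \<cdot> c))"
      using dense_zerD[OF m(2), of "(e \<cdot> c) \<cdot> h"] h m(1) ec e by simp
    then obtain h' where h': "arr h'" "dom h' = dom h" "cod h' = dom n" "n \<cdot> h' = h"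
      using kernel_factor[OF n h(1)] h ec by auto
    have "n \<cdot> (h' \<cdot> m) = n \<cdot> g"
      using cmp_eq[OF h'(4), of m] h h' ns m(1) by simp
    then have "h' \<cdot> m = g"
      by (rule monic_cancel[OF kernel_monic[OF n]]) (use h h' ns m j in auto)
    then show "\<exists>h. arr h \<and> dom h = cod m \<and> cod h = cod j \<and> h \<cdot> m = g"
      using h h' j by auto
  qed (use j ns in simp)
  then show ?thesis
    using that jm jd j by blast
qed

text \<open>For torsion-free \<open>M'\<close> with a dense monomorphism \<open>j\<close> into a torsion-injective \<open>N\<close>, put \<open>q : N \<rightarrow> Q = N/TN\<close>.
  Then \<open>q j\<close> is a dense monomorphism, so \<open>j\<close> extends along it to \<open>r : Q \<rightarrow> N\<close>, and density forces
  \<open>q r = 1\<close>. Hence \<open>Q\<close> is a retract of \<open>N\<close>, and is closed.\<close>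

lemma closed_reflection:
  assumes "enough_injectives C" "obj M"
  obtains f where "dom f = M" "closed (cod f)" "torsion_iso f"
proof -
  obtain t p where tp: "short_exact C t p" "cod t = M" "dom t \<in> tors" "tfree (cod p)"
    using torsion_part[OF assms(2)] by blast
  then have t: "is_kernel C t p" and "is_cokernel C p t"
    by (auto simp: short_exact_def)
  then have pe: "epic C p"
    by (simp add: cokernel_epic)
  note ts = kernel_simps[OF t]
  obtain E i where i: "injective_obj C E" "arr i" "dom i = cod p" "cod i = E" "monic C i"
    using assms(1) obj_dom_cod(2)[OF ts(2)] unfolding enough_injectives_def Hom_iff by blast
  obtain j where j: "monic C j" "dense j" "dom j = cod p" "torsion_injective (cod j)"
    using torsion_injective_envelope[OF i(1,5,4)] i(3) by metis
  obtain b q where bq: "short_exact C b q" "cod b = cod j" "dom b \<in> tors" "tfree (cod q)"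
    using torsion_part[of "cod j"] j by auto
  then have b: "is_kernel C b q" and "is_cokernel C q b"
    by (auto simp: short_exact_def)
  then have qe: "epic C q"
    by (simp add: cokernel_epic)
  note bs = kernel_simps[OF b]
  have ar: "arr j" "arr q" "dom q = cod j" "arr p" "dom p = M"
    using j bs bq ts tp by auto
  have zm: "monic C (q \<cdot> j)"
    by (rule tfree_monic_quotient[OF j(1) _ b bq(3)]) (use j tp ar in auto)
  have zd: "dense (q \<cdot> j)"
    using dense_cmp[OF j(2) epic_dense[OF qe]] ar by simp
  obtain r where r: "arr r" "dom r = cod (q \<cdot> j)" "cod r = cod j" "r \<cdot> (q \<cdot> j) = j"
    using j(4) zm zd ar unfolding torsion_injective_def by (metis cmp_simps(2))
  have "(q \<cdot> r) \<cdot> (q \<cdot> j) = ide (cod q) \<cdot> (q \<cdot> j)"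
    using r ar by simp
  then have qr: "q \<cdot> r = ide (cod q)"
    by (rule dense_cancel[OF zd]) (use r ar bq in auto)
  have "torsion_injective (cod q)"
    unfolding torsion_injective_def
  proof (intro conjI allI impI)
    fix m g assume m: "monic C m" "dense m" "arr g" "dom g = dom m" "cod g = cod q"
    \<comment> \<open>The extension problem is moved to the envelope by \<open>r\<close>, solved
      there, and brought back by \<open>q\<close>.\<close>
    have "arr (r \<cdot> g)" "dom (r \<cdot> g) = dom m" "cod (r \<cdot> g) = cod j"
      using m r ar by simp_all
    then obtain h where h: "arr h" "dom h = cod m" "cod h = cod j" "h \<cdot> m = r \<cdot> g"
      using j(4) m(1,2) unfolding torsion_injective_def by blast
    have "(q \<cdot> h) \<cdot> m = q \<cdot> (r \<cdot> g)"
      using h m(1) ar by simp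
    also have "\<dots> = g"
      using cmp_eq[OF qr, of g] m r ar by simp
    finally show "\<exists>h. arr h \<and> dom h = cod m \<and> cod h = cod q \<and> h \<cdot> m = g"
      using h ar by (intro exI[of _ "q \<cdot> h"]) auto
  qed (use ar in simp)
  then have cl: "closed (cod ((q \<cdot> j) \<cdot> p))"
    using bq ar j by (simp add: closed_def)
  have "torsion_iso ((q \<cdot> j) \<cdot> p)"
    unfolding torsion_iso_def
  proof (intro conjI allI impI)
    show "dense ((q \<cdot> j) \<cdot> p)"
      using dense_cmp[OF epic_dense[OF pe] zd] ar j by simp
    \<comment> \<open>Since \<open>q \<cdot> j\<close> is monic, an arrow killed by the composite is
      already killed by \<open>p\<close>, hence factors through the torsion part
      \<open>t\<close>.\<close>
    fix x assume x: "monic C x" "cod x = dom ((q \<cdot> j) \<cdot> p)" "((q \<cdot> j) \<cdot> p) \<cdot> x = zer (dom x) (cod ((q \<cdot> j) \<cdot> p))"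
    then have "(q \<cdot> j) \<cdot> (p \<cdot> x) = zer (dom (p \<cdot> x)) (cod (q \<cdot> j))"
      using ar j by simp
    then have "p \<cdot> x = zer (dom x) (cod p)"
      using monic_zerD[OF zm, of "p \<cdot> x"] ar j x(1,2) by simp
    then obtain u where u: "arr u" "dom u = dom x" "cod u = dom t" "t \<cdot> u = x"
      using kernel_factor[OF t, of x] ar j x(1,2) by auto
    have "monic C u"
      using monic_of_cmp[of t u] u ts x by simp
    then show "dom x \<in> tors"
      using tors_sub[of u] u tp by simp
  qed
  then show ?thesis
    using that[of "(q \<cdot> j) \<cdot> p"] cl ar j by simp
qed

text \<open>This replaces the choice of a preimage: \<open>w\<close> factors through
  \<open>f\<close> after a dense restriction. The restriction has two stages, the preimage under
  \<open>w\<close> of the image of \<open>f\<close>, and then an epic pullback. The last clause says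
  that \<open>x\<close> and \<open>s\<close> are jointly monic.\<close>

lemma dense_pullback:
  assumes "dense f" "arr w" "cod w = cod f"
  obtains x s where "arr x" "dense s" "dom x = dom s" "cod x = dom f" "cod s = dom w" "f \<cdot> x = w \<cdot> s"
    "\<And>t. \<lbrakk>arr t; cod t = dom s; x \<cdot> t = zer (dom t) (dom f); s \<cdot> t = zer (dom t) (dom w)\<rbrakk>
      \<Longrightarrow> t = zer (dom t) (dom s)"
proof -
  have f: "arr f" using assms by simp
  obtain l e m where i: "is_kernel C l f" "is_cokernel C e l" "epic C e" "monic C m"
    "dom e = dom f" "cod e = dom m" "cod m = cod f" "m \<cdot> e = f"
    using image_factorization[OF f] .
  have em: "arr e" "arr m" using i by auto
  obtain q where q: "is_cokernel C q m"
    using cokernel_exists[OF em(2)] by blast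
  note qs = cokernel_simps[OF q]
  have md: "dense m"
    by (rule dense_of_cmp[of m e]) (use i assms em in auto)
  have qt: "cod q \<in> tors"
    by (rule dense_cokernel_tors[OF md q])
  have mk: "is_kernel C m q"
    by (rule monic_kernel_of_cokernel[OF i(4) q])
  \<comment> \<open>\<open>n\<close> is the preimage under \<open>w\<close> of the image
    \<open>m\<close> of \<open>f\<close>; it is dense because the cokernel of \<open>m\<close> is
    torsion.\<close>
  obtain n where n: "is_kernel C n (q \<cdot> w)"
    using kernel_exists[of "q \<cdot> w"] qs assms i by auto
  note ns = kernel_simps[OF n]
  have ncd: "cod n = dom w"
    using ns qs assms i by simp
  have nd: "dense n"
    by (rule dense_kernel[OF n]) (use qs assms i qt in simp)
  have "q \<cdot> (w \<cdot> n) = zer (dom (w \<cdot> n)) (cod q)"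
    using ns(4) ns(1) ncd qs assms i by simp
  then obtain g where g: "arr g" "dom g = dom (w \<cdot> n)" "cod g = dom m" "m \<cdot> g = w \<cdot> n"
    using kernel_factor[OF mk, of "w \<cdot> n"] ns(1) ncd qs assms i by auto
  have gn: "dom g = dom n"
    using g ns(1) ncd assms by simp
  obtain x s where s: "arr x" "epic C s" "dom x = dom s" "cod x = dom e" "cod s = dom g"
    "e \<cdot> x = g \<cdot> s"
    "\<And>t. \<lbrakk>arr t; cod t = dom s; x \<cdot> t = zer (dom t) (dom e); s \<cdot> t = zer (dom t) (dom g)\<rbrakk>
      \<Longrightarrow> t = zer (dom t) (dom s)"
    using epic_pullback[OF i(3) g(1)] g(3) i(6) by metis
  have ss: "arr s" using s by simp
  show ?thesis
  proof (rule that[of x "n \<cdot> s"])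
    show "dense (n \<cdot> s)"
      using dense_cmp[OF epic_dense[OF s(2)] nd] s gn by simp
    have "f \<cdot> x = m \<cdot> (e \<cdot> x)"
      using cmp_eq[OF i(8), of x] s em i by simp
    also have "\<dots> = w \<cdot> (n \<cdot> s)"
      unfolding s(6) using cmp_eq[OF g(4), of s] g(1,3) gn em ss s(5) ns(1) ncd assms by simp
    finally show "f \<cdot> x = w \<cdot> (n \<cdot> s)" .
    fix t assume t: "arr t" "cod t = dom (n \<cdot> s)" "x \<cdot> t = zer (dom t) (dom f)"
      "(n \<cdot> s) \<cdot> t = zer (dom t) (dom w)"
    have "s \<cdot> t = zer (dom t) (dom n)"
      using monic_zerD[OF kernel_monic[OF n], of "s \<cdot> t"] t ss s(5) gn ns(1) ncd by simp
    then show "t = zer (dom t) (dom (n \<cdot> s))"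
      using s(7)[of t] t ss s(5) gn ns(1) i by simp
  qed (use s ss gn ns ncd i in auto)
qed

end

subsection \<open>The localization functor\<close>

locale localization = torsion_theory C add zer tors
  for C :: "('o, 'm) category" and add zer tors +
  assumes enough_inj: "enough_injectives C"
begin

definition loc_unit :: "'o \<Rightarrow> 'm" where
  "loc_unit M = (SOME f. dom f = M \<and> closed (cod f) \<and> torsion_iso f)"

abbreviation loc :: "'o \<Rightarrow> 'o" where "loc M \<equiv> cod (loc_unit M)"

definition loc_arr :: "'m \<Rightarrow> 'm" where
  "loc_arr f = (SOME h. arr h \<and> dom h = loc (dom f) \<and> cod h = loc (cod f) \<and>
     h \<cdot> loc_unit (dom f) = loc_unit (cod f) \<cdot> f)"

lemma loc_unit_simps [simp]:
  assumes "obj M"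
  shows "dom (loc_unit M) = M" "closed (loc M)" "torsion_iso (loc_unit M)" "arr (loc_unit M)" "dense (loc_unit M)"
proof -
  have "\<exists>f. dom f = M \<and> closed (cod f) \<and> torsion_iso f"
    using closed_reflection[OF enough_inj assms] by metis
  then have r: "dom (loc_unit M) = M \<and> closed (loc M) \<and> torsion_iso (loc_unit M)"
    unfolding loc_unit_def by (rule someI_ex)
  then show "dom (loc_unit M) = M" "closed (loc M)" "torsion_iso (loc_unit M)"
    by simp_all
  from r show "arr (loc_unit M)" "dense (loc_unit M)"
    by (simp_all add: torsion_iso_def)
qed

lemma loc_arr_simps [simp]:
  assumes "arr f"
  shows "arr (loc_arr f)" "dom (loc_arr f) = loc (dom f)" "cod (loc_arr f) = loc (cod f)"
    "loc_arr f \<cdot> loc_unit (dom f) = loc_unit (cod f) \<cdot> f"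
proof -
  have "\<exists>h. arr h \<and> dom h = loc (dom f) \<and> cod h = loc (cod f) \<and> h \<cdot> loc_unit (dom f) = loc_unit (cod f) \<cdot> f"
    using closed_extend[of "loc (cod f)" "loc_unit (dom f)" "loc_unit (cod f) \<cdot> f"] assms by auto
  then have "arr (loc_arr f) \<and> dom (loc_arr f) = loc (dom f) \<and> cod (loc_arr f) = loc (cod f) \<and>
      loc_arr f \<cdot> loc_unit (dom f) = loc_unit (cod f) \<cdot> f"
    unfolding loc_arr_def by (rule someI_ex)
  then show "arr (loc_arr f)" "dom (loc_arr f) = loc (dom f)"
    "cod (loc_arr f) = loc (cod f)" "loc_arr f \<cdot> loc_unit (dom f) = loc_unit (cod f) \<cdot> f"
    by simp_all
qed

lemma loc_unit_cancel:
  assumes "h \<cdot> loc_unit M = h' \<cdot> loc_unit M" "obj M" "arr h" "arr h'" "dom h = loc M" "dom h' = loc M"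
    "cod h = cod h'" "closed (cod h')"
  shows "h = h'"
  by (rule dense_cancel[of "loc_unit M"]) (use assms in auto)

text \<open>Uniqueness of extensions to closed objects reduces functoriality of the localization to
  equations after the unit.\<close>

lemma loc_arr_eqI:
  assumes "arr f" "arr h" "dom h = loc (dom f)" "cod h = loc (cod f)"
    "h \<cdot> loc_unit (dom f) = loc_unit (cod f) \<cdot> f"
  shows "loc_arr f = h"
  by (rule loc_unit_cancel[of _ "dom f"]) (use assms in auto)

lemma loc_arr_ide: "obj X \<Longrightarrow> loc_arr (ide X) = ide (loc X)"
  by (rule loc_arr_eqI) auto

lemma loc_arr_cmp:
  assumes "arr f" "arr g" "cod f = dom g"
  shows "loc_arr (g \<cdot> f) = loc_arr g \<cdot> loc_arr f"
  by (rule loc_arr_eqI)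
    (use assms cmp_eq[OF loc_arr_simps(4)[of g], of f] in auto)

lemma loc_unit_kernel:
  assumes "loc_unit M \<cdot> y = zer (dom y) (loc M)" "arr y" "cod y = M"
  obtains z \<tau> where "arr z" "monic C \<tau>" "dom z = dom y" "cod z = dom \<tau>" "cod \<tau> = M" "\<tau> \<cdot> z = y"
    "dom \<tau> \<in> tors"
proof -
  have M: "obj M" using assms by auto
  obtain \<tau> where \<tau>: "is_kernel C \<tau> (loc_unit M)"
    using kernel_exists[of "loc_unit M"] M by auto
  note ts = kernel_simps[OF \<tau>]
  obtain z where z: "arr z" "dom z = dom y" "cod z = dom \<tau>" "\<tau> \<cdot> z = y"
    using kernel_factor[OF \<tau>, of y] assms M by auto
  have "dom \<tau> \<in> tors"
    using loc_unit_simps(3)[OF M] kernel_monic[OF \<tau>] ts unfolding torsion_iso_def by blast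
  then show ?thesis
    using that[OF z(1) kernel_monic[OF \<tau>] z(2,3)] z ts M by simp
qed

text \<open>Restricting to the kernel of a morphism with torsion target is harmless, because it is dense.\<close>

lemma loc_unit_kernel_dense:
  assumes "loc_unit M \<cdot> y = zer (dom y) (loc M)" "arr y" "cod y = M"
  obtains i where "monic C i" "dense i" "cod i = dom y" "y \<cdot> i = zer (dom i) M"
proof -
  obtain z \<tau> where z: "arr z" "monic C \<tau>" "dom z = dom y" "cod z = dom \<tau>" "cod \<tau> = M" "\<tau> \<cdot> z = y"
    "dom \<tau> \<in> tors"
    using loc_unit_kernel[OF assms] .
  obtain i where i: "is_kernel C i z"
    using kernel_exists[OF z(1)] by blast
  note ik = kernel_simps[OF i]
  have "\<tau> \<cdot> (z \<cdot> i) = zer (dom i) M"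
    using ik z by simp
  then have "y \<cdot> i = zer (dom i) M"
    using cmp_eq[OF z(6), of i] ik z by simp
  then show ?thesis
    using that[OF kernel_monic[OF i] dense_kernel[OF i]] ik z by simp
qed

text \<open>The usual element chase is carried out with arrows: lift along a unit by
  \<open>dense_pullback\<close>, remove torsion by \<open>loc_unit_kernel_dense\<close>, use the
  kernel \<open>k\<close> in \<open>C\<close>, and return by the properties of closed
  objects.\<close>

lemma loc_kernel:
  assumes "is_kernel C k f"
  shows "is_kernel C (loc_arr k) (loc_arr f)"
proof -
  note ks = kernel_simps[OF assms]
  let ?K = "dom k" and ?X = "dom f" and ?Y = "cod f"
  have ob: "obj ?K" "obj ?X" "obj ?Y"
    using ks by auto
  have nk: "loc_arr k \<cdot> loc_unit ?K = loc_unit ?X \<cdot> k" and nf: "loc_arr f \<cdot> loc_unit ?X = loc_unit ?Y \<cdot> f"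
    using loc_arr_simps(4)[of k] loc_arr_simps(4)[of f] ks by simp_all
  show ?thesis
  proof (rule kernelI)
    show "monic C (loc_arr k)"
    proof (rule monicI_zer)
      fix u assume u: "arr u" "cod u = dom (loc_arr k)" "loc_arr k \<cdot> u = zer (dom u) (cod (loc_arr k))"
      obtain x s where s: "arr x" "dense s" "dom x = dom s" "cod x = ?K" "cod s = dom u" "loc_unit ?K \<cdot> x = u \<cdot> s"
        by (rule dense_pullback[of "loc_unit ?K" u]) (use u ob ks in auto)
      have ss: "arr s" using s by simp
      have "loc_unit ?X \<cdot> (k \<cdot> x) = loc_arr k \<cdot> (loc_unit ?K \<cdot> x)"
        using cmp_eq[OF nk, of x] s(1,4) ob ks by simp
      also have "\<dots> = zer (dom (k \<cdot> x)) (loc ?X)"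
        unfolding s(6) using cmp_eq[OF u(3), of s] u(1,2) s(1,3,4,5) ss ob ks by simp
      \<comment> \<open>The unit kills \<open>k \<cdot> x\<close>, so \<open>k \<cdot> x\<close>
        itself vanishes on a dense subobject, where monicness of \<open>k\<close> applies.\<close>
      finally obtain i where i: "monic C i" "dense i" "cod i = dom (k \<cdot> x)" "(k \<cdot> x) \<cdot> i = zer (dom i) ?X"
        using loc_unit_kernel_dense[of ?X "k \<cdot> x"] s(1,4) ks by auto
      have ia: "arr i" "cod i = dom x"
        using i s(1,4) ks by auto
      have "k \<cdot> (x \<cdot> i) = zer (dom (x \<cdot> i)) (cod k)"
        using i(4) ia s(1,4) ks by simp
      then have xi: "x \<cdot> i = zer (dom i) ?K"
        using monic_zerD[OF kernel_monic[OF assms], of "x \<cdot> i"] ia s(1,4) ks by simp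
      have "u \<cdot> (s \<cdot> i) = loc_unit ?K \<cdot> (x \<cdot> i)"
        using cmp_eq[OF s(6)[symmetric], of i] s(1,3,4,5) ss ia u(1,2) ob ks by simp
      also have "\<dots> = zer (dom (s \<cdot> i)) (cod u)"
        unfolding xi using s(3) ss ia u(1,2) ob ks by simp
      finally show "u = zer (dom u) (dom (loc_arr k))"
        using dense_zerD[OF dense_cmp[OF i(2) s(2)], of u] ia ss s(3,5) u(1,2) ob ks by simp
    qed (use ks in simp)
    have "loc_arr f \<cdot> loc_arr k = loc_arr (zer ?K ?Y)"
      using loc_arr_cmp[of k f] ks by simp
    also have "\<dots> = zer (loc ?K) (loc ?Y)"
      by (rule loc_arr_eqI) (use ob in auto)
    finally show "loc_arr f \<cdot> loc_arr k = zer (dom (loc_arr k)) (cod (loc_arr f))"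
      using ks by simp
    fix w assume w: "arr w" "cod w = dom (loc_arr f)" "loc_arr f \<cdot> w = zer (dom w) (cod (loc_arr f))"
    obtain x s where s: "arr x" "dense s" "dom x = dom s" "cod x = ?X" "cod s = dom w" "loc_unit ?X \<cdot> x = w \<cdot> s"
      "\<And>t. \<lbrakk>arr t; cod t = dom s; x \<cdot> t = zer (dom t) (dom (loc_unit ?X)); s \<cdot> t = zer (dom t) (dom w)\<rbrakk>
        \<Longrightarrow> t = zer (dom t) (dom s)"
      using dense_pullback[of "loc_unit ?X" w] w ob ks by (metis loc_arr_simps(2) loc_unit_simps(1,5))
    have ss: "arr s" using s by simp
    have "loc_unit ?Y \<cdot> (f \<cdot> x) = loc_arr f \<cdot> (loc_unit ?X \<cdot> x)"
      using cmp_eq[OF nf, of x] s(1,4) ob ks by simp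
    also have "\<dots> = zer (dom (f \<cdot> x)) (loc ?Y)"
      unfolding s(6) using cmp_eq[OF w(3), of s] w(1,2) s(1,3,4,5) ss ob ks by simp
    finally obtain i where i: "monic C i" "dense i" "cod i = dom (f \<cdot> x)" "(f \<cdot> x) \<cdot> i = zer (dom i) ?Y"
      using loc_unit_kernel_dense[of ?Y "f \<cdot> x"] s(1,4) ks by auto
    have ia: "arr i" "cod i = dom x"
      using i s(1,4) ks by auto
    have "f \<cdot> (x \<cdot> i) = zer (dom (x \<cdot> i)) ?Y"
      using i(4) ia s(1,4) ks by simp
    then obtain y where y: "arr y" "dom y = dom (x \<cdot> i)" "cod y = ?K" "k \<cdot> y = x \<cdot> i"
      using kernel_factor[OF assms, of "x \<cdot> i"] ia s(1,4) ks by auto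
    have ydom: "dom y = dom i"
      using y ia s(1) by simp
    have si: "arr (s \<cdot> i)" "dom (s \<cdot> i) = dom i" "cod (s \<cdot> i) = dom w"
      using ss ia s(3,5) by auto
    \<comment> \<open>To extend an arrow along \<open>s \<cdot> i\<close> density is not enough; its
      kernel must be torsion too. A subobject \<open>t\<close> killed by \<open>s \<cdot> i\<close>
      embeds through \<open>x\<close> into something that the unit kills, hence is torsion.\<close>
    have "torsion_iso (s \<cdot> i)"
      unfolding torsion_iso_def
    proof (intro conjI allI impI)
      show "dense (s \<cdot> i)"
        using dense_cmp[OF i(2) s(2)] ia s(3) by simp
      fix t assume t: "monic C t" "cod t = dom (s \<cdot> i)" "(s \<cdot> i) \<cdot> t = zer (dom t) (cod (s \<cdot> i))"
      have ta: "arr t" "cod t = dom i"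
        using t si by auto
      have st: "s \<cdot> (i \<cdot> t) = zer (dom t) (dom w)"
        using t(3) ta ia ss s(3,5) by simp
      \<comment> \<open>An arrow killed here is killed both by \<open>x\<close> and by
        \<open>s\<close> after \<open>i \<cdot> t\<close>, and these two are jointly monic.\<close>
      have m: "monic C (x \<cdot> (i \<cdot> t))"
      proof (rule monicI_zer)
        fix v assume v: "arr v" "cod v = dom (x \<cdot> (i \<cdot> t))" "(x \<cdot> (i \<cdot> t)) \<cdot> v = zer (dom v) (cod (x \<cdot> (i \<cdot> t)))"
        have va: "cod v = dom t"
          using v ta ia s(1) by simp
        have "(i \<cdot> t) \<cdot> v = zer (dom v) (dom s)"
          using s(7)[of "(i \<cdot> t) \<cdot> v"] v(1,3) va ta ia s(1,3,4) ss ob cmp_eq[OF st, of v] w(1) by simp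
        then show "v = zer (dom v) (dom (x \<cdot> (i \<cdot> t)))"
          using monic_zerD[OF monic_cmp[OF t(1) i(1) ta(2)], of v] v(1) va ta ia s(1,3) by simp
      qed (use ta ia s(1) in simp)
      have "loc_unit ?X \<cdot> (x \<cdot> (i \<cdot> t)) = w \<cdot> (s \<cdot> (i \<cdot> t))"
        using cmp_eq[OF s(6), of "i \<cdot> t"] ta ia s(1,3,4,5) ss w(1,2) ob ks by simp
      also have "\<dots> = zer (dom (x \<cdot> (i \<cdot> t))) (loc ?X)"
        unfolding st using ta ia s(1) w(1,2) ks by simp
      finally have "dom (x \<cdot> (i \<cdot> t)) \<in> tors"
        using loc_unit_simps(3)[OF ob(2)] m ta ia s(1,4) ob unfolding torsion_iso_def
        by (metis cmp_simps loc_unit_simps(1))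
      then show "dom t \<in> tors"
        using ta ia s(1) by simp
    qed
    then have sd: "dense (s \<cdot> i)"
      by (simp add: torsion_iso_def)
    \<comment> \<open>The factorization \<open>y\<close> exists only on a dense restriction of
      \<open>dom w\<close>; closedness of the target extends it to all of
      \<open>dom w\<close>.\<close>
    obtain u where u: "arr u" "dom u = dom w" "cod u = loc ?K" "u \<cdot> (s \<cdot> i) = loc_unit ?K \<cdot> y"
      using closed_extend[of "loc ?K" "s \<cdot> i" "loc_unit ?K \<cdot> y"] \<open>torsion_iso (s \<cdot> i)\<close> y(1,3) ydom si ob by auto
    have "(loc_arr k \<cdot> u) \<cdot> (s \<cdot> i) = loc_arr k \<cdot> (loc_unit ?K \<cdot> y)"
      using u si ks by simp
    also have "\<dots> = loc_unit ?X \<cdot> (k \<cdot> y)"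
      using cmp_eq[OF nk, of y] y(1,3) ob ks by simp
    also have "\<dots> = w \<cdot> (s \<cdot> i)"
      unfolding y(4) using cmp_eq[OF s(6), of i] ia s(1,3,4,5) ss w(1,2) ob ks by simp
    finally have "loc_arr k \<cdot> u = w"
      by (rule dense_cancel[OF sd]) (use u si w(1,2) ob ks in auto)
    then show "\<exists>u. arr u \<and> dom u = dom w \<and> cod u = dom (loc_arr k) \<and> loc_arr k \<cdot> u = w"
      using u ks by auto
  qed (use ks in simp_all)
qed

text \<open>If the unit vanishes, the identity of \<open>M\<close> is a monic that it kills, so
  \<open>M\<close> is torsion; a torsion \<open>M\<close> has no nonzero arrow to the torsion-free
  \<open>loc M\<close>.\<close>

lemma loc_zero_iff:
  assumes "obj M"
  shows "loc_unit M = zer M (loc M) \<longleftrightarrow> M \<in> tors"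
proof
  assume "loc_unit M = zer M (loc M)"
  then have "loc_unit M \<cdot> ide M = zer M (loc M)"
    using assms by simp
  then show "M \<in> tors"
    using loc_unit_simps(3)[OF assms] assms monic_ide[OF assms] unfolding torsion_iso_def by fastforce
next
  assume "M \<in> tors"
  then show "loc_unit M = zer M (loc M)"
    using tfree_zer[of "loc_unit M"] assms by simp
qed

end

subsection \<open>The quotient category\<close>

locale quotient_category = localization C add zer tors
  for C :: "('o, 'm) category" and add zer tors +
  fixes a :: "'o \<Rightarrow> 'd" and b :: "'m \<Rightarrow> 'e"
  assumes inj_a: "inj_on a (Obj C)" and inj_b: "inj_on b (Arr C)"
begin

abbreviation "a' \<equiv> inv_into (Obj C) a"
abbreviation "b' \<equiv> inv_into (Arr C) b"

lemma inv_a [simp]: "obj X \<Longrightarrow> a' (a X) = X"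
  using inj_a by simp

lemma inv_b [simp]: "arr f \<Longrightarrow> b' (b f) = f"
  using inj_b by simp

text \<open>A copy, on the types \<open>'d\<close> and \<open>'e\<close>, of the full subcategory of closed objects.\<close>

definition quot :: "('d, 'e) category" where
  "quot = \<lparr>Obj = a ` {X. closed X}, Arr = b ` {f. arr f \<and> closed (dom f) \<and> closed (cod f)},
     Dom = (\<lambda>g. a (dom (b' g))), Cod = (\<lambda>g. a (cod (b' g))), Ident = (\<lambda>Y. b (ide (a' Y))),
     Comp = (\<lambda>g f. b (b' g \<cdot> b' f))\<rparr>"

definition quot_functor :: "('o, 'm, 'd, 'e) fctr" where
  "quot_functor = \<lparr>Src = C, Tgt = quot, on_obj = (\<lambda>X. a (loc X)), on_arr = (\<lambda>f. b (loc_arr f))\<rparr>"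

definition quot_incl :: "('d, 'e, 'o, 'm) fctr" where
  "quot_incl = \<lparr>Src = quot, Tgt = C, on_obj = a', on_arr = b'\<rparr>"

lemma quot_functor_simps:
  "on_obj quot_functor = (\<lambda>X. a (loc X))" "on_arr quot_functor = (\<lambda>f. b (loc_arr f))"
  by (simp_all add: quot_functor_def)

lemma quot_incl_simps: "on_obj quot_incl = a'" "on_arr quot_incl = b'"
  by (simp_all add: quot_incl_def)

text \<open>The extension of the identity along the unit, which exists because \<open>X\<close> is
  closed.\<close>

definition counit :: "'o \<Rightarrow> 'm" where
  "counit X = (SOME h. arr h \<and> dom h = loc X \<and> cod h = X \<and> h \<cdot> loc_unit X = ide X)"

lemma counit_simps [simp]:
  assumes "closed X"
  shows "arr (counit X)" "dom (counit X) = loc X" "cod (counit X) = X" "counit X \<cdot> loc_unit X = ide X"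
proof -
  have "\<exists>h. arr h \<and> dom h = loc X \<and> cod h = X \<and> h \<cdot> loc_unit X = ide X"
    using closed_extend[of X "loc_unit X" "ide X"] assms by auto
  then have "arr (counit X) \<and> dom (counit X) = loc X \<and> cod (counit X) = X \<and> counit X \<cdot> loc_unit X = ide X"
    unfolding counit_def by (rule someI_ex)
  then show "arr (counit X)" "dom (counit X) = loc X" "cod (counit X) = X" "counit X \<cdot> loc_unit X = ide X"
    by simp_all
qed

lemma quot_Obj: "Y \<in> Obj quot \<longleftrightarrow> (\<exists>X. Y = a X \<and> closed X)"
  by (auto simp: quot_def)

lemma quot_Arr: "g \<in> Arr quot \<longleftrightarrow> (\<exists>f. g = b f \<and> arr f \<and> closed (dom f) \<and> closed (cod f))"
  by (auto simp: quot_def)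

lemma quot_simps [simp]:
  "arr f \<Longrightarrow> Dom quot (b f) = a (dom f)" "arr f \<Longrightarrow> Cod quot (b f) = a (cod f)"
  "obj X \<Longrightarrow> Ident quot (a X) = b (ide X)" "arr f \<Longrightarrow> arr g \<Longrightarrow> b g \<cdot>\<^bsub>quot\<^esub> b f = b (g \<cdot> f)"
  by (simp_all add: quot_def)

lemma a_eq_iff: "obj X \<Longrightarrow> obj Y \<Longrightarrow> a X = a Y \<longleftrightarrow> X = Y"
  using inj_a by (auto simp: inj_on_def)

lemma is_category_quot: "is_category quot"
  unfolding is_category_def Hom_def
proof (intro conjI ballI impI)
  fix f assume "f \<in> Arr quot"
  then obtain f' where f: "f = b f'" "arr f'" "closed (dom f')" "closed (cod f')"
    by (auto simp: quot_Arr)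
  then show "Dom quot f \<in> Obj quot" "Cod quot f \<in> Obj quot"
    "f \<cdot>\<^bsub>quot\<^esub> Ident quot (Dom quot f) = f" "Ident quot (Cod quot f) \<cdot>\<^bsub>quot\<^esub> f = f"
    by (auto simp: quot_Obj)
  fix g assume "g \<in> Arr quot"
  then obtain g' where g: "g = b g'" "arr g'" "closed (dom g')" "closed (cod g')"
    by (auto simp: quot_Arr)
  assume "Cod quot f = Dom quot g"
  then have fg: "cod f' = dom g'"
    using f g by (simp add: a_eq_iff)
  show "g \<cdot>\<^bsub>quot\<^esub> f \<in> {f' \<in> Arr quot. Dom quot f' = Dom quot f \<and> Cod quot f' = Cod quot g}"
    using f g fg by (auto simp: quot_Arr)
  fix h assume "h \<in> Arr quot"
  then obtain h' where h: "h = b h'" "arr h'" "closed (dom h')" "closed (cod h')"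
    by (auto simp: quot_Arr)
  assume "Cod quot g = Dom quot h"
  then have gh: "cod g' = dom h'"
    using g h by (simp add: a_eq_iff)
  show "h \<cdot>\<^bsub>quot\<^esub> (g \<cdot>\<^bsub>quot\<^esub> f) = (h \<cdot>\<^bsub>quot\<^esub> g) \<cdot>\<^bsub>quot\<^esub> f"
    using f g h fg gh by simp
qed (auto simp: quot_Obj quot_Arr intro!: exI[of _ "ide _"])

lemma ftr_quot: "ftr C quot quot_functor"
  by (rule ftrI)
    (auto simp: quot_functor_def is_functor_def is_category is_category_quot Hom_def quot_Obj quot_Arr
      loc_arr_ide loc_arr_cmp intro!: exI[of _ "loc_arr _"])

lemma ftr_incl: "ftr quot C quot_incl"
  by (rule ftrI)
    (auto simp: quot_incl_def is_functor_def is_category is_category_quot Hom_def quot_Obj quot_Arr a_eq_iff)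

lemma reflection_quot: "reflection C quot quot_functor quot_incl loc_unit (\<lambda>Y. b (counit (a' Y)))"
proof -
  interpret F: ftr C quot quot_functor by (rule ftr_quot)
  interpret G: ftr quot C quot_incl by (rule ftr_incl)
  note [simp] = quot_functor_simps quot_incl_simps
  show ?thesis
  proof unfold_locales
    show "nat_trans (id_functor C) (comp_functor quot_incl quot_functor) loc_unit"
      unfolding nat_trans_def Hom_def
      using F.is_functor G.is_functor is_category by (auto intro!: is_functor_id is_functor_comp)
    \<comment> \<open>Both sides are arrows from a localization to a closed object, so they are
      compared after the unit, where each becomes \<open>f\<close>.\<close>
    have "counit (cod f) \<cdot> loc_arr f = f \<cdot> counit (dom f)"
      if "arr f" "closed (dom f)" "closed (cod f)" for f
      by (rule loc_unit_cancel[of _ "dom f"])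
        (use that cmp_eq[OF counit_simps(4)[of "cod f"], of f] in auto)
    then have nat: "b f \<cdot>\<^bsub>quot\<^esub> b (counit (dom f)) = b (counit (cod f)) \<cdot>\<^bsub>quot\<^esub> b (loc_arr f)"
      if "arr f" "closed (dom f)" "closed (cod f)" for f
      using that by simp
    have "b (counit X) \<in> Arr quot" if "closed X" for X
      unfolding quot_Arr using that by (intro exI[of _ "counit X"]) simp
    then show "nat_trans (comp_functor quot_functor quot_incl) (id_functor quot) (\<lambda>Y. b (counit (a' Y)))"
      unfolding nat_trans_def Hom_def
      using F.is_functor G.is_functor is_category_quot nat
      by (auto simp: quot_Obj quot_Arr intro!: is_functor_id is_functor_comp simp del: quot_simps(4))
    show "b (counit (a' (on_obj quot_functor X))) \<cdot>\<^bsub>quot\<^esub> on_arr quot_functor (loc_unit X) =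
        Ident quot (on_obj quot_functor X)" if X: "X \<in> Obj C" for X
    proof -
      have "counit (loc X) \<cdot> loc_arr (loc_unit X) = ide (loc X)"
        by (rule loc_unit_cancel[of _ X])
          (use X loc_arr_simps(4)[of "loc_unit X"] cmp_eq[OF counit_simps(4)[of "loc X"], of "loc_unit X"] in auto)
      then show ?thesis
        using X by simp
    qed
    show "on_arr quot_incl (b (counit (a' Y))) \<cdot> loc_unit (on_obj quot_incl Y) = Ident C (on_obj quot_incl Y)"
      if "Y \<in> Obj quot" for Y
      using that by (auto simp: quot_Obj)
    show "full_faithful quot_incl"
      unfolding full_faithful_def bij_betw_def
    proof (intro conjI ballI)
      show "is_functor quot_incl"
        by (rule G.is_functor)
      fix X Y assume "X \<in> Obj (Src quot_incl)" "Y \<in> Obj (Src quot_incl)"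
      then obtain X' Y' where XY: "X = a X'" "Y = a Y'" "closed X'" "closed Y'"
        by (auto simp: quot_Obj)
      show "inj_on (on_arr quot_incl) (Hom (Src quot_incl) X Y)"
      proof (rule inj_onI)
        fix g h assume gh: "g \<in> Hom (Src quot_incl) X Y" "h \<in> Hom (Src quot_incl) X Y"
          "on_arr quot_incl g = on_arr quot_incl h"
        then have "g \<in> Arr quot" "h \<in> Arr quot"
          by (simp_all add: Hom_def)
        then obtain g' h' where "g = b g'" "h = b h'" "arr g'" "arr h'"
          unfolding quot_Arr by blast
        then show "g = h"
          using gh(3) by simp
      qed
      have img: "Hom quot X Y = b ` Hom C X' Y'"
        using XY by (auto simp: Hom_def quot_Arr a_eq_iff)
      have "on_arr quot_incl ` Hom quot X Y = (\<lambda>f. b' (b f)) ` Hom C X' Y'"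
        unfolding img quot_incl_simps image_image ..
      also have "\<dots> = (\<lambda>f. f) ` Hom C X' Y'"
        by (rule image_cong) (auto simp: Hom_def)
      finally have "on_arr quot_incl ` Hom quot X Y = Hom C X' Y'"
        by simp
      then show "on_arr quot_incl ` Hom (Src quot_incl) X Y =
          Hom (Tgt quot_incl) (on_obj quot_incl X) (on_obj quot_incl Y)"
        using XY by simp
    qed
  qed
qed

text \<open>The composite of \<open>quot_incl\<close> with \<open>quot_functor\<close> is the
  localization itself, so \<open>loc_kernel\<close> supplies the hypothesis of
  \<open>left_kernel_of_right_left\<close>; abelianness of the quotient and exactness then come from
  \<open>exact_reflection\<close>.\<close>

lemma quot_functor_exact_ff_radj: "quot_functor \<in> exact_ff_radj C"
  and quot_functor_zero_iff: "obj M \<Longrightarrow> zero_obj quot (on_obj quot_functor M) \<longleftrightarrow> M \<in> tors"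
proof -
  interpret R: reflection C quot quot_functor quot_incl loc_unit "\<lambda>Y. b (counit (a' Y))"
    by (rule reflection_quot)
  interpret R: additive_reflection C quot quot_functor quot_incl loc_unit "\<lambda>Y. b (counit (a' Y))" add zer ..
  interpret R: exact_reflection C quot quot_functor quot_incl loc_unit "\<lambda>Y. b (counit (a' Y))" add zer
  proof
    fix k f assume k: "is_kernel C k f"
    show "is_kernel quot (on_arr quot_functor k) (on_arr quot_functor f)"
      by (rule R.left_kernel_of_right_left[OF k])
        (use loc_kernel[OF k] kernel_simps(1,2)[OF k] in \<open>simp add: quot_functor_simps quot_incl_simps del: R.unit_simps\<close>)
  qed
  have "right_adjoint quot_functor quot_incl"
    unfolding right_adjoint_iff using R.adjunction_axioms by auto
  then show "quot_functor \<in> exact_ff_radj C"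
    unfolding exact_ff_radj_def using R.exact_F R.ff by auto
  show "zero_obj quot (on_obj quot_functor M) \<longleftrightarrow> M \<in> tors" if "obj M"
  proof -
    have "on_obj quot_incl (on_obj quot_functor M) = loc M"
      using that by (simp add: quot_functor_simps quot_incl_simps del: R.unit_simps)
    then show ?thesis
      unfolding R.left_zero_iff[OF that] loc_zero_iff[OF that, symmetric] by simp
  qed
qed

end

section \<open>Left exact radicals and hereditary torsion theories\<close>

locale preradical_functor = cat C + ftr C C \<gamma>
  for C :: "('o, 'm) category" and \<gamma> +
  fixes \<iota> :: "'o \<Rightarrow> 'm"
  assumes incl: "X \<in> Obj C \<Longrightarrow> monic C (\<iota> X)" "X \<in> Obj C \<Longrightarrow> Dom C (\<iota> X) = on_obj \<gamma> X"
      "X \<in> Obj C \<Longrightarrow> Cod C (\<iota> X) = X"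
    and incl_natural: "f \<in> Arr C \<Longrightarrow> f \<cdot>\<^bsub>C\<^esub> \<iota> (Dom C f) = \<iota> (Cod C f) \<cdot>\<^bsub>C\<^esub> on_arr \<gamma> f"
begin

lemma incl_simps [simp]:
  "obj X \<Longrightarrow> arr (\<iota> X)" "obj X \<Longrightarrow> dom (\<iota> X) = on_obj \<gamma> X" "obj X \<Longrightarrow> cod (\<iota> X) = X"
  using incl by auto

end

lemma preradical_iff:
  assumes "is_category C"
  shows "preradical C (\<gamma>, \<iota>) \<longleftrightarrow> preradical_functor C \<gamma> \<iota>"
proof
  assume p: "preradical C (\<gamma>, \<iota>)"
  then have "is_functor \<gamma>" "Src \<gamma> = C" "Tgt \<gamma> = C"
    by (auto simp: preradical_def nat_trans_def)
  then interpret ftr C C \<gamma>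
    by (intro ftrI)
  show "preradical_functor C \<gamma> \<iota>"
    by unfold_locales (use p in \<open>auto simp: preradical_def nat_trans_def Hom_def\<close>)
next
  assume "preradical_functor C \<gamma> \<iota>"
  then interpret preradical_functor C \<gamma> \<iota> .
  show "preradical C (\<gamma>, \<iota>)"
    using is_functor is_category incl incl_natural
    by (auto simp: preradical_def nat_trans_def Hom_def intro!: is_functor_id)
qed

text \<open>Because the inclusions are monic, comparison arrows chosen object by object are
  automatically invertible and natural.\<close>

lemma same_subfunctor_iff:
  assumes "is_category C" "preradical C r" "preradical C s"
  shows "same_subfunctor C r s \<longleftrightarrow>
    (\<forall>M\<in>Obj C. factors_through C (snd r M) (snd s M) \<and> factors_through C (snd s M) (snd r M))"
proof -
  obtain \<gamma> \<iota> \<gamma>' \<iota>' where rs: "r = (\<gamma>, \<iota>)" "s = (\<gamma>', \<iota>')"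
    by (metis surj_pair)
  interpret R: preradical_functor C \<gamma> \<iota>
    using assms rs by (simp add: preradical_iff)
  interpret S: preradical_functor C \<gamma>' \<iota>'
    using assms rs by (simp add: preradical_iff)
  show ?thesis
  proof
    assume "same_subfunctor C r s"
    then obtain \<theta> where \<theta>: "nat_iso \<gamma> \<gamma>' \<theta>" "\<And>M. M \<in> Obj C \<Longrightarrow> \<iota>' M \<cdot>\<^bsub>C\<^esub> \<theta> M = \<iota> M"
      by (auto simp: same_subfunctor_def rs)
    note t = nat_isoD[OF \<theta>(1) R.Src R.Tgt]
    show "\<forall>M\<in>Obj C. factors_through C (snd r M) (snd s M) \<and> factors_through C (snd s M) (snd r M)"
    proof
      fix M assume M: "M \<in> Obj C"
      note tM = t(5,6,7)[OF M]
      obtain g where g: "R.arr (\<theta> M)" "R.arr g" "R.dom g = R.cod (\<theta> M)" "R.cod g = R.dom (\<theta> M)"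
        "g \<cdot>\<^bsub>C\<^esub> \<theta> M = R.ide (R.dom (\<theta> M))" "\<theta> M \<cdot>\<^bsub>C\<^esub> g = R.ide (R.cod (\<theta> M))"
        using R.iso_arrE[OF tM(1)] by metis
      have "factors_through C (\<iota> M) (\<iota>' M)"
        unfolding factors_through_def Bex_def R.Hom_iff
        using \<theta>(2)[OF M] g M tM by (intro exI[of _ "\<theta> M"]) auto
      moreover have "\<iota> M \<cdot>\<^bsub>C\<^esub> g = \<iota>' M"
        unfolding \<theta>(2)[OF M, symmetric] using g M tM by simp
      then have "factors_through C (\<iota>' M) (\<iota> M)"
        unfolding factors_through_def Bex_def R.Hom_iff
        using g M tM by (intro exI[of _ g]) auto
      ultimately show "factors_through C (snd r M) (snd s M) \<and> factors_through C (snd s M) (snd r M)"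
        by (simp add: rs)
    qed
  next
    assume f: "\<forall>M\<in>Obj C. factors_through C (snd r M) (snd s M) \<and> factors_through C (snd s M) (snd r M)"
    then have "\<forall>M\<in>Obj C. \<exists>t. R.arr t \<and> R.dom t = on_obj \<gamma> M \<and> R.cod t = on_obj \<gamma>' M \<and> \<iota>' M \<cdot>\<^bsub>C\<^esub> t = \<iota> M"
      unfolding factors_through_def Bex_def R.Hom_iff rs by auto
    then obtain \<theta> where \<theta>: "\<And>M. M \<in> Obj C \<Longrightarrow> R.arr (\<theta> M)" "\<And>M. M \<in> Obj C \<Longrightarrow> R.dom (\<theta> M) = on_obj \<gamma> M"
      "\<And>M. M \<in> Obj C \<Longrightarrow> R.cod (\<theta> M) = on_obj \<gamma>' M" "\<And>M. M \<in> Obj C \<Longrightarrow> \<iota>' M \<cdot>\<^bsub>C\<^esub> \<theta> M = \<iota> M"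
      by metis
    have "nat_iso \<gamma> \<gamma>' \<theta>"
    proof (rule nat_isoI[OF R.is_functor S.is_functor R.Src S.Src R.Tgt S.Tgt])
      fix M assume M: "M \<in> Obj C"
      obtain g where g: "R.arr g" "R.dom g = on_obj \<gamma>' M" "R.cod g = on_obj \<gamma> M" "\<iota> M \<cdot>\<^bsub>C\<^esub> g = \<iota>' M"
        using f M unfolding factors_through_def Bex_def R.Hom_iff rs by auto
      have "monic C (\<iota>' M \<cdot>\<^bsub>C\<^esub> \<theta> M)"
        using R.incl(1)[OF M] \<theta>(4)[OF M] by simp
      then have "monic C (\<theta> M)"
        by (rule R.monic_of_cmp) (use \<theta> M in auto)
      moreover have "\<iota>' M \<cdot>\<^bsub>C\<^esub> (\<theta> M \<cdot>\<^bsub>C\<^esub> g) = \<iota>' M \<cdot>\<^bsub>C\<^esub> R.ide (on_obj \<gamma>' M)"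
        using R.cmp_eq[OF \<theta>(4)[OF M], of g] \<theta>(1-3)[OF M] g M by simp
      then have "\<theta> M \<cdot>\<^bsub>C\<^esub> g = R.ide (on_obj \<gamma>' M)"
        by (rule R.monic_cancel[OF S.incl(1)[OF M]]) (use \<theta>(1-3)[OF M] g M in auto)
      ultimately show "iso_arr C (\<theta> M)"
        by (intro R.iso_of_split[of _ g]) (use \<theta>(1-3)[OF M] g M in auto)
    next
      fix f assume f: "f \<in> Arr C"
      let ?X = "R.dom f" and ?Y = "R.cod f"
      have X: "?X \<in> Obj C" and Y: "?Y \<in> Obj C" using f by auto
      have "\<iota>' ?Y \<cdot>\<^bsub>C\<^esub> (on_arr \<gamma>' f \<cdot>\<^bsub>C\<^esub> \<theta> ?X) = f \<cdot>\<^bsub>C\<^esub> (\<iota>' ?X \<cdot>\<^bsub>C\<^esub> \<theta> ?X)"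
        using R.cmp_eq[OF S.incl_natural[OF f, symmetric], of "\<theta> ?X"] f \<theta>(1-3)[OF X] by simp
      also have "\<dots> = (\<iota>' ?Y \<cdot>\<^bsub>C\<^esub> \<theta> ?Y) \<cdot>\<^bsub>C\<^esub> on_arr \<gamma> f"
        unfolding \<theta>(4)[OF X] \<theta>(4)[OF Y] using R.incl_natural[OF f] .
      also have "\<dots> = \<iota>' ?Y \<cdot>\<^bsub>C\<^esub> (\<theta> ?Y \<cdot>\<^bsub>C\<^esub> on_arr \<gamma> f)"
        using f \<theta>(1-3)[OF Y] by simp
      finally show "on_arr \<gamma>' f \<cdot>\<^bsub>C\<^esub> \<theta> ?X = \<theta> ?Y \<cdot>\<^bsub>C\<^esub> on_arr \<gamma> f"
        by (rule R.monic_cancel[OF S.incl(1)[OF Y]]) (use \<theta>(1-3)[OF X] \<theta>(1-3)[OF Y] f in auto)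
    qed (use \<theta> in auto)
    then show "same_subfunctor C r s"
      using \<theta>(4) by (auto simp: same_subfunctor_def rs)
  qed
qed

definition torsion_objects :: "('o, 'm) category \<Rightarrow> ('o, 'm) subfunctor \<Rightarrow> 'o set" where
  "torsion_objects C r = {M \<in> Obj C. iso_arr C (snd r M)}"

locale left_exact_radical = abcat C add zer + preradical_functor C \<gamma> \<iota>
  for C :: "('o, 'm) category" and add zer \<gamma> \<iota> +
  assumes rad: "obj M \<Longrightarrow> is_cokernel C p (\<iota> M) \<Longrightarrow> zero_obj C (on_obj \<gamma> (cod p))"
    and pres_kernel: "is_kernel C k f \<Longrightarrow> is_kernel C (on_arr \<gamma> k) (on_arr \<gamma> f)"
begin

abbreviation "T \<equiv> torsion_objects C (\<gamma>, \<iota>)"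

lemma T_iff: "M \<in> T \<longleftrightarrow> obj M \<and> iso_arr C (\<iota> M)"
  by (simp add: torsion_objects_def)

lemma T_iff_epic: "M \<in> T \<longleftrightarrow> obj M \<and> epic C (\<iota> M)"
  unfolding T_iff using mono_epi_iso incl(1) iso_epic by blast

text \<open>Left exactness makes \<open>\<gamma>\<close> of the inclusion a kernel of
  \<open>\<gamma> p\<close>, which is zero since \<open>\<gamma>\<close> is radical. So it is
  invertible, and by naturality it equals the inclusion of
  \<open>\<gamma> (\<gamma> M)\<close>.\<close>

lemma incl_idem:
  assumes "obj M"
  shows "on_obj \<gamma> M \<in> T"
proof -
  obtain p where p: "is_cokernel C p (\<iota> M)"
    using cokernel_exists[of "\<iota> M"] assms by auto
  note ps = cokernel_simps[OF p]
  have k: "is_kernel C (on_arr \<gamma> (\<iota> M)) (on_arr \<gamma> p)"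
    using monic_kernel_of_cokernel[OF incl(1)[OF assms] p] by (rule pres_kernel)
  have "on_arr \<gamma> p = zer (dom (on_arr \<gamma> p)) (cod (on_arr \<gamma> p))"
    by (rule zero_arr_of_zero_obj[OF rad[OF assms p]]) (use ps in auto)
  then have i: "iso_arr C (on_arr \<gamma> (\<iota> M))"
    by (rule kernel_of_zer_iso[OF k])
  have "\<iota> M \<cdot> \<iota> (on_obj \<gamma> M) = \<iota> M \<cdot> on_arr \<gamma> (\<iota> M)"
    using incl_natural[of "\<iota> M"] assms by simp
  then have "\<iota> (on_obj \<gamma> M) = on_arr \<gamma> (\<iota> M)"
    by (rule monic_cancel[OF incl(1)[OF assms]]) (use assms in auto)
  then show ?thesis
    using i assms by (simp add: T_iff)
qed

lemma zer_from_T: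
  assumes "arr f" "dom f \<in> T" "on_arr \<gamma> f = zer (on_obj \<gamma> (dom f)) (on_obj \<gamma> (cod f))"
  shows "f = zer (dom f) (cod f)"
proof (rule epic_cancel)
  show "epic C (\<iota> (dom f))"
    using assms(2) by (simp add: T_iff_epic)
  show "f \<cdot> \<iota> (dom f) = zer (dom f) (cod f) \<cdot> \<iota> (dom f)"
    unfolding incl_natural[OF assms(1)] assms(3) using assms(1) by simp
qed (use assms(1) in auto)

lemma torsion_theory: "torsion_theory C add zer T"
proof -
  interpret torsion_class C add zer T ..
  show ?thesis
  proof
    show "T \<subseteq> Obj C"
      by (auto simp: T_iff)
  next
    fix m assume m: "monic C m" "cod m \<in> T"
    then have ma: "arr m" by simp
    obtain g where g: "is_cokernel C g m"
      using cokernel_exists[OF ma] by blast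
    note gs = cokernel_simps[OF g]
    have k: "is_kernel C m g"
      by (rule monic_kernel_of_cokernel[OF m(1) g])
    let ?N = "cod m"
    obtain i where i: "arr (\<iota> ?N)" "arr i" "dom i = cod (\<iota> ?N)" "cod i = dom (\<iota> ?N)"
      "i \<cdot> \<iota> ?N = ide (dom (\<iota> ?N))" "\<iota> ?N \<cdot> i = ide (cod (\<iota> ?N))"
      using m(2) iso_arrE[of "\<iota> ?N"] unfolding T_iff by metis
    have id: "dom i = ?N" "cod i = on_obj \<gamma> ?N" "\<iota> ?N \<cdot> i = ide ?N"
      using i ma by auto
    have nat: "\<iota> (cod g) \<cdot> on_arr \<gamma> g = g \<cdot> \<iota> ?N"
      using incl_natural[OF gs(1)] gs by simp
    have im: "arr (i \<cdot> m)" "cod (i \<cdot> m) = on_obj \<gamma> ?N"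
      using id(1,2) i(2) ma by simp_all
    have "\<iota> (cod g) \<cdot> (on_arr \<gamma> g \<cdot> (i \<cdot> m)) = (g \<cdot> \<iota> ?N) \<cdot> (i \<cdot> m)"
      by (rule cmp_eq[OF nat]) (use gs(1,3) im in auto)
    also have "\<dots> = g \<cdot> (\<iota> ?N \<cdot> (i \<cdot> m))"
      by (rule cmp_assoc) (use gs(1,3) im ma in auto)
    also have iim: "\<iota> ?N \<cdot> (i \<cdot> m) = ide ?N \<cdot> m"
      by (rule cmp_eq[OF id(3)]) (use id(1,2) i(2) ma in auto)
    finally have "\<iota> (cod g) \<cdot> (on_arr \<gamma> g \<cdot> (i \<cdot> m)) = zer (dom m) (cod g)"
      using gs(4) ma by simp
    then have "on_arr \<gamma> g \<cdot> (i \<cdot> m) = zer (dom m) (on_obj \<gamma> (cod g))"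
      using monic_zerD[OF incl(1)[of "cod g"], of "on_arr \<gamma> g \<cdot> (i \<cdot> m)"] gs(1-3) id(1,2) i(2) ma by simp
    \<comment> \<open>Applied to the inclusion of \<open>m\<close> into
      \<open>\<gamma> ?N = ?N\<close>, preservation of the kernel yields an arrow that splits
      \<open>\<iota> (dom m)\<close>.\<close>
    then obtain y where y: "arr y" "dom y = dom m" "cod y = on_obj \<gamma> (dom m)" "on_arr \<gamma> m \<cdot> y = i \<cdot> m"
      using kernel_factor[OF pres_kernel[OF k], of "i \<cdot> m"] gs(1-3) id(1,2) i(2) ma by auto
    have "m \<cdot> (\<iota> (dom m) \<cdot> y) = \<iota> ?N \<cdot> (on_arr \<gamma> m \<cdot> y)"
      using cmp_eq[OF incl_natural[OF ma], of y] y(1-3) ma by simp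
    also have "\<dots> = m \<cdot> ide (dom m)"
      unfolding y(4) iim using ma by simp
    finally have "\<iota> (dom m) \<cdot> y = ide (dom m)"
      by (rule monic_cancel[OF m(1)]) (use y(1-3) ma in auto)
    then have "iso_arr C (\<iota> (dom m))"
      by (intro iso_of_split[OF incl(1), of _ y]) (use y(1-3) ma in auto)
    then show "dom m \<in> T"
      using ma by (simp add: T_iff)
  next
    fix e assume e: "epic C e" "dom e \<in> T"
    then have ea: "arr e" by simp
    \<comment> \<open>By naturality this epic factors through \<open>\<iota> (cod e)\<close>, which
      is therefore epic and, being monic, invertible.\<close>
    have "epic C (e \<cdot> \<iota> (dom e))"
      using e ea by (intro epic_cmp) (auto simp: T_iff_epic)
    then have "epic C (\<iota> (cod e) \<cdot> on_arr \<gamma> e)"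
      using incl_natural[OF ea] by simp
    then have "epic C (\<iota> (cod e))"
      by (rule epic_of_cmp) (use ea in auto)
    then show "cod e \<in> T"
      using ea by (simp add: T_iff_epic)
  next
    fix M assume M: "obj M"
    obtain p where p: "is_cokernel C p (\<iota> M)"
      using cokernel_exists[of "\<iota> M"] M by auto
    note ps = cokernel_simps[OF p]
    \<comment> \<open>As \<open>\<gamma> (cod p)\<close> is zero, \<open>\<gamma>\<close> kills
      every arrow into \<open>cod p\<close>, and an arrow from a torsion object that
      \<open>\<gamma>\<close> kills is zero.\<close>
    have "tfree (cod p)"
      unfolding tfree_def
    proof (intro conjI allI impI)
      fix f assume f: "arr f" "dom f \<in> T" "cod f = cod p"
      have "on_arr \<gamma> f = zer (dom (on_arr \<gamma> f)) (cod (on_arr \<gamma> f))"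
        by (rule zero_arr_of_zero_obj[OF rad[OF M p]]) (use f ps in auto)
      then show "f = zer (dom f) (cod p)"
        using zer_from_T[OF f(1,2)] f(1,3) by simp
    qed (use ps in simp)
    then show "\<exists>t p. short_exact C t p \<and> cod t = M \<and> dom t \<in> T \<and> tfree (cod p)"
      using short_exactI_monic[OF incl(1)[OF M] p] M incl_idem[OF M]
      by (intro exI[of _ "\<iota> M"] exI[of _ p]) simp
  qed
qed

text \<open>\<open>\<gamma> M\<close> is a torsion object for both, so it equals its own
  \<open>\<gamma>'\<close> part, which naturality maps into \<open>\<gamma>' M\<close>. Hence a left
  exact radical is determined by its torsion objects.\<close>

lemma factors_of_torsion_subset:
  assumes "preradical_functor C \<gamma>' \<iota>'" "T \<subseteq> torsion_objects C (\<gamma>', \<iota>')" "obj M"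
  shows "factors_through C (\<iota> M) (\<iota>' M)"
proof -
  interpret S: preradical_functor C \<gamma>' \<iota>' by fact
  let ?N = "on_obj \<gamma> M"
  have N: "obj ?N" using assms(3) by simp
  have "iso_arr C (\<iota>' ?N)"
    using assms(2) incl_idem[OF assms(3)] by (auto simp: torsion_objects_def)
  then obtain i where i: "arr i" "dom i = cod (\<iota>' ?N)" "cod i = dom (\<iota>' ?N)" "\<iota>' ?N \<cdot> i = ide (cod (\<iota>' ?N))"
    using iso_arrE by metis
  have id: "dom i = ?N" "cod i = on_obj \<gamma>' ?N" "\<iota>' ?N \<cdot> i = ide ?N"
    using i N by auto
  have "\<iota>' M \<cdot> (on_arr \<gamma>' (\<iota> M) \<cdot> i) = \<iota> M"
    using cmp_eq[OF S.incl_natural[of "\<iota> M", symmetric], of i] id i(1) N assms(3) by simp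
  then show ?thesis
    unfolding factors_through_def Bex_def Hom_iff
    using id(1,2) i(1) N assms(3) by (intro exI[of _ "on_arr \<gamma>' (\<iota> M) \<cdot> i"]) simp
qed

end

lemma left_exact_radicalI:
  assumes "abcat C add zer" "radical C (\<gamma>, \<iota>)" "left_exact \<gamma>"
  shows "left_exact_radical C add zer \<gamma> \<iota>"
proof -
  interpret abcat C add zer by fact
  have p: "preradical C (\<gamma>, \<iota>)"
    using assms(2) by (simp add: radical_def)
  interpret preradical_functor C \<gamma> \<iota>
    using p is_category by (simp add: preradical_iff)
  show ?thesis
    by unfold_locales (use assms in \<open>auto simp: radical_def left_exact_def\<close>)
qed

subsection \<open>The radical of an exact reflection\<close>

context exact_reflection
begin

definition rad_incl :: "'o \<Rightarrow> 'm" where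
  "rad_incl M = (SOME k. is_kernel A k (\<eta> M))"

definition rad_arr :: "'m \<Rightarrow> 'm" where
  "rad_arr f = (SOME u. u \<in> Arr A \<and> Dom A u = Dom A (rad_incl (Dom A f)) \<and>
     Cod A u = Dom A (rad_incl (Cod A f)) \<and> rad_incl (Cod A f) \<cdot>\<^bsub>A\<^esub> u = f \<cdot>\<^bsub>A\<^esub> rad_incl (Dom A f))"

definition rad_functor :: "('o, 'm, 'o, 'm) fctr" where
  "rad_functor = \<lparr>Src = A, Tgt = A, on_obj = (\<lambda>M. Dom A (rad_incl M)), on_arr = rad_arr\<rparr>"

lemma rad_incl_kernel:
  assumes "M \<in> Obj A"
  shows "is_kernel A (rad_incl M) (\<eta> M)"
  unfolding rad_incl_def using A.kernel_exists[OF unit_simps(1)[OF assms]] by (rule someI_ex)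

lemma rad_incl_simps [simp]:
  assumes "M \<in> Obj A"
  shows "rad_incl M \<in> Arr A" "Cod A (rad_incl M) = M" "monic A (rad_incl M)"
    "\<eta> M \<cdot>\<^bsub>A\<^esub> rad_incl M = zer (Dom A (rad_incl M)) (on_obj G (on_obj F M))"
  using A.kernel_simps[OF rad_incl_kernel[OF assms]] A.kernel_monic[OF rad_incl_kernel[OF assms]] assms
  by auto

lemma rad_arr_simps:
  assumes "f \<in> Arr A"
  shows "rad_arr f \<in> Arr A" "Dom A (rad_arr f) = Dom A (rad_incl (Dom A f))"
    "Cod A (rad_arr f) = Dom A (rad_incl (Cod A f))"
    "rad_incl (Cod A f) \<cdot>\<^bsub>A\<^esub> rad_arr f = f \<cdot>\<^bsub>A\<^esub> rad_incl (Dom A f)"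
proof -
  have XY: "Dom A f \<in> Obj A" "Cod A f \<in> Obj A" using assms by auto
  have "\<eta> (Cod A f) \<cdot>\<^bsub>A\<^esub> (f \<cdot>\<^bsub>A\<^esub> rad_incl (Dom A f)) =
      zer (Dom A (f \<cdot>\<^bsub>A\<^esub> rad_incl (Dom A f))) (Cod A (\<eta> (Cod A f)))"
    using F.A.cmp_eq[OF unit_natural[OF assms, symmetric], of "rad_incl (Dom A f)"] assms by simp
  then obtain u where "u \<in> Arr A" "Dom A u = Dom A (f \<cdot>\<^bsub>A\<^esub> rad_incl (Dom A f))"
    "Cod A u = Dom A (rad_incl (Cod A f))" "rad_incl (Cod A f) \<cdot>\<^bsub>A\<^esub> u = f \<cdot>\<^bsub>A\<^esub> rad_incl (Dom A f)"
    using A.kernel_factor[OF rad_incl_kernel[OF XY(2)], of "f \<cdot>\<^bsub>A\<^esub> rad_incl (Dom A f)"] assms by auto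
  then have "\<exists>u. u \<in> Arr A \<and> Dom A u = Dom A (rad_incl (Dom A f)) \<and>
     Cod A u = Dom A (rad_incl (Cod A f)) \<and> rad_incl (Cod A f) \<cdot>\<^bsub>A\<^esub> u = f \<cdot>\<^bsub>A\<^esub> rad_incl (Dom A f)"
    using assms by auto
  then have "rad_arr f \<in> Arr A \<and> Dom A (rad_arr f) = Dom A (rad_incl (Dom A f)) \<and>
    Cod A (rad_arr f) = Dom A (rad_incl (Cod A f)) \<and>
    rad_incl (Cod A f) \<cdot>\<^bsub>A\<^esub> rad_arr f = f \<cdot>\<^bsub>A\<^esub> rad_incl (Dom A f)"
    unfolding rad_arr_def by (rule someI_ex)
  then show "rad_arr f \<in> Arr A" "Dom A (rad_arr f) = Dom A (rad_incl (Dom A f))"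
    "Cod A (rad_arr f) = Dom A (rad_incl (Cod A f))"
    "rad_incl (Cod A f) \<cdot>\<^bsub>A\<^esub> rad_arr f = f \<cdot>\<^bsub>A\<^esub> rad_incl (Dom A f)"
    by simp_all
qed

lemmas [simp] = rad_arr_simps(1-3)

lemma rad_functor_simps [simp]: "Src rad_functor = A" "Tgt rad_functor = A" "on_arr rad_functor = rad_arr"
  by (simp_all add: rad_functor_def)

lemma rad_arr_eqI:
  assumes "f \<in> Arr A" "u \<in> Arr A" "Cod A u = Dom A (rad_incl (Cod A f))"
    "rad_incl (Cod A f) \<cdot>\<^bsub>A\<^esub> u = f \<cdot>\<^bsub>A\<^esub> rad_incl (Dom A f)"
  shows "rad_arr f = u"
  by (rule F.A.monic_cancel[of "rad_incl (Cod A f)"]) (use assms rad_arr_simps(4)[OF assms(1)] in auto)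

lemma is_functor_rad: "is_functor rad_functor"
proof -
  have "rad_arr (Ident A X) = Ident A (Dom A (rad_incl X))" if "X \<in> Obj A" for X
    by (rule rad_arr_eqI) (use that in auto)
  moreover have "rad_arr (g \<cdot>\<^bsub>A\<^esub> f) = rad_arr g \<cdot>\<^bsub>A\<^esub> rad_arr f"
    if "f \<in> Arr A" "g \<in> Arr A" "Cod A f = Dom A g" for f g
    by (rule rad_arr_eqI)
      (use that rad_arr_simps(4)[OF that(1)] F.A.cmp_eq[OF rad_arr_simps(4)[OF that(2)], of "rad_arr f"] in auto)
  ultimately show ?thesis
    using F.A.is_category by (auto simp: is_functor_def rad_functor_def Hom_def)
qed

sublocale rad: preradical_functor A rad_functor rad_incl
proof -
  interpret ftr A A rad_functor
    by (rule ftrI[OF is_functor_rad]) simp_all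
  show "preradical_functor A rad_functor rad_incl"
    by unfold_locales (auto simp: rad_functor_def rad_arr_simps(4))
qed

text \<open>The arrows that \<open>F\<close> inverts are determined by the objects that it kills.
  For the converse direction \<open>f\<close> is factored as \<open>m \<cdot> e\<close>:
  \<open>F e\<close> is a cokernel of a zero arrow and \<open>F m\<close> a kernel of a zero
  arrow.\<close>

lemma iso_left_iff:
  assumes "is_kernel A k f" "is_cokernel A q f"
  shows "iso_arr D (on_arr F f) \<longleftrightarrow> zero_obj D (on_obj F (Dom A k)) \<and> zero_obj D (on_obj F (Cod A q))"
proof
  note k = A.kernel_simps[OF assms(1)] and q = A.cokernel_simps[OF assms(2)]
  note Fk = D.kernel_simps[OF left_kernel[OF assms(1)]] and Fq = D.cokernel_simps[OF left_cokernel[OF assms(2)]]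
  assume iso: "iso_arr D (on_arr F f)"
  have "on_arr F k = zerD (Dom D (on_arr F k)) (Cod D (on_arr F k))"
    using D.monic_zerD[OF F.B.iso_monic[OF iso], of "on_arr F k"] Fk by simp
  then have "on_arr F k \<cdot>\<^bsub>D\<^esub> Ident D (on_obj F (Dom A k)) = zerD (on_obj F (Dom A k)) (Cod D (on_arr F k))"
    using k by simp
  then have "Ident D (on_obj F (Dom A k)) = zerD (on_obj F (Dom A k)) (on_obj F (Dom A k))"
    using D.monic_zerD[OF D.kernel_monic[OF left_kernel[OF assms(1)]], of "Ident D (on_obj F (Dom A k))"] k
    by simp
  moreover have "on_arr F q = zerD (Dom D (on_arr F q)) (Cod D (on_arr F q))"
    using D.epic_zerD[OF F.B.iso_epic[OF iso], of "on_arr F q"] Fq by simp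
  then have "Ident D (on_obj F (Cod A q)) \<cdot>\<^bsub>D\<^esub> on_arr F q = zerD (Dom D (on_arr F q)) (on_obj F (Cod A q))"
    using q by simp
  then have "Ident D (on_obj F (Cod A q)) = zerD (on_obj F (Cod A q)) (on_obj F (Cod A q))"
    using D.epic_zerD[OF D.cokernel_epic[OF left_cokernel[OF assms(2)]], of "Ident D (on_obj F (Cod A q))"] q
    by simp
  ultimately show "zero_obj D (on_obj F (Dom A k)) \<and> zero_obj D (on_obj F (Cod A q))"
    using k q by (auto intro!: D.zero_objI)
next
  note q = A.cokernel_simps[OF assms(2)]
  assume z: "zero_obj D (on_obj F (Dom A k)) \<and> zero_obj D (on_obj F (Cod A q))"
  obtain k' e m where i: "is_kernel A k' f" "is_cokernel A e k'" "epic A e" "monic A m"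
    "Dom A e = Dom A f" "Cod A e = Dom A m" "Cod A m = Cod A f" "m \<cdot>\<^bsub>A\<^esub> e = f"
    using A.image_factorization[OF q(2)] .
  note k = A.kernel_simps[OF assms(1)] and k' = A.kernel_simps[OF i(1)]
  have em: "e \<in> Arr A" "m \<in> Arr A" using i by auto
  \<comment> \<open>The factorization comes with its own kernel \<open>k'\<close>; factoring it
    through \<open>k\<close> shows that \<open>F\<close> sends it to zero.\<close>
  obtain u where u: "u \<in> Arr A" "Dom A u = Dom A k'" "Cod A u = Dom A k" "k \<cdot>\<^bsub>A\<^esub> u = k'"
    using A.kernel_factor[OF assms(1) k'(1,3,4)] .
  have "on_arr F u = zerD (Dom D (on_arr F u)) (Cod D (on_arr F u))"
    by (rule D.zero_arr_of_zero_obj[of "on_obj F (Dom A k)"]) (use z u in auto)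
  then have "on_arr F k \<cdot>\<^bsub>D\<^esub> on_arr F u = zerD (on_obj F (Dom A k')) (on_obj F (Cod A k'))"
    using u(1-3) k k' D.cmp_zer[of "on_arr F k" "on_obj F (Dom A k')"] by simp
  then have "on_arr F k' = zerD (Dom D (on_arr F k')) (Cod D (on_arr F k'))"
    using F.cmp[of u k] u k k' by simp
  then have 1: "iso_arr D (on_arr F e)"
    by (rule D.cokernel_of_zer_iso[OF left_cokernel[OF i(2)]])
  have "is_cokernel A q m"
  proof (rule A.cokernelI)
    show "epic A q"
      by (rule A.cokernel_epic[OF assms(2)])
    have "(q \<cdot>\<^bsub>A\<^esub> m) \<cdot>\<^bsub>A\<^esub> e = zer (Dom A e) (Cod A q)"
      using q i em by simp
    then show "q \<cdot>\<^bsub>A\<^esub> m = zer (Dom A m) (Cod A q)"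
      using A.epic_zerD[OF i(3), of "q \<cdot>\<^bsub>A\<^esub> m"] q i em by simp
    fix h assume h: "h \<in> Arr A" "Dom A h = Cod A m" "h \<cdot>\<^bsub>A\<^esub> m = zer (Dom A m) (Cod A h)"
    have "h \<cdot>\<^bsub>A\<^esub> (m \<cdot>\<^bsub>A\<^esub> e) = zer (Dom A e) (Cod A h)"
      using F.A.cmp_eq[OF h(3), of e] h(1,2) i(5,6) em by simp
    then show "\<exists>u. u \<in> Arr A \<and> Dom A u = Cod A q \<and> Cod A u = Cod A h \<and> u \<cdot>\<^bsub>A\<^esub> q = h"
      using A.cokernel_factor[OF assms(2) h(1)] h(2) i by metis
  qed (use em q i in auto)
  then have "is_kernel A m q"
    by (rule A.monic_kernel_of_cokernel[OF i(4)])
  moreover have "on_arr F q = zerD (Dom D (on_arr F q)) (Cod D (on_arr F q))"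
    by (rule D.zero_arr_of_zero_obj[of "on_obj F (Cod A q)"]) (use z q in auto)
  ultimately have 2: "iso_arr D (on_arr F m)"
    by (intro D.kernel_of_zer_iso[OF left_kernel]) auto
  show "iso_arr D (on_arr F f)"
    using F.B.iso_cmp[OF 1 2] F.cmp[of e m] em i by simp
qed

text \<open>\<open>F\<close> kills the kernel of the unit, hence inverts \<open>p\<close>. An arrow
  \<open>x\<close> killed by the unit of the quotient lifts, after an epic \<open>s\<close>, to an
  arrow \<open>y\<close> killed by the unit of \<open>M\<close>; then \<open>y\<close> factors
  through \<open>rad_incl M\<close> and is killed by \<open>p\<close>.\<close>

lemma unit_quotient_monic:
  assumes "M \<in> Obj A" "is_cokernel A p (rad_incl M)"
  shows "monic A (\<eta> (Cod A p))"
proof (rule A.monicI_zer)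
  note p = A.cokernel_simps[OF assms(2)]
  have pe: "epic A p"
    by (rule A.cokernel_epic[OF assms(2)])
  have pd: "Dom A p = M" using p assms by simp
  obtain q where q: "is_cokernel A q (\<eta> M)"
    using A.cokernel_exists[of "\<eta> M"] assms by auto
  have "zero_obj D (on_obj F (Dom A (rad_incl M)))"
    using iso_left_iff[OF rad_incl_kernel[OF assms(1)] q] left_unit_iso[OF assms(1)] by simp
  then have "on_arr F (rad_incl M) = zerD (Dom D (on_arr F (rad_incl M))) (Cod D (on_arr F (rad_incl M)))"
    by (rule D.zero_arr_of_zero_obj) (use assms in auto)
  then have "iso_arr D (on_arr F p)"
    by (rule D.cokernel_of_zer_iso[OF left_cokernel[OF assms(2)]])
  then have iso: "monic A (on_arr G (on_arr F p))"
    by (intro F.A.iso_monic G.iso)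
  fix x assume x: "x \<in> Arr A" "Cod A x = Dom A (\<eta> (Cod A p))"
    "\<eta> (Cod A p) \<cdot>\<^bsub>A\<^esub> x = zer (Dom A x) (Cod A (\<eta> (Cod A p)))"
  have xc: "Cod A x = Cod A p" using x(2) p by simp
  obtain y s where y: "y \<in> Arr A" "epic A s" "Dom A y = Dom A s" "Cod A y = Dom A p" "Cod A s = Dom A x"
    "p \<cdot>\<^bsub>A\<^esub> y = x \<cdot>\<^bsub>A\<^esub> s"
    by (rule A.epic_pullback[OF pe x(1) xc])
  have s: "s \<in> Arr A" using y by simp
  have "on_arr G (on_arr F p) \<cdot>\<^bsub>A\<^esub> (\<eta> M \<cdot>\<^bsub>A\<^esub> y) = \<eta> (Cod A p) \<cdot>\<^bsub>A\<^esub> (p \<cdot>\<^bsub>A\<^esub> y)"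
    using F.A.cmp_eq[OF unit_natural[OF p(1)], of y] pd y(1,4) p(1) assms(1) by simp
  also have "\<dots> = zer (Dom A y) (on_obj G (on_obj F (Cod A p)))"
    unfolding y(6) using F.A.cmp_eq[OF x(3), of s] x(1) xc y(3,5) s p by simp
  finally have "\<eta> M \<cdot>\<^bsub>A\<^esub> y = zer (Dom A y) (Cod A (\<eta> M))"
    using A.monic_zerD[OF iso, of "\<eta> M \<cdot>\<^bsub>A\<^esub> y"] y(1,4) pd p(1) assms(1) by simp
  then obtain z where z: "z \<in> Arr A" "Dom A z = Dom A y" "Cod A z = Dom A (rad_incl M)" "rad_incl M \<cdot>\<^bsub>A\<^esub> z = y"
    using A.kernel_factor[OF rad_incl_kernel[OF assms(1)], of y] y(1,4) pd assms(1) by auto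
  have "p \<cdot>\<^bsub>A\<^esub> (rad_incl M \<cdot>\<^bsub>A\<^esub> z) = zer (Dom A z) (Cod A p)"
    using F.A.cmp_eq[OF p(4), of z] z(1-3) p pd assms(1) by simp
  then have "x \<cdot>\<^bsub>A\<^esub> s = zer (Dom A s) (Cod A x)"
    using z y(3,6) xc by simp
  then show "x = zer (Dom A x) (Dom A (\<eta> (Cod A p)))"
    using A.epic_zerD[OF y(2), of x] x(1) xc y(5) p by simp
qed (use A.cokernel_simps[OF assms(2)] in simp)

text \<open>This says that the torsion part of a subobject is its intersection with the torsion part
  of the whole: \<open>G (F k)\<close> is monic, so \<open>y\<close> is killed by the unit as soon
  as \<open>k \<cdot> y\<close> is.\<close>

lemma rad_left_exact:
  assumes "is_kernel A k f"
  shows "is_kernel A (rad_arr k) (rad_arr f)"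
proof (rule A.kernelI)
  note k = A.kernel_simps[OF assms]
  have km: "monic A k" by (rule A.kernel_monic[OF assms])
  let ?K = "Dom A k" and ?X = "Dom A f" and ?Y = "Cod A f"
  have ob: "?K \<in> Obj A" "?X \<in> Obj A" "?Y \<in> Obj A" using k by auto
  have nk: "rad_incl ?X \<cdot>\<^bsub>A\<^esub> rad_arr k = k \<cdot>\<^bsub>A\<^esub> rad_incl ?K"
    and nf: "rad_incl ?Y \<cdot>\<^bsub>A\<^esub> rad_arr f = f \<cdot>\<^bsub>A\<^esub> rad_incl ?X"
    using rad_arr_simps(4)[OF k(1)] rad_arr_simps(4)[OF k(2)] k(3) by simp_all
  have "monic A (k \<cdot>\<^bsub>A\<^esub> rad_incl ?K)"
    using ob by (intro F.A.monic_cmp km) auto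
  then have "monic A (rad_incl ?X \<cdot>\<^bsub>A\<^esub> rad_arr k)"
    using nk by simp
  then show "monic A (rad_arr k)"
    by (rule F.A.monic_of_cmp) (use k in auto)
  have "rad_arr f \<cdot>\<^bsub>A\<^esub> rad_arr k = rad_arr (f \<cdot>\<^bsub>A\<^esub> k)"
    using rad.cmp[of k f] k by simp
  also have "\<dots> = zer (Dom A (rad_incl ?K)) (Dom A (rad_incl ?Y))"
    by (rule rad_arr_eqI) (use k ob in auto)
  finally show "rad_arr f \<cdot>\<^bsub>A\<^esub> rad_arr k = zer (Dom A (rad_arr k)) (Cod A (rad_arr f))"
    using k by simp
  fix x assume x: "x \<in> Arr A" "Cod A x = Dom A (rad_arr f)"
    "rad_arr f \<cdot>\<^bsub>A\<^esub> x = zer (Dom A x) (Cod A (rad_arr f))"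
  have xc: "Cod A x = Dom A (rad_incl ?X)" using x(2) k by simp
  have "f \<cdot>\<^bsub>A\<^esub> (rad_incl ?X \<cdot>\<^bsub>A\<^esub> x) = rad_incl ?Y \<cdot>\<^bsub>A\<^esub> (rad_arr f \<cdot>\<^bsub>A\<^esub> x)"
    using F.A.cmp_eq[OF nf[symmetric], of x] x(1) xc k(2) ob by simp
  also have "\<dots> = zer (Dom A x) ?Y"
    unfolding x(3) using x(1) k(2) ob by simp
  finally obtain y where y: "y \<in> Arr A" "Dom A y = Dom A x" "Cod A y = ?K" "k \<cdot>\<^bsub>A\<^esub> y = rad_incl ?X \<cdot>\<^bsub>A\<^esub> x"
    using A.kernel_factor[OF assms, of "rad_incl ?X \<cdot>\<^bsub>A\<^esub> x"] x(1) xc ob by auto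
  have un: "on_arr G (on_arr F k) \<cdot>\<^bsub>A\<^esub> \<eta> ?K = \<eta> ?X \<cdot>\<^bsub>A\<^esub> k"
    using unit_natural[OF k(1)] k(3) by simp
  have "on_arr G (on_arr F k) \<cdot>\<^bsub>A\<^esub> (\<eta> ?K \<cdot>\<^bsub>A\<^esub> y) = \<eta> ?X \<cdot>\<^bsub>A\<^esub> (k \<cdot>\<^bsub>A\<^esub> y)"
    using F.A.cmp_eq[OF un, of y] y(1,3) k(1,3) ob by simp
  also have "\<dots> = zer (Dom A y) (on_obj G (on_obj F ?X))"
    unfolding y(4) using F.A.cmp_eq[OF rad_incl_simps(4)[OF ob(2)], of x] x(1) xc y(2) ob by simp
  finally have "\<eta> ?K \<cdot>\<^bsub>A\<^esub> y = zer (Dom A y) (on_obj G (on_obj F ?K))"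
    using A.monic_zerD[OF A.kernel_monic[OF right_kernel[OF left_kernel[OF assms]]], of "\<eta> ?K \<cdot>\<^bsub>A\<^esub> y"]
      y(1,3) k(1,3) ob by simp
  then obtain z where z: "z \<in> Arr A" "Dom A z = Dom A y" "Cod A z = Dom A (rad_incl ?K)" "rad_incl ?K \<cdot>\<^bsub>A\<^esub> z = y"
    using A.kernel_factor[OF rad_incl_kernel[OF ob(1)], of y] y(1,3) ob by auto
  have "rad_incl ?X \<cdot>\<^bsub>A\<^esub> (rad_arr k \<cdot>\<^bsub>A\<^esub> z) = rad_incl ?X \<cdot>\<^bsub>A\<^esub> x"
    using F.A.cmp_eq[OF nk, of z] z y(4) k(1,3) ob by simp
  then have "rad_arr k \<cdot>\<^bsub>A\<^esub> z = x"
    by (rule F.A.monic_cancel[OF rad_incl_simps(3)[OF ob(2)]]) (use z(1-3) x(1) xc k(1,3) ob in auto)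
  then show "\<exists>u. u \<in> Arr A \<and> Dom A u = Dom A x \<and> Cod A u = Dom A (rad_arr k) \<and> rad_arr k \<cdot>\<^bsub>A\<^esub> u = x"
    using z y(2) k by auto
qed (use A.kernel_simps[OF assms] in auto)

lemma rad_radical: "radical A (rad_functor, rad_incl)"
  and rad_functor_left_exact: "left_exact rad_functor"
proof -
  have "zero_obj A (on_obj rad_functor (Cod A p))" if "M \<in> Obj A" "is_cokernel A p (rad_incl M)" for M p
  proof -
    have c: "Cod A p \<in> Obj A"
      using A.cokernel_simps[OF that(2)] by simp
    have "rad_incl (Cod A p) = zer (Dom A (rad_incl (Cod A p))) (Cod A p)"
      using A.monic_zerD[OF unit_quotient_monic[OF that], of "rad_incl (Cod A p)"] c by simp
    then have "rad_incl (Cod A p) \<cdot>\<^bsub>A\<^esub> Ident A (Dom A (rad_incl (Cod A p))) = zer (Dom A (rad_incl (Cod A p))) (Cod A p)"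
      using c by simp
    then have "Ident A (Dom A (rad_incl (Cod A p))) = zer (Dom A (rad_incl (Cod A p))) (Dom A (rad_incl (Cod A p)))"
      using A.monic_zerD[OF rad_incl_simps(3)[OF c], of "Ident A (Dom A (rad_incl (Cod A p)))"] c by simp
    then show ?thesis
      using c by (intro A.zero_objI) auto
  qed
  then show "radical A (rad_functor, rad_incl)"
    using rad.preradical_functor_axioms F.A.is_category by (auto simp: radical_def preradical_iff)
  show "left_exact rad_functor"
    unfolding left_exact_def using is_functor_rad A.abelian rad_left_exact
    by simp
qed

lemma torsion_objects_rad:
  "torsion_objects A (rad_functor, rad_incl) = {M \<in> Obj A. zero_obj D (on_obj F M)}"
proof -
  have "iso_arr A (rad_incl M) \<longleftrightarrow> \<eta> M = zer M (on_obj G (on_obj F M))" if M: "M \<in> Obj A" for M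
  proof
    assume "iso_arr A (rad_incl M)"
    then show "\<eta> M = zer M (on_obj G (on_obj F M))"
      using A.epic_zerD[OF F.A.iso_epic, of "rad_incl M" "\<eta> M"] M by simp
  next
    assume "\<eta> M = zer M (on_obj G (on_obj F M))"
    then show "iso_arr A (rad_incl M)"
      using M by (intro A.kernel_of_zer_iso[OF rad_incl_kernel[OF M]]) simp
  qed
  then show ?thesis
    by (auto simp: torsion_objects_def left_zero_iff)
qed

end

section \<open>Exact functors with a full and faithful right adjoint\<close>

context additive_cat
begin

text \<open>A monic detects zero composites, so composing with it changes neither condition for a
  kernel.\<close>

lemma kernel_cmp_monic_iff:
  assumes "monic C m" "arr e" "cod e = dom m"
  shows "is_kernel C k (m \<cdot> e) \<longleftrightarrow> is_kernel C k e"
proof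
  assume k: "is_kernel C k (m \<cdot> e)"
  note ks = kernel_simps[OF k]
  have m: "arr m" using assms by simp
  have kc: "cod k = dom e" using ks m assms by simp
  show "is_kernel C k e"
  proof (rule kernelI[OF kernel_monic[OF k]])
    have "m \<cdot> (e \<cdot> k) = zer (dom k) (cod m)"
      using ks(4) ks(1) kc m assms by simp
    then show "e \<cdot> k = zer (dom k) (cod e)"
      using monic_zerD[OF assms(1), of "e \<cdot> k"] ks(1) kc m assms by simp
    fix h assume h: "arr h" "cod h = dom e" "e \<cdot> h = zer (dom h) (cod e)"
    have "(m \<cdot> e) \<cdot> h = m \<cdot> (e \<cdot> h)"
      using h(1,2) m assms by simp
    also have "\<dots> = zer (dom h) (cod (m \<cdot> e))"
      unfolding h(3) using h(1,2) m assms by simp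
    finally show "\<exists>u. arr u \<and> dom u = dom h \<and> cod u = dom k \<and> k \<cdot> u = h"
      using kernel_factor[OF k h(1)] h(2) m assms by (metis cmp_simps(2))
  qed (use kc assms in auto)
next
  assume k: "is_kernel C k e"
  note ks = kernel_simps[OF k]
  have m: "arr m" using assms by simp
  show "is_kernel C k (m \<cdot> e)"
  proof (rule kernelI[OF kernel_monic[OF k]])
    show "(m \<cdot> e) \<cdot> k = zer (dom k) (cod (m \<cdot> e))"
      using ks m assms by simp
    fix h assume h: "arr h" "cod h = dom (m \<cdot> e)" "(m \<cdot> e) \<cdot> h = zer (dom h) (cod (m \<cdot> e))"
    then have "e \<cdot> h = zer (dom h) (cod e)"
      using monic_zerD[OF assms(1), of "e \<cdot> h"] m assms by simp
    then show "\<exists>u. arr u \<and> dom u = dom h \<and> cod u = dom k \<and> k \<cdot> u = h"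
      using kernel_factor[OF k h(1)] h(2) m assms by (metis cmp_simps(2))
  qed (use ks m assms in auto)
qed

end

text \<open>Exactness is defined on short exact sequences, the locale asks for all kernels.
  Factoring \<open>f = m \<cdot> e\<close> closes the gap: \<open>k\<close> is the kernel of the
  epic \<open>e\<close>, and \<open>F m\<close> stays monic because \<open>m\<close> starts a short
  exact sequence.\<close>

lemma exact_ff_radj_reflection:
  assumes "F \<in> exact_ff_radj A" "abcat A add zer"
  obtains G \<eta> \<epsilon> where "exact_reflection A (Tgt F) F G \<eta> \<epsilon> add zer"
proof -
  define D where "D = Tgt F"
  then have F: "Src F = A" "exact F" "Tgt F = D"
    using assms(1) by (auto simp: exact_ff_radj_def)
  obtain G where "right_adjoint F G" "full_faithful G"
    using assms(1) unfolding exact_ff_radj_def by blast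
  moreover from this(1) obtain \<eta> \<epsilon> where "adjunction A D F G \<eta> \<epsilon>"
    unfolding right_adjoint_iff F(1,3) by blast
  ultimately interpret R: reflection A D F G \<eta> \<epsilon>
    by (simp add: reflection_def reflection_axioms_def)
  interpret A: abcat A add zer by fact
  interpret R: additive_reflection A D F G \<eta> \<epsilon> add zer ..
  have se: "short_exact D (on_arr F f) (on_arr F g)" if "short_exact A f g" for f g
    using that F by (auto simp: exact_def)
  have "is_kernel D (on_arr F k) (on_arr F f)" if k: "is_kernel A k f" for k f
  proof -
    note ks = A.kernel_simps[OF k]
    obtain l e m where i: "is_kernel A l f" "is_cokernel A e l" "epic A e" "monic A m"
      "Dom A e = Dom A f" "Cod A e = Dom A m" "Cod A m = Cod A f" "m \<cdot>\<^bsub>A\<^esub> e = f"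
      using A.image_factorization[OF ks(2)] .
    have em: "e \<in> Arr A" "m \<in> Arr A" using i by auto
    have "is_kernel A k e"
      using A.kernel_cmp_monic_iff[OF i(4) em(1) i(6)] k i(8) by simp
    then have Fe: "is_kernel D (on_arr F k) (on_arr F e)"
      using se[OF A.short_exactI_epic[OF i(3)]] by (simp add: short_exact_def)
    obtain c where "is_cokernel A c m"
      using A.cokernel_exists[OF em(2)] by blast
    then have "is_kernel D (on_arr F m) (on_arr F c)"
      using se[OF A.short_exactI_monic[OF i(4)]] by (simp add: short_exact_def)
    then have "monic D (on_arr F m)"
      by (rule R.D.kernel_monic)
    then show ?thesis
      using R.D.kernel_cmp_monic_iff[of "on_arr F m" "on_arr F e" "on_arr F k"] Fe em i R.F.cmp[of e m]
      by simp
  qed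
  then show ?thesis
    using that R.additive_reflection_axioms F(3)
    by (auto simp: exact_reflection_def exact_reflection_axioms_def)
qed

text \<open>Composition of functor records is associative on the nose, so the chains of isomorphisms
  below need no associators.\<close>

lemma comp_functor_assoc: "comp_functor H (comp_functor G F) = comp_functor (comp_functor H G) F"
  by (simp add: comp_functor_def)

lemma comp_functor_id: "Src H = C \<Longrightarrow> comp_functor H (id_functor C) = H"
  by (simp add: comp_functor_def id_functor_def)

context adjunction
begin

text \<open>Applying \<open>H\<close> to the unit gives the isomorphism; so a functor that inverts
  the unit factors through \<open>F\<close>, with factor \<open>H G\<close>.\<close>

lemma comp_adjoint_iso:
  assumes "is_functor H" "Src H = A" "\<And>X. X \<in> Obj A \<Longrightarrow> iso_arr (Tgt H) (on_arr H (\<eta> X))"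
  shows "nat_isomorphic (comp_functor (comp_functor H G) F) H"
proof -
  define E where "E = Tgt H"
  interpret H: ftr A E H
    using assms E_def[symmetric] by (intro ftrI) auto
  have "nat_iso H (comp_functor (comp_functor H G) F) (\<lambda>X. on_arr H (\<eta> X))"
  proof (rule nat_isoI[of _ _ A E])
    show "is_functor (comp_functor (comp_functor H G) F)"
      using H.is_functor F.is_functor G.is_functor by (intro is_functor_comp) auto
    fix f assume f: "f \<in> Arr A"
    show "on_arr (comp_functor (comp_functor H G) F) f \<cdot>\<^bsub>E\<^esub> on_arr H (\<eta> (Dom A f)) =
        on_arr H (\<eta> (Cod A f)) \<cdot>\<^bsub>E\<^esub> on_arr H f"
      using H.cmp[of "\<eta> (Dom A f)" "on_arr G (on_arr F f)"] H.cmp[of f "\<eta> (Cod A f)"] unit_natural[OF f] f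
      by simp
  qed (use assms E_def[symmetric] H.is_functor in auto)
  then have "nat_isomorphic H (comp_functor (comp_functor H G) F)"
    by (auto simp: nat_isomorphic_def)
  then show ?thesis
    by (rule nat_isomorphic_sym)
qed

end

context reflection
begin

lemma counit_nat_iso: "nat_isomorphic (comp_functor F G) (id_functor D)"
  using counit counit_iso unfolding nat_isomorphic_def nat_iso_def by (intro exI[of _ \<epsilon>]) auto

end

lemma nat_isomorphic_iso_iff:
  assumes "nat_isomorphic F G" "f \<in> Arr (Src F)"
  shows "iso_arr (Tgt F) (on_arr F f) \<longleftrightarrow> iso_arr (Tgt F) (on_arr G f)"
proof -
  have "iso_arr (Tgt F) (on_arr G f)"
    if asm: "nat_isomorphic F G" "f \<in> Arr (Src F)" "iso_arr (Tgt F) (on_arr F f)"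
    for F G :: "('o, 'm, 'p, 'n) fctr" and f
  proof -
    define A B where AB: "A = Src F" "B = Tgt F"
    obtain t where t: "nat_iso F G t"
      using asm(1) by (auto simp: nat_isomorphic_def)
    note ts = nat_isoD[OF t AB(1,2)[symmetric]]
    interpret F: ftr A B F using ts AB[symmetric] by (intro ftrI) auto
    interpret G: ftr A B G using ts AB[symmetric] by (intro ftrI) auto
    have f: "f \<in> Arr A" and i: "iso_arr B (on_arr F f)"
      using asm by auto
    have XY: "Dom A f \<in> Obj A" "Cod A f \<in> Obj A" using f by auto
    note X = ts(5-7)[OF XY(1)] and Y = ts(5-7)[OF XY(2)]
    obtain s where s: "s \<in> Arr B" "Dom B s = on_obj G (Dom A f)" "Cod B s = on_obj F (Dom A f)"
      "t (Dom A f) \<cdot>\<^bsub>B\<^esub> s = Ident B (on_obj G (Dom A f))"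
      "s \<cdot>\<^bsub>B\<^esub> t (Dom A f) = Ident B (on_obj F (Dom A f))"
      by (rule F.B.iso_arrE[OF X(1)]) (use X in auto)
    have iso_s: "iso_arr B s"
      by (rule F.B.iso_arrI[of _ "t (Dom A f)"]) (use s X in auto)
    have "iso_arr B ((t (Cod A f) \<cdot>\<^bsub>B\<^esub> on_arr F f) \<cdot>\<^bsub>B\<^esub> s)"
      by (intro F.B.iso_cmp iso_s i Y(1)) (use s X Y f in auto)
    also have "(t (Cod A f) \<cdot>\<^bsub>B\<^esub> on_arr F f) \<cdot>\<^bsub>B\<^esub> s = on_arr G f"
      unfolding ts(8)[OF f, symmetric] using s X f by simp
    finally show ?thesis
      by simp
  qed
  from this[OF assms] this[OF nat_isomorphic_sym[OF assms(1)], of f] show ?thesis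
    using assms by (auto simp: nat_isomorphic_def nat_iso_def nat_trans_def)
qed

section \<open>The equivalence of exact functors in terms of the objects they kill\<close>

definition killed_objects :: "('o, 'm, 'd, 'e) fctr \<Rightarrow> 'o set" where
  "killed_objects F = {M \<in> Obj (Src F). zero_obj (Tgt F) (on_obj F M)}"

lemma fctr_sim_iff:
  assumes "abcat A add zer" "F \<in> exact_ff_radj A" "F' \<in> exact_ff_radj A"
  shows "fctr_sim F F' \<longleftrightarrow> killed_objects F = killed_objects F'"
proof -
  obtain G \<eta> \<epsilon> where "exact_reflection A (Tgt F) F G \<eta> \<epsilon> add zer"
    using exact_ff_radj_reflection[OF assms(2,1)] .
  moreover obtain G' \<eta>' \<epsilon>' where "exact_reflection A (Tgt F') F' G' \<eta>' \<epsilon>' add zer"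
    using exact_ff_radj_reflection[OF assms(3,1)] .
  moreover define D D' where D: "D = Tgt F" "D' = Tgt F'"
  ultimately have "exact_reflection A D F G \<eta> \<epsilon> add zer" "exact_reflection A D' F' G' \<eta>' \<epsilon>' add zer"
    by simp_all
  then interpret R: exact_reflection A D F G \<eta> \<epsilon> add zer + S: exact_reflection A D' F' G' \<eta>' \<epsilon>' add zer .
  show ?thesis
  proof
    assume "fctr_sim F F'"
    then obtain H where H: "is_equivalence H" "Src H = D" "Tgt H = D'" "nat_isomorphic (comp_functor H F) F'"
      using D[symmetric] by (auto simp: fctr_sim_def equiv_under_def)
    then obtain K where K: "is_functor H" "is_functor K" "Src K = D'" "Tgt K = D"
      "nat_isomorphic (comp_functor K H) (id_functor D)"
      by (auto simp: is_equivalence_def)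
    interpret H: ftr D D' H using H K by (intro ftrI)
    interpret K: ftr D' D K using K by (intro ftrI)
    \<comment> \<open>An equivalence reflects isomorphisms, so \<open>F\<close> and
      \<open>F'\<close> invert the same arrows.\<close>
    have iso: "iso_arr D (on_arr F f) \<longleftrightarrow> iso_arr D' (on_arr F' f)" if f: "f \<in> Arr A" for f
    proof -
      have "iso_arr D' (on_arr F' f) \<longleftrightarrow> iso_arr D' (on_arr H (on_arr F f))"
        using nat_isomorphic_iso_iff[OF H(4), of f] f by simp
      moreover have "iso_arr D (on_arr F f)" if "iso_arr D' (on_arr H (on_arr F f))"
        using nat_isomorphic_iso_iff[OF K(5), of "on_arr F f"] K.iso[OF that] f by simp
      ultimately show ?thesis
        using H.iso by blast
    qed
    obtain Z where Z: "zero_obj A Z"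
      using R.A.zero_obj_exists by blast
    then have ZA: "Z \<in> Obj A" by (simp add: zero_obj_def)
    have "zero_obj D (on_obj F M) \<longleftrightarrow> zero_obj D' (on_obj F' M)" if M: "M \<in> Obj A" for M
    proof -
      \<comment> \<open>Killing \<open>M\<close> is the same as inverting
        \<open>M \<rightarrow> 0\<close>, whose kernel is \<open>M\<close> and whose cokernel is
        \<open>0\<close>.\<close>
      have "zer M Z \<cdot>\<^bsub>A\<^esub> Ident A M = zer M Z" "Ident A Z \<cdot>\<^bsub>A\<^esub> zer M Z = zer M Z"
        using M ZA by simp_all
      then have kq: "is_kernel A (Ident A M) (zer M Z)" "is_cokernel A (Ident A Z) (zer M Z)"
        using M ZA
        by (auto intro!: R.A.kernelI R.A.cokernelI R.F.A.monic_ide R.F.A.epic_ide)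
      have "zero_obj D (on_obj F Z)" "zero_obj D' (on_obj F' Z)"
        using R.A.zero_obj_ide[OF Z] ZA R.F.ide[of Z] S.F.ide[of Z]
        by (auto intro!: R.D.zero_objI S.D.zero_objI simp: R.left_zer S.left_zer)
      then show ?thesis
        using R.iso_left_iff[OF kq] S.iso_left_iff[OF kq] iso[of "zer M Z"] M ZA by simp
    qed
    then show "killed_objects F = killed_objects F'"
      by (auto simp: killed_objects_def)
  next
    assume kill: "killed_objects F = killed_objects F'"
    have iso: "iso_arr D (on_arr F f) \<longleftrightarrow> iso_arr D' (on_arr F' f)" if f: "f \<in> Arr A" for f
    proof -
      obtain k q where kq: "is_kernel A k f" "is_cokernel A q f"
        using R.A.kernel_exists R.A.cokernel_exists f by metis
      have "Dom A k \<in> Obj A" "Cod A q \<in> Obj A"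
        using R.A.kernel_simps(1)[OF kq(1)] R.A.cokernel_simps(1)[OF kq(2)] by auto
      then show ?thesis
        unfolding R.iso_left_iff[OF kq] S.iso_left_iff[OF kq] using kill
        by (auto simp: killed_objects_def set_eq_iff)
    qed
    have HF: "nat_isomorphic (comp_functor (comp_functor F' G) F) F'"
      by (rule R.comp_adjoint_iso) (use S.F.is_functor iso R.left_unit_iso in auto)
    have KF: "nat_isomorphic (comp_functor (comp_functor F G') F') F"
      by (rule S.comp_adjoint_iso) (use R.F.is_functor iso S.left_unit_iso in auto)
    define H where "H = comp_functor F' G"
    define K where "K = comp_functor F G'"
    have H: "is_functor H" "Src H = D" "Tgt H = D'" and K: "is_functor K" "Src K = D'" "Tgt K = D"
      using R.F.is_functor R.G.is_functor S.F.is_functor S.G.is_functor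
      by (auto simp: H_def K_def intro!: is_functor_comp)
    \<comment> \<open>Regrouped, \<open>K H\<close> is \<open>F G' F'\<close> after
      \<open>G\<close>; the first factor is isomorphic to \<open>F\<close>, and \<open>F G\<close>
      to the identity by the counit.\<close>
    have "nat_isomorphic (comp_functor K H) (comp_functor F G)"
      unfolding H_def K_def comp_functor_assoc
      by (rule nat_isomorphic_comp_right[OF KF]) (use R.G.is_functor in auto)
    then have KH: "nat_isomorphic (comp_functor K H) (id_functor D)"
      using R.counit_nat_iso by (rule nat_isomorphic_trans)
    have "nat_isomorphic (comp_functor H K) (comp_functor F' G')"
      unfolding H_def K_def comp_functor_assoc
      by (rule nat_isomorphic_comp_right[OF HF]) (use S.G.is_functor in auto)
    then have HK: "nat_isomorphic (comp_functor H K) (id_functor D')"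
      using S.counit_nat_iso by (rule nat_isomorphic_trans)
    have "is_equivalence H"
      unfolding is_equivalence_def using H K KH HK by auto
    then have eq: "equiv_under F F' H"
      unfolding equiv_under_def using H HF by (simp add: H_def)
    have "nat_isomorphic H' H" if H': "equiv_under F F' H'" for H'
    proof -
      have h: "is_functor H'" "Src H' = D" "nat_isomorphic (comp_functor H' F) F'"
        using H' by (auto simp: equiv_under_def is_equivalence_def)
      have "nat_isomorphic (comp_functor H' (comp_functor F G)) (comp_functor H' (id_functor D))"
        by (rule nat_isomorphic_comp_left[OF R.counit_nat_iso]) (use h in auto)
      then have "nat_isomorphic H' (comp_functor (comp_functor H' F) G)"
        unfolding comp_functor_id[OF h(2)] comp_functor_assoc by (rule nat_isomorphic_sym)
      moreover have "nat_isomorphic (comp_functor (comp_functor H' F) G) H"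
        unfolding H_def by (rule nat_isomorphic_comp_right[OF h(3)]) (use R.G.is_functor in auto)
      ultimately show ?thesis
        by (rule nat_isomorphic_trans)
    qed
    then show "fctr_sim F F'"
      using eq by (auto simp: fctr_sim_def)
  qed
qed

lemma fctr_class_eq_iff:
  assumes "abcat A add zer" "F \<in> exact_ff_radj A" "F' \<in> exact_ff_radj A"
  shows "fctr_class A F = fctr_class A F' \<longleftrightarrow> killed_objects F = killed_objects F'"
proof -
  have "fctr_class A F = {H \<in> exact_ff_radj A. killed_objects F = killed_objects H}"
    "fctr_class A F' = {H \<in> exact_ff_radj A. killed_objects F' = killed_objects H}"
    using fctr_sim_iff[OF assms(1)] assms(2,3) by (auto simp: fctr_class_def)
  then show ?thesis
    using assms(2,3) by auto
qed

section \<open>Classes of left exact radicals and their torsion objects\<close>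

lemma torsion_objects_same:
  assumes "is_category C" "preradical C r" "preradical C s" "same_subfunctor C r s"
  shows "torsion_objects C r \<subseteq> torsion_objects C s"
proof
  fix M assume "M \<in> torsion_objects C r"
  then have M: "M \<in> Obj C" "iso_arr C (snd r M)"
    by (auto simp: torsion_objects_def)
  obtain \<gamma> \<iota> \<gamma>' \<iota>' where rs: "r = (\<gamma>, \<iota>)" "s = (\<gamma>', \<iota>')"
    by (metis surj_pair)
  interpret R: preradical_functor C \<gamma> \<iota>
    using assms rs by (simp add: preradical_iff)
  interpret S: preradical_functor C \<gamma>' \<iota>'
    using assms rs by (simp add: preradical_iff)
  have "factors_through C (snd r M) (snd s M)"
    using assms(4) M(1) unfolding same_subfunctor_iff[OF assms(1-3)] by blast
  then have "factors_through C (\<iota> M) (\<iota>' M)"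
    by (simp add: rs)
  then obtain t where t: "R.arr t" "R.dom t = on_obj \<gamma> M" "R.cod t = on_obj \<gamma>' M" "\<iota>' M \<cdot>\<^bsub>C\<^esub> t = \<iota> M"
    unfolding factors_through_def Bex_def R.Hom_iff using M(1) by auto
  have "iso_arr C (\<iota> M)"
    using M(2) rs by simp
  then obtain g where g: "R.arr g" "R.dom g = M" "R.cod g = on_obj \<gamma> M" "\<iota> M \<cdot>\<^bsub>C\<^esub> g = R.ide M"
    by (rule R.iso_arrE) (use M(1) in auto)
  have "\<iota>' M \<cdot>\<^bsub>C\<^esub> (t \<cdot>\<^bsub>C\<^esub> g) = R.ide M"
    using R.cmp_eq[OF t(4), of g] t(1-3) g M(1) by simp
  then have "iso_arr C (\<iota>' M)"
    by (intro R.iso_of_split[OF S.incl(1), of M "t \<cdot>\<^bsub>C\<^esub> g"]) (use t(1-3) g M(1) in auto)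
  then show "M \<in> torsion_objects C s"
    using M(1) rs by (simp add: torsion_objects_def)
qed

lemma same_subfunctor_eq_iff:
  assumes "abcat A add zer" "radical A r" "left_exact (fst r)" "radical A s" "left_exact (fst s)"
  shows "{u. preradical A u \<and> same_subfunctor A r u} = {u. preradical A u \<and> same_subfunctor A s u} \<longleftrightarrow>
    torsion_objects A r = torsion_objects A s"
proof -
  interpret abcat A add zer by fact
  obtain \<gamma> \<iota> \<gamma>' \<iota>' where rs: "r = (\<gamma>, \<iota>)" "s = (\<gamma>', \<iota>')"
    by (metis surj_pair)
  interpret R: left_exact_radical A add zer \<gamma> \<iota>
    using left_exact_radicalI[OF assms(1)] assms rs by simp
  interpret S: left_exact_radical A add zer \<gamma>' \<iota>'
    using left_exact_radicalI[OF assms(1)] assms rs by simp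
  have p: "preradical A r" "preradical A s"
    using assms(2,4) rs by (auto simp: radical_def)
  note same = same_subfunctor_iff[OF is_category]
  have trans: "factors_through A i k" if ft: "factors_through A i j" "factors_through A j k" "arr k" for i j k
  proof -
    obtain u v where "arr u" "dom u = dom i" "cod u = dom j" "j \<cdot>\<^bsub>A\<^esub> u = i"
      "arr v" "dom v = dom j" "cod v = dom k" "k \<cdot>\<^bsub>A\<^esub> v = j"
      using ft unfolding factors_through_def Bex_def Hom_iff by blast
    then have "arr (v \<cdot>\<^bsub>A\<^esub> u) \<and> dom (v \<cdot>\<^bsub>A\<^esub> u) = dom i \<and> cod (v \<cdot>\<^bsub>A\<^esub> u) = dom k \<and>
        k \<cdot>\<^bsub>A\<^esub> (v \<cdot>\<^bsub>A\<^esub> u) = i"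
      using ft(3) cmp_eq[of k v j u] by simp
    then show ?thesis
      unfolding factors_through_def Bex_def Hom_iff by blast
  qed
  have arr_snd: "arr (snd u M)" if "preradical A u" "obj M" for u M
    using that by (auto simp: preradical_def nat_trans_def Hom_def)
  show ?thesis
  proof
    assume eq: "{u. preradical A u \<and> same_subfunctor A r u} = {u. preradical A u \<and> same_subfunctor A s u}"
    \<comment> \<open>Reflexivity puts \<open>r\<close> and \<open>s\<close> into their own classes,
      so equality of the classes relates them in both directions.\<close>
    have refl: "same_subfunctor A u u" if u: "preradical A u" for u
    proof -
      have "factors_through A (snd u M) (snd u M)" if M: "obj M" for M
        unfolding factors_through_def Bex_def Hom_iff
        using arr_snd[OF u M] by (intro exI[of _ "ide (dom (snd u M))"]) auto
      then show ?thesis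
        unfolding same[OF u u] by blast
    qed
    have "same_subfunctor A r s" "same_subfunctor A s r"
      using eq refl p by blast+
    then show "torsion_objects A r = torsion_objects A s"
      using torsion_objects_same[OF is_category] p by blast
  next
    assume eq: "torsion_objects A r = torsion_objects A s"
    \<comment> \<open>Each inclusion of torsion classes gives one factorization, and the equality
      gives both.\<close>
    have rs': "factors_through A (snd r M) (snd s M)" "factors_through A (snd s M) (snd r M)" if "obj M" for M
      using R.factors_of_torsion_subset[OF S.preradical_functor_axioms _ that]
        S.factors_of_torsion_subset[OF R.preradical_functor_axioms _ that] eq rs by auto
    show "{u. preradical A u \<and> same_subfunctor A r u} = {u. preradical A u \<and> same_subfunctor A s u}"
    proof (intro Collect_cong conj_cong refl)
      fix u assume u: "preradical A u"
      show "same_subfunctor A r u \<longleftrightarrow> same_subfunctor A s u"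
        unfolding same[OF p(1) u] same[OF p(2) u] using rs' trans arr_snd[OF p(1)] arr_snd[OF p(2)] arr_snd[OF u]
        by blast
    qed
  qed
qed

text \<open>Two maps with the same fibres have images in bijection: any preimage under
  \<open>f\<close> may be used to define the value of \<open>h\<close>.\<close>

lemma bij_betw_same_fibres:
  assumes "\<And>x y. x \<in> X \<Longrightarrow> y \<in> X \<Longrightarrow> f x = f y \<longleftrightarrow> t x = t y"
  shows "\<exists>h. bij_betw h (f ` X) (t ` X)"
proof -
  define h where "h = t \<circ> inv_into X f"
  have h: "h (f x) = t x" if "x \<in> X" for x
    using that assms[of "inv_into X f (f x)" x] inv_into_into[of "f x" f X] f_inv_into_f[of "f x" f X]
    by (simp add: h_def)
  have "bij_betw h (f ` X) (t ` X)"
    unfolding bij_betw_def inj_on_def using h assms by (auto simp: image_image)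
  then show ?thesis
    by blast
qed

text \<open>Here \<open>f\<close> and \<open>g\<close> send representatives to their classes, and
  \<open>t\<close> and \<open>s\<close> are complete invariants with a common range that links the
  two quotients.\<close>

lemma bij_betw_quotients:
  assumes "\<And>x y. x \<in> X \<Longrightarrow> y \<in> X \<Longrightarrow> f x = f y \<longleftrightarrow> t x = t y"
    and "\<And>x y. x \<in> Y \<Longrightarrow> y \<in> Y \<Longrightarrow> g x = g y \<longleftrightarrow> s x = s y"
    and "t ` X = s ` Y"
  shows "\<exists>\<Phi>. bij_betw \<Phi> (f ` X) (g ` Y)"
proof -
  obtain h k where "bij_betw h (f ` X) (t ` X)" "bij_betw k (g ` Y) (s ` Y)"
    using bij_betw_same_fibres[of X f t] bij_betw_same_fibres[of Y g s] assms(1,2) by blast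
  then have "bij_betw (inv_into (g ` Y) k \<circ> h) (f ` X) (g ` Y)"
    using assms(3) bij_betw_inv_into bij_betw_trans by metis
  then show ?thesis
    by blast
qed

theorem proposition3p1:
  fixes A :: "('o, 'm) category"
  assumes "infinite (UNIV :: 'u set)"
    and "locally_noetherian_grothendieck TYPE('u) A"
    and "enough_injectives A"
    and "\<exists>a :: 'o \<Rightarrow> 'd. inj_on a (Obj A)"
    and "\<exists>b :: 'm \<Rightarrow> 'e. inj_on b (Arr A)"
  shows "\<exists>\<Phi>. bij_betw \<Phi> (left_exact_radicals A)
                (fctr_classes A :: ('o, 'm, 'd, 'e) fctr set set)"
proof -
  have "abelian A"
    using assms(2) by (simp add: locally_noetherian_grothendieck_def grothendieck_def)
  then obtain add zer where A: "abcat A add zer"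
    using abelian_abcat by blast
  obtain a :: "'o \<Rightarrow> 'd" and b :: "'m \<Rightarrow> 'e" where ab: "inj_on a (Obj A)" "inj_on b (Arr A)"
    using assms(4,5) by blast
  define X where "X = {r. radical A r \<and> left_exact (fst r)}"
  let ?f = "\<lambda>r. {s. preradical A s \<and> same_subfunctor A r s}"
  let ?Y = "exact_ff_radj A :: ('o, 'm, 'd, 'e) fctr set"
  have X: "left_exact_radicals A = ?f ` X"
    unfolding left_exact_radicals_def X_def image_Collect ..
  have Y: "fctr_classes A = fctr_class A ` ?Y"
    by (auto simp: fctr_classes_def)
  \<comment> \<open>The invariants are known to separate classes; what remains is that the same sets
    of objects occur as torsion classes and as kernels of functors.\<close>
  have "torsion_objects A ` X = killed_objects ` ?Y"
  proof (intro equalityI subsetI)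
    fix T assume "T \<in> torsion_objects A ` X"
    then obtain \<gamma> \<iota> where r: "radical A (\<gamma>, \<iota>)" "left_exact \<gamma>" "T = torsion_objects A (\<gamma>, \<iota>)"
      by (auto simp: X_def)
    interpret R: left_exact_radical A add zer \<gamma> \<iota>
      using A r by (intro left_exact_radicalI)
    interpret torsion_theory A add zer T
      using R.torsion_theory r(3) by simp
    interpret quotient_category A add zer T a b
      using assms(3) ab by unfold_locales
    have "T = killed_objects quot_functor"
      using quot_functor_zero_iff tors_obj by (auto simp: killed_objects_def quot_functor_def)
    then show "T \<in> killed_objects ` ?Y"
      using quot_functor_exact_ff_radj by blast
  next
    fix T assume "T \<in> killed_objects ` ?Y"
    then obtain F where F: "F \<in> ?Y" "T = killed_objects F"
      by blast
    define D where "D = Tgt F"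
    obtain G \<eta> \<epsilon> where "exact_reflection A D F G \<eta> \<epsilon> add zer"
      using exact_ff_radj_reflection[OF F(1) A] unfolding D_def .
    then interpret R: exact_reflection A D F G \<eta> \<epsilon> add zer .
    have "T = torsion_objects A (R.rad_functor, R.rad_incl)"
      using F(1) by (simp add: F(2) R.torsion_objects_rad killed_objects_def exact_ff_radj_def)
    moreover have "(R.rad_functor, R.rad_incl) \<in> X"
      using R.rad_radical R.rad_functor_left_exact by (simp add: X_def)
    ultimately show "T \<in> torsion_objects A ` X"
      by blast
  qed
  then have "\<exists>\<Phi>. bij_betw \<Phi> (?f ` X) (fctr_class A ` ?Y)"
  proof (rule bij_betw_quotients[rotated 2])
    fix r s assume "r \<in> X" "s \<in> X"
    then show "?f r = ?f s \<longleftrightarrow> torsion_objects A r = torsion_objects A s"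
      by (intro same_subfunctor_eq_iff[OF A]) (simp_all add: X_def)
  qed (rule fctr_class_eq_iff[OF A])
  then show ?thesis
    unfolding X Y .
qed

end
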